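(* Let $\alpha=\sum_{i,j,k} c^{ij}_k X^k\,\partial_i\wedge\partial_j$ be a linear Poisson structure on $\mathbb{R}^d$, with Poisson bracket $\{\cdot,\cdot\}$, and let $m$ be the commutative product on $A=C^\infty(\mathbb{R}^d)$. Then the initial value problem for the star-product at tree-level $$\star|_{\epsilon=0}=m,\qquad \frac{d\star}{d\epsilon}\Big|_{\epsilon=0}=\{\cdot,\cdot\}$$ has a unique (semi-classical) solution; that is, there is a unique associative product on $A[[\epsilon]]$ satisfying these initial conditions of the form $$f\star g=\sum_{n\ge 0}\epsilon^n\sum_{\Gamma\in G^0_{n,2}}W_\Gamma\, U_\Gamma(\alpha^n)(f,g),\qquad f,g\in A,$$ with weights $W_\Gamma$, the graphs having no circuits and every internal vertex having at most one incoming edge. Moreover, the coefficients $W_\Gamma$ of the associated Moyal element $Z=\sum_{n\ge0}\epsilon^n\sum_{\Gamma\in G^0_{n,2}}W_\Gamma\Gamma$ are determined inductively from the equations $$W(\Delta_b\Gamma)=0,\qquad \Gamma\in G_{n,3}^{-1},\ n\ge 0.$$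
   Context: Graphs. $G_{n,m}^l$ denotes the set of finite directed graphs with $n$ (unlabeled) internal vertices, $m$ linearly ordered boundary vertices having no outgoing edges, and $2n+m-2+l$ edges, without circuits (directed cycles). In $G^0_{n,2}$ and $G^{-1}_{n,3}$ there are $2n$ edges and each internal vertex has exactly two outgoing edges. Graphs are taken as orientation classes: the two outgoing edges of each internal vertex are ordered, and exchanging their order at one vertex multiplies the graph by $-1$ (so graphs with two parallel edges vanish). Sums over $G$ use one representative of each nonzero class; weights are linear functionals $W$ on the span $H$ of graphs. $b_0$ is the graph with two boundary vertices and no internal vertices; $b_1$ is the graph with one internal vertex whose first edge goes to the left and second edge to the right boundary vertex. Operators. Write $\alpha=\sum\alpha^{ij}\partial_i\otimes\partial_j$, $\alpha^{ij}=-\alpha^{ji}$, normalized so that $\{f,g\}=\sum\alpha^{ij}\partial_if\,\partial_jg$. For $\Gamma$ with $n$ internal vertices, boundary vertices $1,\dots,m$ and edge set $E$, $$U_\Gamma(\alpha^n)(f_1,\dots,f_m)=\sum_{I:E\to\{1,\dots,d\}}\ \prod_{v}\Big(\prod_{e\to v}\partial_{I(e)}\Big)\alpha^{I(e_v^1)I(e_v^2)}\ \prod_{j=1}^m\Big(\prod_{e\to j}\partial_{I(e)}\Big)f_j,$$ where $v$ runs over internal vertices with ordered outgoing edges $e_v^1,e_v^2$, and $e\to x$ means that the edge $e$ ends at $x$. Thus $U_{b_0}=m$ and $U_{b_1}(\alpha)=\{\cdot,\cdot\}$. Composition. $\Gamma_1\circ_i\Gamma_2$ is obtained by replacing the $i$-th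 boundary vertex of $\Gamma_1$ by $\Gamma_2$ and summing over all ways of reattaching the edges of $\Gamma_1$ that ended at that vertex to (internal or boundary) vertices of $\Gamma_2$. For graphs with two boundary vertices, $\Gamma_1\circ\Gamma_2=\Gamma_1\circ_1\Gamma_2-\Gamma_1\circ_2\Gamma_2$. Coproduct. For $\Gamma\in G^{-1}_{n,3}$, the reduced coproduct is $\Delta_b\Gamma=\sum(-1)^{|j|}(\Gamma/\gamma)\otimes\gamma$, the sum over subgraphs $\gamma\in G^0_{l,2}$ of $\Gamma$ containing two consecutive boundary vertices of $\Gamma$ (including $\gamma=b_0$) whose collapse to a single boundary vertex gives a graph $\Gamma/\gamma\in G^0_{n-l,2}$; $|j|$ is the number of boundary vertices of $\Gamma$ to the left of $\gamma$. Terms are counted so that $\Delta_b$ is dual to $\circ$: the coefficient of $\Gamma_1\otimes\Gamma_2$ in $\Delta_b\Gamma$ equals the coefficient of $\Gamma$ in $\Gamma_1\circ\Gamma_2$. $W$ is extended by $W(\Gamma_1\otimes\Gamma_2)=W(\Gamma_1)W(\Gamma_2)$. "Tree-level" means that only graphs without circuits are used. For linear $\alpha$ graphs with an internal vertex having more than one incoming edge give zero operators and are discarded.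
   Formalization: Read literally, W(Δ_bΓ)=0 is inconsistent with W(b_0)=W(b_1)=1 already at n=2; it is replaced by Σ_Γ W(Δ_bΓ)U_Γ(α^n)=0, which determines the star-product order by order; the literal values W(Δ_bΓ) are shown to fix the weights inductively. *)

theory Defs
  imports
    "HOL-Analysis.Analysis"
    "HOL-Library.Function_Algebras"
    "HOL-Combinatorics.Permutations"
begin

subsection \<open>Graphs\<close>

datatype vertex = Inner nat | Bdry nat

text \<open>
  A labelled representative of a graph with \<open>n\<close> internal vertices is a list of length \<open>n\<close>: entry \<open>v\<close>
  holds the targets of the first and the second outgoing edge of the internal vertex \<open>v\<close>.
  Boundary vertices are numbered from \<open>0\<close>; their number is not stored in the list, so the empty
  list stands for \<open>b\<^sub>0\<close>, and \<open>b\<^sub>1\<close> is \<open>[(Bdry 0, Bdry 1)]\<close>.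
  An edge is a pair of its source and a flag that is true for the second outgoing edge.
\<close>

type_synonym graph = "(vertex \<times> vertex) list"
type_synonym edge = "nat \<times> bool"

definition vertices :: "nat \<Rightarrow> nat \<Rightarrow> vertex list" where
  "vertices n m = map Inner [0..<n] @ map Bdry [0..<m]"

definition edges :: "graph \<Rightarrow> edge list" where
  "edges \<Gamma> = List.product [0..<length \<Gamma>] [False, True]"

definition target :: "graph \<Rightarrow> edge \<Rightarrow> vertex" where
  "target \<Gamma> e = (if snd e then snd (\<Gamma> ! fst e) else fst (\<Gamma> ! fst e))"

definition incoming :: "graph \<Rightarrow> vertex \<Rightarrow> edge list" where
  "incoming \<Gamma> u = filter (\<lambda>e. target \<Gamma> e = u) (edges \<Gamma>)"

text \<open>
  The graphs without circuits with \<open>n\<close> internal vertices, \<open>m\<close> boundary vertices and two outgoing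
  edges at every internal vertex (hence \<open>2n\<close> edges), without those discarded for a linear \<open>\<alpha>\<close>.
\<close>

definition tree_graphs :: "nat \<Rightarrow> nat \<Rightarrow> graph set" where
  "tree_graphs n m = {\<Gamma>. length \<Gamma> = n
     \<and> (\<forall>e \<in> set (edges \<Gamma>). target \<Gamma> e \<in> set (vertices n m))
     \<and> acyclic {(v, w). \<exists>b. (v, b) \<in> set (edges \<Gamma>) \<and> target \<Gamma> (v, b) = Inner w}
     \<and> (\<forall>v<n. length (incoming \<Gamma> (Inner v)) \<le> 1)}"

fun relabel :: "(nat \<Rightarrow> nat) \<Rightarrow> vertex \<Rightarrow> vertex" where
  "relabel \<sigma> (Inner v) = Inner (\<sigma> v)"
| "relabel \<sigma> (Bdry j) = Bdry j"

text \<open>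
  \<open>\<Gamma>'\<close> arises from \<open>\<Gamma>\<close> by renaming internal vertices along \<open>\<sigma>\<close> and exchanging the two outgoing
  edges at the vertices in \<open>S\<close>; then \<open>\<Gamma>' = s \<Gamma>\<close> as orientation classes.
\<close>

definition oriented_iso :: "int \<Rightarrow> graph \<Rightarrow> graph \<Rightarrow> bool" where
  "oriented_iso s \<Gamma> \<Gamma>' \<longleftrightarrow> length \<Gamma>' = length \<Gamma> \<and>
     (\<exists>\<sigma> S. \<sigma> permutes {..<length \<Gamma>} \<and> S \<subseteq> {..<length \<Gamma>} \<and> s = (-1) ^ card S \<and>
       (\<forall>v<length \<Gamma>. \<Gamma>' ! \<sigma> v =
          (if v \<in> S then prod.swap else id) (map_prod (relabel \<sigma>) (relabel \<sigma>) (\<Gamma> ! v))))"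

definition vanishes :: "graph \<Rightarrow> bool" where
  "vanishes \<Gamma> \<longleftrightarrow> oriented_iso (-1) \<Gamma> \<Gamma>"

definition class_rel :: "nat \<Rightarrow> nat \<Rightarrow> (graph \<times> graph) set" where
  "class_rel n m = {(\<Gamma>, \<Gamma>'). \<Gamma> \<in> tree_graphs n m \<and> \<not> vanishes \<Gamma>
     \<and> \<Gamma>' \<in> tree_graphs n m \<and> \<not> vanishes \<Gamma>' \<and> (\<exists>s. oriented_iso s \<Gamma> \<Gamma>')}"

text \<open>
  One representative of each nonzero class. The values at \<open>m = 2\<close> and \<open>m = 3\<close> are the index sets of
  the sums over \<open>G\<close> in degree \<open>l = 0\<close> and \<open>l = -1\<close>, respectively: \<open>2n + m - 2 + l = 2n\<close>.
\<close>

definition graph_reps :: "nat \<Rightarrow> nat \<Rightarrow> graph set" where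
  "graph_reps n m = (\<lambda>C. SOME \<Gamma>. \<Gamma> \<in> C) `
     ({\<Gamma> \<in> tree_graphs n m. \<not> vanishes \<Gamma>} // class_rel n m)"

text \<open>
  Linear functionals on the span of the graphs modulo \<open>\<Gamma>' = s \<Gamma>\<close>, given by their values on graphs.
  In particular they are zero on vanishing graphs.
\<close>

definition weights :: "(graph \<Rightarrow> real) set" where
  "weights = {W. \<forall>s \<Gamma> \<Gamma>'. oriented_iso s \<Gamma> \<Gamma>' \<longrightarrow> W \<Gamma>' = of_int s * W \<Gamma>}"


subsection \<open>Composition and coproduct\<close>

text \<open>The sign \<open>s\<close> with \<open>T = s \<Gamma>\<close>, and \<open>0\<close> if the class of \<open>T\<close> is zero or is not that of \<open>\<Gamma>\<close> up to sign.\<close>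

definition class_sign :: "graph \<Rightarrow> graph \<Rightarrow> int" where
  "class_sign T \<Gamma> = (if vanishes T then 0 else if oriented_iso 1 T \<Gamma> then 1
     else if oriented_iso (-1) T \<Gamma> then -1 else 0)"

text \<open>
  The terms of the insertion of \<open>\<Gamma>\<^sub>2\<close>, having \<open>m\<close> boundary vertices, at boundary vertex \<open>i\<close> of \<open>\<Gamma>\<^sub>1\<close>.
  The internal vertices of \<open>\<Gamma>\<^sub>2\<close> are numbered after those of \<open>\<Gamma>\<^sub>1\<close>, and its boundary vertices
  become the boundary vertices \<open>i, \<dots>, i + m - 1\<close>.
\<close>

fun embed :: "nat \<Rightarrow> nat \<Rightarrow> vertex \<Rightarrow> vertex" where
  "embed n i (Inner v) = Inner (n + v)"
| "embed n i (Bdry j) = Bdry (i + j)"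

fun reattach :: "nat \<Rightarrow> nat \<Rightarrow> graph \<Rightarrow> nat \<Rightarrow> vertex \<Rightarrow> vertex list" where
  "reattach i m \<Gamma>\<^sub>2 n (Inner v) = [Inner v]"
| "reattach i m \<Gamma>\<^sub>2 n (Bdry j) =
     (if j < i then [Bdry j]
      else if j = i then map (embed n i) (vertices (length \<Gamma>\<^sub>2) m)
      else [Bdry (j + m - 1)])"

definition insertion :: "nat \<Rightarrow> nat \<Rightarrow> graph \<Rightarrow> graph \<Rightarrow> graph list" where
  "insertion i m \<Gamma>\<^sub>1 \<Gamma>\<^sub>2 = (let n = length \<Gamma>\<^sub>1 in
     map (\<lambda>\<Delta>. \<Delta> @ map (map_prod (embed n i) (embed n i)) \<Gamma>\<^sub>2)
       (product_lists
         (map (\<lambda>(a, b). List.product (reattach i m \<Gamma>\<^sub>2 n a) (reattach i m \<Gamma>\<^sub>2 n b)) \<Gamma>\<^sub>1)))"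

text \<open>The coefficient of \<open>\<Gamma>\<close> in \<open>\<Gamma>\<^sub>1 \<circ> \<Gamma>\<^sub>2 = \<Gamma>\<^sub>1 \<circ>\<^sub>1 \<Gamma>\<^sub>2 - \<Gamma>\<^sub>1 \<circ>\<^sub>2 \<Gamma>\<^sub>2\<close>, for graphs with two boundary vertices.\<close>

definition composition_coeff :: "graph \<Rightarrow> graph \<Rightarrow> graph \<Rightarrow> int" where
  "composition_coeff \<Gamma>\<^sub>1 \<Gamma>\<^sub>2 \<Gamma> =
     (\<Sum>T\<leftarrow>insertion 0 2 \<Gamma>\<^sub>1 \<Gamma>\<^sub>2. class_sign T \<Gamma>) - (\<Sum>T\<leftarrow>insertion 1 2 \<Gamma>\<^sub>1 \<Gamma>\<^sub>2. class_sign T \<Gamma>)"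

text \<open>
  The coefficient of \<open>\<Gamma>\<^sub>1 \<otimes> \<Gamma>\<^sub>2\<close> in \<open>\<Delta>\<^sub>b \<Gamma>\<close>. A term \<open>T\<close> of \<open>\<Gamma>\<^sub>1 \<circ>\<^sub>j \<Gamma>\<^sub>2\<close> in the class of \<open>\<Gamma>\<close> exhibits \<open>\<Gamma>\<^sub>2\<close> as
  a subgraph \<open>\<gamma>\<close> of \<open>\<Gamma>\<close> on the boundary vertices \<open>j, j + 1\<close> (numbered from 1) with \<open>\<Gamma>/\<gamma> = \<Gamma>\<^sub>1\<close>, and
  \<open>j - 1\<close> boundary vertices lie to the left of \<open>\<gamma>\<close>. Counting these terms, rather than the subgraphs
  of a labelled representative, is what makes \<open>\<Delta>\<^sub>b\<close> dual to \<open>\<circ>\<close> in the presence of automorphisms.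
\<close>

definition coproduct :: "graph \<Rightarrow> graph \<times> graph \<Rightarrow> int" where
  "coproduct \<Gamma> = (\<lambda>(\<Gamma>\<^sub>1, \<Gamma>\<^sub>2). composition_coeff \<Gamma>\<^sub>1 \<Gamma>\<^sub>2 \<Gamma>)"

text \<open>\<open>W(\<Delta>\<^sub>b \<Gamma>)\<close>, where \<open>l\<close> is the number of internal vertices of \<open>\<gamma>\<close>\<close>

definition weight_coproduct :: "(graph \<Rightarrow> real) \<Rightarrow> graph \<Rightarrow> real" where
  "weight_coproduct W \<Gamma> =
     (\<Sum>l\<le>length \<Gamma>. \<Sum>\<Gamma>\<^sub>1\<in>graph_reps (length \<Gamma> - l) 2. \<Sum>\<Gamma>\<^sub>2\<in>graph_reps l 2.
        of_int (coproduct \<Gamma> (\<Gamma>\<^sub>1, \<Gamma>\<^sub>2)) * (W \<Gamma>\<^sub>1 * W \<Gamma>\<^sub>2))"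


subsection \<open>Smooth functions and linear Poisson structures\<close>

definition pd :: "'d::finite \<Rightarrow> (real^'d \<Rightarrow> real) \<Rightarrow> real^'d \<Rightarrow> real" where
  "pd i f = (\<lambda>x. frechet_derivative f (at x) (axis i 1))"

definition smooth_functions :: "(real^'d::finite \<Rightarrow> real) set" where
  "smooth_functions = {f. \<forall>is x. foldr pd is f differentiable (at x)}"

type_synonym 'd bivector = "'d \<Rightarrow> 'd \<Rightarrow> real^'d \<Rightarrow> real"

text \<open>
  The components \<open>\<alpha>\<^sup>i\<^sup>j\<close>, in \<open>\<alpha> = \<Sum> \<alpha>\<^sup>i\<^sup>j \<partial>\<^sub>i \<otimes> \<partial>\<^sub>j\<close>, of \<open>\<alpha> = \<Sum> c i j k X\<^sup>k \<partial>\<^sub>i \<and> \<partial>\<^sub>j\<close>, with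
  \<open>\<partial>\<^sub>i \<and> \<partial>\<^sub>j = \<partial>\<^sub>i \<otimes> \<partial>\<^sub>j - \<partial>\<^sub>j \<otimes> \<partial>\<^sub>i\<close> and no symmetry assumed of \<open>c\<close>.
\<close>

definition linear_bivector :: "('d \<Rightarrow> 'd \<Rightarrow> 'd \<Rightarrow> real) \<Rightarrow> 'd::finite bivector" where
  "linear_bivector c i j = (\<lambda>x. \<Sum>k\<in>UNIV. (c i j k - c j i k) * x $ k)"

definition bracket ::
  "'d::finite bivector \<Rightarrow> (real^'d \<Rightarrow> real) \<Rightarrow> (real^'d \<Rightarrow> real) \<Rightarrow> real^'d \<Rightarrow> real" where
  "bracket \<alpha> f g = (\<lambda>x. \<Sum>i\<in>UNIV. \<Sum>j\<in>UNIV. \<alpha> i j x * pd i f x * pd j g x)"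

definition poisson_structure :: "'d::finite bivector \<Rightarrow> bool" where
  "poisson_structure \<alpha> \<longleftrightarrow>
     (\<forall>i j. \<alpha> i j \<in> smooth_functions) \<and> (\<forall>i j x. \<alpha> j i x = - \<alpha> i j x) \<and>
     (\<forall>f\<in>smooth_functions. \<forall>g\<in>smooth_functions. \<forall>h\<in>smooth_functions.
        bracket \<alpha> f (bracket \<alpha> g h) + bracket \<alpha> g (bracket \<alpha> h f)
          + bracket \<alpha> h (bracket \<alpha> f g) = 0)"


subsection \<open>Operators of graphs\<close>

definition diff_along ::
  "graph \<Rightarrow> (edge \<Rightarrow> 'd) \<Rightarrow> vertex \<Rightarrow> (real^'d::finite \<Rightarrow> real) \<Rightarrow> real^'d \<Rightarrow> real" where
  "diff_along \<Gamma> I u h = foldr (\<lambda>e. pd (I e)) (incoming \<Gamma> u) h"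

definition graph_op ::
  "'d::finite bivector \<Rightarrow> graph \<Rightarrow> (real^'d \<Rightarrow> real) list \<Rightarrow> real^'d \<Rightarrow> real" where
  "graph_op \<alpha> \<Gamma> fs = (\<lambda>x. \<Sum>I \<in> set (edges \<Gamma>) \<rightarrow>\<^sub>E UNIV.
     (\<Prod>v<length \<Gamma>. diff_along \<Gamma> I (Inner v) (\<alpha> (I (v, False)) (I (v, True))) x) *
     (\<Prod>j<length fs. diff_along \<Gamma> I (Bdry j) (fs ! j) x))"

text \<open>The coefficient of \<open>\<epsilon>\<^sup>n\<close> in \<open>f \<star> g\<close>\<close>

definition star_coeff ::
  "'d::finite bivector \<Rightarrow> (graph \<Rightarrow> real) \<Rightarrow> nat \<Rightarrow>
   (real^'d \<Rightarrow> real) \<Rightarrow> (real^'d \<Rightarrow> real) \<Rightarrow> real^'d \<Rightarrow> real" where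
  "star_coeff \<alpha> W n f g = (\<lambda>x. \<Sum>\<Gamma>\<in>graph_reps n 2. W \<Gamma> * graph_op \<alpha> \<Gamma> [f, g] x)"


subsection \<open>Star-products\<close>

definition smooth_series :: "(real^'d::finite \<Rightarrow> real) fps set" where
  "smooth_series = {F. \<forall>n. fps_nth F n \<in> smooth_functions}"

text \<open>
  The product on \<open>A[[\<epsilon>]]\<close> given by weights on \<open>A\<close>, extended bilinearly over \<open>\<real>[[\<epsilon>]]\<close>. It is made
  \<open>undefined\<close> outside of \<open>A[[\<epsilon>]]\<close>, so that products on \<open>A[[\<epsilon>]]\<close> are equal when they agree there.
\<close>

definition star_product ::
  "'d::finite bivector \<Rightarrow> (graph \<Rightarrow> real) \<Rightarrow>
   (real^'d \<Rightarrow> real) fps \<Rightarrow> (real^'d \<Rightarrow> real) fps \<Rightarrow> (real^'d \<Rightarrow> real) fps" where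
  "star_product \<alpha> W = (\<lambda>F\<in>smooth_series. \<lambda>G\<in>smooth_series. Abs_fps (\<lambda>n.
     \<Sum>a\<le>n. \<Sum>b\<le>n - a. star_coeff \<alpha> W (n - a - b) (fps_nth F a) (fps_nth G b)))"

definition initial_conditions ::
  "'d::finite bivector \<Rightarrow>
   ((real^'d \<Rightarrow> real) fps \<Rightarrow> (real^'d \<Rightarrow> real) fps \<Rightarrow> (real^'d \<Rightarrow> real) fps) \<Rightarrow> bool" where
  "initial_conditions \<alpha> star \<longleftrightarrow> (\<forall>f\<in>smooth_functions. \<forall>g\<in>smooth_functions.
     fps_nth (star (fps_const f) (fps_const g)) 0 = f * g \<and>
     fps_nth (fps_deriv (star (fps_const f) (fps_const g))) 0 = bracket \<alpha> f g)"

definition associative_product ::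
  "((real^'d::finite \<Rightarrow> real) fps \<Rightarrow> (real^'d \<Rightarrow> real) fps \<Rightarrow> (real^'d \<Rightarrow> real) fps) \<Rightarrow> bool" where
  "associative_product star \<longleftrightarrow>
     (\<forall>F\<in>smooth_series. \<forall>G\<in>smooth_series. star F G \<in> smooth_series) \<and>
     (\<forall>F\<in>smooth_series. \<forall>G\<in>smooth_series. \<forall>H\<in>smooth_series.
        star (star F G) H = star F (star G H))"

definition semiclassical_solution ::
  "'d::finite bivector \<Rightarrow>
   ((real^'d \<Rightarrow> real) fps \<Rightarrow> (real^'d \<Rightarrow> real) fps \<Rightarrow> (real^'d \<Rightarrow> real) fps) \<Rightarrow> bool" where
  "semiclassical_solution \<alpha> star \<longleftrightarrow>
     (\<exists>W\<in>weights. star = star_product \<alpha> W) \<and> associative_product star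
     \<and> initial_conditions \<alpha> star"


subsection \<open>The equations for the weights\<close>

text \<open>
  In the span of the graphs, where no Jacobi relation is imposed, the equations \<open>W(\<Delta>\<^sub>b \<Gamma>) = 0\<close> with
  \<open>W(b\<^sub>0) = W(b\<^sub>1) = 1\<close> have no solution. With boundary vertices \<open>1, 2, 3\<close> and internal vertices
  \<open>u, v\<close>, put
  \<open>P\<close>: \<open>u \<rightarrow> (1, 2), v \<rightarrow> (u, 2)\<close> and \<open>Q\<close>: \<open>u \<rightarrow> (1, 2), v \<rightarrow> (u, 1)\<close>, of weights \<open>p\<close> and \<open>q\<close>; then
    \<^item> \<open>u \<rightarrow> (1, 2), v \<rightarrow> (u, 3)\<close> requires \<open>1 - p = 0\<close>;
    \<^item> \<open>u \<rightarrow> (2, 3), v \<rightarrow> (u, 1)\<close> requires \<open>1 + q = 0\<close>;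
    \<^item> \<open>u \<rightarrow> (3, 1), v \<rightarrow> (u, 2)\<close> requires \<open>p - q = 0\<close>.

  The sum of the three graphs is the Jacobiator, whose operator is zero, and the star-product has
  \<open>p = 1/3, q = -1/3\<close>. The equations are therefore read modulo the linear relations between the
  operators of the graphs with \<open>n\<close> internal vertices.
\<close>

definition moyal_equation :: "'d::finite bivector \<Rightarrow> (graph \<Rightarrow> real) \<Rightarrow> nat \<Rightarrow> bool" where
  "moyal_equation \<alpha> W n \<longleftrightarrow>
     (\<forall>f\<in>smooth_functions. \<forall>g\<in>smooth_functions. \<forall>h\<in>smooth_functions. \<forall>x.
        (\<Sum>\<Gamma>\<in>graph_reps n 3. weight_coproduct W \<Gamma> * graph_op \<alpha> \<Gamma> [f, g, h] x) = 0)"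

definition agree_below :: "nat \<Rightarrow> (graph \<Rightarrow> real) \<Rightarrow> (graph \<Rightarrow> real) \<Rightarrow> bool" where
  "agree_below n W W' \<longleftrightarrow> (\<forall>k<n. \<forall>\<Gamma>\<in>graph_reps k 2. W \<Gamma> = W' \<Gamma>)"

end

theory Submission
  imports Defs "HOL-Computational_Algebra.Polynomial"
begin

text \<open>
  Since \<open>\<alpha>\<close> is linear, the graphs at hand are forests of binary trees. On exponentials
  \<open>f\<^sub>j = exp (p\<^sub>j x)\<close> the operator of such a graph is multiplication by its symbol, a polynomial in the
  covectors \<open>p\<^sub>j\<close> that is homogeneous of degree \<open>N\<close>, the number of edges ending at the boundary. A
  multidifferential operator is determined by its values on exponentials, because finitely many
  derivatives of a smooth function at a point are those of a linear combination of exponentials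
  (\<open>jet_interpolation\<close>). The product of two exponentials adds the covectors, so that the Hochschild
  differential becomes the coboundary of the additive group of covectors, and the theorem becomes a
  statement on polynomial group cocycles.

  A forest with \<open>n \<ge> 2\<close> internal vertices has \<open>N \<ge> n + 1 \<ge> 3\<close> (\<open>card_leaf_edges\<close>), and doubling all
  covectors multiplies its symbol by \<open>2\<^sup>N\<close>. Up to coboundaries, however, doubling acts on group cocycles
  through permutations of the arguments: on 2-cocycles its eigenvalues are \<open>2\<close> and \<open>4\<close>, on 3-cocycles
  they are \<open>2\<close>, \<open>4\<close> and \<open>8\<close>, where \<open>8\<close> belongs to the alternating cocycles. Comparing eigenvalues gives

    \<^item> uniqueness (\<open>two_cocycle_zero\<close>, \<open>star_coeff_unique_step\<close>): two choices for order \<open>n\<close> differ by a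
      2-cocycle, which vanishes, since the symbol of a nonempty forest is zero when all its
      covectors are equal;
    \<^item> existence (\<open>three_cocycle_coboundary\<close>, \<open>weights_correction_step\<close>): if the product is associative
      below order \<open>n\<close>, then by the pentagon identity its associator of order \<open>n\<close> is a 3-cocycle. It has
      no alternating part: the eigenvalue \<open>8\<close> requires \<open>N = 3\<close>, hence \<open>n = 2\<close>, and there the alternating
      part is the Jacobiator of the Poisson bracket. So it is the coboundary of an explicit combination
      of its own values at linear combinations of two covectors. Such substitutions amount to sending
      the edges at the boundary to new boundary vertices, so the primitive is again a combination of
      graphs, and changing the weights of the graphs with \<open>n\<close> vertices removes the associator.

  The equations for the weights are the associativity equations by the duality of composition and
  coproduct (\<open>associator_moyal\<close>), whose core is that the operator of an insertion of graphs is the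
  composition of operators (\<open>graph_operator_insertion\<close>).

  That the values \<open>W(\<Delta>\<^sub>b \<Gamma>)\<close> determine the weights of order \<open>n\<close> (\<open>coproduct_determines_weights\<close>) is
  a statement on graphs and not on operators. For a graph \<open>\<Gamma>\<^sub>0\<close> of order \<open>n \<ge> 2\<close> there is a graph
  \<open>\<Gamma>\<close> with three boundary vertices for which \<open>\<Gamma>\<^sub>0\<close> is the only graph whose weight of order \<open>n\<close>
  enters \<open>W(\<Delta>\<^sub>b \<Gamma>)\<close>.
\<close>

section \<open>Smooth functions and exponentials\<close>

lemma pd_eqI: "(f has_derivative D) (at x) \<Longrightarrow> pd i f x = D (axis i 1)"
  by (simp add: pd_def frechet_derivative_at[symmetric])

lemma smooth_differentiable: "f \<in> smooth_functions \<Longrightarrow> f differentiable (at x)"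
  unfolding smooth_functions_def by (auto dest: spec[of _ "[]"])

lemma smooth_has_derivative:
  "f \<in> smooth_functions \<Longrightarrow> (f has_derivative frechet_derivative f (at x)) (at x)"
  using smooth_differentiable frechet_derivative_works by blast

lemma smooth_pd [intro, simp]: "f \<in> smooth_functions \<Longrightarrow> pd i f \<in> smooth_functions"
proof -
  assume f: "f \<in> smooth_functions"
  have "foldr pd (is @ [i]) f differentiable (at x)" for "is" x
    using f unfolding smooth_functions_def by blast
  then show ?thesis by (simp add: smooth_functions_def)
qed

lemma smooth_foldr_pd [intro, simp]: "f \<in> smooth_functions \<Longrightarrow> foldr pd is f \<in> smooth_functions"
  by (induction "is") auto

text \<open>
  Smoothness demands all iterated partial derivatives at once; a set of differentiable functions that
  is stable under partial derivatives proves it without an induction on their order.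
\<close>

lemma smooth_coinduct:
  assumes "f \<in> S" and "\<And>g x. g \<in> S \<Longrightarrow> g differentiable (at x)" and "\<And>g i. g \<in> S \<Longrightarrow> pd i g \<in> S"
  shows "f \<in> smooth_functions"
proof -
  have "foldr pd is f \<in> S" for "is" by (induction "is") (use assms in auto)
  then show ?thesis using assms(2) by (auto simp: smooth_functions_def)
qed

lemma pd_add: "f \<in> smooth_functions \<Longrightarrow> g \<in> smooth_functions \<Longrightarrow>
    pd i (\<lambda>x. f x + g x) = (\<lambda>x. pd i f x + pd i g x)"
  by (rule ext, subst pd_eqI[OF has_derivative_add[OF smooth_has_derivative smooth_has_derivative]])
     (auto simp: pd_def)

lemma pd_mult: "f \<in> smooth_functions \<Longrightarrow> g \<in> smooth_functions \<Longrightarrow>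
    pd i (\<lambda>x. f x * g x) = (\<lambda>x. pd i f x * g x + f x * pd i g x)"
  by (rule ext, subst pd_eqI[OF has_derivative_mult[OF smooth_has_derivative smooth_has_derivative]])
     (auto simp: pd_def)

text \<open>
  A set to which coinduction applies: the partial derivatives of a product of smooth functions
  are not products, but sums of products.
\<close>

inductive_set smooth_algebra :: "(real^'d::finite \<Rightarrow> real) set" where
  gen: "f \<in> smooth_functions \<Longrightarrow> f \<in> smooth_algebra"
| add: "f \<in> smooth_algebra \<Longrightarrow> g \<in> smooth_algebra \<Longrightarrow> (\<lambda>x. f x + g x) \<in> smooth_algebra"
| mult: "f \<in> smooth_algebra \<Longrightarrow> g \<in> smooth_algebra \<Longrightarrow> (\<lambda>x. f x * g x) \<in> smooth_algebra"

lemma smooth_algebra_derivative: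
  "f \<in> smooth_algebra \<Longrightarrow> (\<forall>x. f differentiable (at x)) \<and> (\<forall>i. pd i f \<in> smooth_algebra)"
proof (induction rule: smooth_algebra.induct)
  case (gen f)
  then show ?case by (auto simp: smooth_differentiable intro: smooth_algebra.gen)
next
  case (add f g)
  have "pd i (\<lambda>x. f x + g x) = (\<lambda>x. pd i f x + pd i g x)" for i
    by (rule ext, subst pd_eqI[OF has_derivative_add[OF frechet_derivative_works[THEN iffD1] frechet_derivative_works[THEN iffD1]]])
       (use add.IH in \<open>auto simp: pd_def\<close>)
  then show ?case using add by (auto intro: smooth_algebra.add)
next
  case (mult f g)
  have "pd i (\<lambda>x. f x * g x) = (\<lambda>x. f x * pd i g x + pd i f x * g x)" for i
    by (rule ext, subst pd_eqI[OF has_derivative_mult[OF frechet_derivative_works[THEN iffD1] frechet_derivative_works[THEN iffD1]]])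
       (use mult.IH in \<open>auto simp: pd_def\<close>)
  moreover have "(\<lambda>x. f x * pd i g x + pd i f x * g x) \<in> smooth_algebra" for i
    using mult by (intro smooth_algebra.add[OF smooth_algebra.mult smooth_algebra.mult]) auto
  ultimately show ?case using mult by (auto intro: differentiable_mult)
qed

lemma smooth_algebra_smooth: "f \<in> smooth_algebra \<Longrightarrow> f \<in> smooth_functions"
  by (rule smooth_coinduct[of _ smooth_algebra]) (auto simp: smooth_algebra_derivative)

lemma smooth_add [intro]: "f \<in> smooth_functions \<Longrightarrow> g \<in> smooth_functions \<Longrightarrow>
    (\<lambda>x. f x + g x) \<in> smooth_functions"
  by (rule smooth_algebra_smooth, rule smooth_algebra.add; rule smooth_algebra.gen)

lemma smooth_mult [intro]: "f \<in> smooth_functions \<Longrightarrow> g \<in> smooth_functions \<Longrightarrow>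
    (\<lambda>x. f x * g x) \<in> smooth_functions"
  by (rule smooth_algebra_smooth, rule smooth_algebra.mult; rule smooth_algebra.gen)

lemma pd_const [simp]: "pd i (\<lambda>x. c) = (\<lambda>x. 0)"
  by (simp add: pd_def)

lemma smooth_const [simp, intro]: "(\<lambda>x. c) \<in> smooth_functions"
  by (rule smooth_coinduct[of _ "range (\<lambda>c x. c)"]) auto

lemma pd_cmult: "f \<in> smooth_functions \<Longrightarrow> pd i (\<lambda>x. c * f x) = (\<lambda>x. c * pd i f x)"
  by (subst pd_mult) auto

lemma smooth_cmult [intro]: "f \<in> smooth_functions \<Longrightarrow> (\<lambda>x. c * f x) \<in> smooth_functions"
  by (rule smooth_mult) auto

lemma smooth_minus [intro]: "f \<in> smooth_functions \<Longrightarrow> (\<lambda>x. - f x) \<in> smooth_functions"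
  using smooth_cmult[of f "-1"] by simp

lemma smooth_diff [intro]: "f \<in> smooth_functions \<Longrightarrow> g \<in> smooth_functions \<Longrightarrow>
    (\<lambda>x. f x - g x) \<in> smooth_functions"
  using smooth_add[of f "\<lambda>x. - g x"] by auto

lemma smooth_sum [intro]: "(\<And>a. a \<in> A \<Longrightarrow> f a \<in> smooth_functions) \<Longrightarrow>
    (\<lambda>x. \<Sum>a\<in>A. f a x) \<in> smooth_functions"
  by (induction A rule: infinite_finite_induct) auto

lemma smooth_prod [intro]: "(\<And>a. a \<in> A \<Longrightarrow> f a \<in> smooth_functions) \<Longrightarrow>
    (\<lambda>x. \<Prod>a\<in>A. f a x) \<in> smooth_functions"
  by (induction A rule: infinite_finite_induct) auto

lemma pd_sum: "(\<And>a. a \<in> A \<Longrightarrow> f a \<in> smooth_functions) \<Longrightarrow>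
    pd i (\<lambda>x. \<Sum>a\<in>A. f a x) = (\<lambda>x. \<Sum>a\<in>A. pd i (f a) x)"
  by (induction A rule: infinite_finite_induct) (auto simp: pd_add smooth_sum)

lemma foldr_pd_sum: "(\<And>a. a \<in> A \<Longrightarrow> f a \<in> smooth_functions) \<Longrightarrow>
    foldr pd is (\<lambda>x. \<Sum>a\<in>A. f a x) = (\<lambda>x. \<Sum>a\<in>A. foldr pd is (f a) x)"
  by (induction "is") (auto simp: pd_sum)

lemma foldr_pd_cmult: "f \<in> smooth_functions \<Longrightarrow> foldr pd is (\<lambda>x. c * f x) = (\<lambda>x. c * foldr pd is f x)"
  by (induction "is") (auto simp: pd_cmult)

lemma has_derivative_linear_form:
  fixes a :: "'d::finite \<Rightarrow> real"
  shows "((\<lambda>x. \<Sum>k\<in>UNIV. a k * x $ k) has_derivative (\<lambda>h. \<Sum>k\<in>UNIV. a k * h $ k)) (at x)"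
  by (rule has_derivative_sum, rule has_derivative_mult_right,
      rule bounded_linear_imp_has_derivative, rule bounded_linear_vec_nth)

lemma pd_linear_form:
  fixes a :: "'d::finite \<Rightarrow> real"
  shows "pd i (\<lambda>x. \<Sum>k\<in>UNIV. a k * x $ k) = (\<lambda>x. a i)"
proof
  fix x
  have "(\<Sum>k\<in>UNIV. a k * axis i 1 $ k) = a i"
    by (simp add: axis_def if_distrib cong: if_cong)
  then show "pd i (\<lambda>x. \<Sum>k\<in>UNIV. a k * x $ k) x = a i"
    by (subst pd_eqI[OF has_derivative_linear_form]) simp
qed

lemma smooth_linear_form [intro]:
  fixes a :: "'d::finite \<Rightarrow> real"
  shows "(\<lambda>x. \<Sum>k\<in>UNIV. a k * x $ k) \<in> smooth_functions"
  by (rule smooth_coinduct[of _ "range (\<lambda>c x. c) \<union> range (\<lambda>a x. \<Sum>k\<in>UNIV. a k * x $ k)"])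
     (auto simp: pd_linear_form intro: differentiableI has_derivative_linear_form)

definition expo :: "('d::finite \<Rightarrow> real) \<Rightarrow> real^'d \<Rightarrow> real" where
  "expo p = (\<lambda>x. exp (\<Sum>k\<in>UNIV. p k * x $ k))"

lemma has_derivative_expo: "(expo p has_derivative (\<lambda>h. expo p x * (\<Sum>k\<in>UNIV. p k * h $ k))) (at x)"
  using has_derivative_exp[OF has_derivative_linear_form[of p x]]
  by (simp add: expo_def mult.commute)

lemma pd_cexpo: "pd i (\<lambda>x. c * expo p x) = (\<lambda>x. (c * p i) * expo p x)"
proof
  fix x
  have *: "(\<Sum>k\<in>UNIV. p k * axis i 1 $ k) = p i"
    by (simp add: axis_def if_distrib cong: if_cong)
  show "pd i (\<lambda>x. c * expo p x) x = (c * p i) * expo p x"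
    by (subst pd_eqI[OF has_derivative_mult_right[OF has_derivative_expo]]) (simp add: *)
qed

lemma smooth_expo [intro, simp]: "expo p \<in> smooth_functions"
proof (rule smooth_coinduct[of _ "range (\<lambda>c x. c * expo p x)"])
  show "expo p \<in> range (\<lambda>c x. c * expo p x)" by (rule image_eqI[of _ _ 1]) auto
  show "g differentiable at x" if "g \<in> range (\<lambda>c x. c * expo p x)" for g x
    using that has_derivative_mult_right[OF has_derivative_expo] by (fastforce simp: differentiable_def)
qed (auto simp: pd_cexpo)

lemma foldr_pd_expo: "foldr pd is (expo p) = (\<lambda>x. (\<Prod>i\<leftarrow>is. p i) * expo p x)"
proof (induction "is")
  case (Cons a "is")
  then show ?case using pd_cexpo[of a "\<Prod>i\<leftarrow>is. p i" p] by (simp add: mult_ac)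
qed simp

lemma expo_add: "expo p x * expo q x = expo (\<lambda>k. p k + q k) x"
  by (simp add: expo_def exp_add[symmetric] sum.distrib distrib_right)

lemma expo_nonzero [simp]: "expo p x \<noteq> 0"
  by (simp add: expo_def)

section \<open>Symmetry of second derivatives\<close>

lemma has_real_derivative_along_axis:
  assumes "f \<in> smooth_functions"
  shows "((\<lambda>s. f (y + s *\<^sub>R axis i 1)) has_real_derivative pd i f (y + s *\<^sub>R axis i 1)) (at s within A)"
proof -
  let ?F = "frechet_derivative f (at (y + s *\<^sub>R axis i 1))"
  have 1: "((\<lambda>s. y + s *\<^sub>R axis i 1) has_derivative (\<lambda>h. h *\<^sub>R axis i 1)) (at s within A)"
    by (auto intro!: derivative_eq_intros)
  have "((\<lambda>s. f (y + s *\<^sub>R axis i 1)) has_derivative (\<lambda>h. ?F (h *\<^sub>R axis i 1))) (at s within A)"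
    using has_derivative_compose[OF 1 smooth_has_derivative[OF assms]] by simp
  moreover have "linear ?F" by (rule linear_frechet_derivative[OF smooth_differentiable[OF assms]])
  ultimately show ?thesis
    by (simp add: has_field_derivative_def pd_def linear_scale mult_commute_abs)
qed

text \<open>
  The mean value theorem, applied once in each of the two directions. The left-hand side is symmetric
  in the two directions, which is what equates the two mixed derivatives in the limit.
\<close>

lemma mixed_difference_quotient:
  assumes f: "f \<in> smooth_functions" and h: "h > 0"
  shows "\<exists>s t. 0 < s \<and> s < h \<and> 0 < t \<and> t < h \<and>
    f (x + h *\<^sub>R axis j 1 + h *\<^sub>R axis i 1) - f (x + h *\<^sub>R axis i 1) - f (x + h *\<^sub>R axis j 1) + f x
     = h\<^sup>2 * pd j (pd i f) (x + s *\<^sub>R axis i 1 + t *\<^sub>R axis j 1)"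
proof -
  define G where "G s = f ((x + h *\<^sub>R axis j 1) + s *\<^sub>R axis i 1) - f (x + s *\<^sub>R axis i 1)" for s
  define G' where "G' s = pd i f ((x + h *\<^sub>R axis j 1) + s *\<^sub>R axis i 1) - pd i f (x + s *\<^sub>R axis i 1)" for s
  have "DERIV G s :> G' s" for s unfolding G_def G'_def
    by (intro DERIV_diff has_real_derivative_along_axis f)
  from MVT2[OF h this] obtain s where s: "0 < s" "s < h" "G h - G 0 = (h - 0) * G' s" by auto
  define K where "K t = pd i f ((x + s *\<^sub>R axis i 1) + t *\<^sub>R axis j 1)" for t
  have "DERIV K t :> pd j (pd i f) ((x + s *\<^sub>R axis i 1) + t *\<^sub>R axis j 1)" for t unfolding K_def
    by (intro has_real_derivative_along_axis smooth_pd f)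
  from MVT2[OF h this] obtain t where t: "0 < t" "t < h"
    "K h - K 0 = (h - 0) * pd j (pd i f) ((x + s *\<^sub>R axis i 1) + t *\<^sub>R axis j 1)" by auto
  have "G' s = K h - K 0" by (simp add: G'_def K_def add_ac)
  then have "G h - G 0 = h\<^sup>2 * pd j (pd i f) (x + s *\<^sub>R axis i 1 + t *\<^sub>R axis j 1)"
    using s t by (simp add: power2_eq_square mult_ac)
  then show ?thesis using s t by (intro exI[of _ s] exI[of _ t]) (simp add: G_def)
qed

lemma pd_commute:
  assumes f: "f \<in> smooth_functions"
  shows "pd i (pd j f) = pd j (pd i f)"
proof
  fix x
  let ?h = "\<lambda>n. inverse (real (Suc n))"
  have "\<exists>s t s' t'. 0 < s \<and> s < ?h n \<and> 0 < t \<and> t < ?h n \<and> 0 < s' \<and> s' < ?h n \<and> 0 < t' \<and> t' < ?h n \<and>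
     pd j (pd i f) (x + s *\<^sub>R axis i 1 + t *\<^sub>R axis j 1) = pd i (pd j f) (x + s' *\<^sub>R axis j 1 + t' *\<^sub>R axis i 1)" for n
  proof -
    have h: "?h n > 0" by simp
    have swap: "f (x + u + v) = f (x + v + u)" for u v by (simp add: add_ac)
    obtain s t where 1: "0 < s \<and> s < ?h n \<and> 0 < t \<and> t < ?h n"
      "f (x + ?h n *\<^sub>R axis j 1 + ?h n *\<^sub>R axis i 1) - f (x + ?h n *\<^sub>R axis i 1) - f (x + ?h n *\<^sub>R axis j 1) + f x
       = (?h n)\<^sup>2 * pd j (pd i f) (x + s *\<^sub>R axis i 1 + t *\<^sub>R axis j 1)"
      using mixed_difference_quotient[OF f h, of x j i] by auto
    obtain s' t' where 2: "0 < s' \<and> s' < ?h n \<and> 0 < t' \<and> t' < ?h n"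
      "f (x + ?h n *\<^sub>R axis i 1 + ?h n *\<^sub>R axis j 1) - f (x + ?h n *\<^sub>R axis j 1) - f (x + ?h n *\<^sub>R axis i 1) + f x
       = (?h n)\<^sup>2 * pd i (pd j f) (x + s' *\<^sub>R axis j 1 + t' *\<^sub>R axis i 1)"
      using mixed_difference_quotient[OF f h, of x i j] by auto
    have "(?h n)\<^sup>2 * pd j (pd i f) (x + s *\<^sub>R axis i 1 + t *\<^sub>R axis j 1)
        = (?h n)\<^sup>2 * pd i (pd j f) (x + s' *\<^sub>R axis j 1 + t' *\<^sub>R axis i 1)"
      using 1(2) 2(2) swap[of "?h n *\<^sub>R axis j 1" "?h n *\<^sub>R axis i 1"] by linarith
    moreover have "(?h n)\<^sup>2 \<noteq> 0" by simp
    ultimately show ?thesis using 1(1) 2(1) by (metis mult_cancel_left)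
  qed
  then obtain s t s' t' where st: "\<And>n. 0 < s n \<and> s n < ?h n \<and> 0 < t n \<and> t n < ?h n \<and> 0 < s' n \<and> s' n < ?h n \<and> 0 < t' n \<and> t' n < ?h n"
    and eq: "\<And>n. pd j (pd i f) (x + s n *\<^sub>R axis i 1 + t n *\<^sub>R axis j 1) = pd i (pd j f) (x + s' n *\<^sub>R axis j 1 + t' n *\<^sub>R axis i 1)"
    by metis
  have lim: "u \<longlonglongrightarrow> 0" if "\<And>n. 0 < u n \<and> u n < ?h n" for u :: "nat \<Rightarrow> real"
    using that by (intro tendsto_sandwich[OF _ _ tendsto_const LIMSEQ_inverse_real_of_nat])
       (auto intro!: always_eventually simp: less_imp_le)
  have c: "isCont (pd a (pd b f)) x" for a b
    using smooth_differentiable[of "pd a (pd b f)" x] f differentiable_imp_continuous_within by blast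
  have "(\<lambda>n. x + s n *\<^sub>R axis i 1 + t n *\<^sub>R axis j 1) \<longlonglongrightarrow> x + 0 *\<^sub>R axis i 1 + 0 *\<^sub>R axis j 1"
    by (intro tendsto_intros lim) (use st in auto)
  then have 1: "(\<lambda>n. pd j (pd i f) (x + s n *\<^sub>R axis i 1 + t n *\<^sub>R axis j 1)) \<longlonglongrightarrow> pd j (pd i f) x"
    by (intro isCont_tendsto_compose[OF c]) simp
  have "(\<lambda>n. x + s' n *\<^sub>R axis j 1 + t' n *\<^sub>R axis i 1) \<longlonglongrightarrow> x + 0 *\<^sub>R axis j 1 + 0 *\<^sub>R axis i 1"
    by (intro tendsto_intros lim) (use st in auto)
  then have 2: "(\<lambda>n. pd i (pd j f) (x + s' n *\<^sub>R axis j 1 + t' n *\<^sub>R axis i 1)) \<longlonglongrightarrow> pd i (pd j f) x"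
    by (intro isCont_tendsto_compose[OF c]) simp
  show "pd i (pd j f) x = pd j (pd i f) x"
    using LIMSEQ_unique[OF 1] 2 eq by simp
qed

lemma foldr_pd_move_front:
  "f \<in> smooth_functions \<Longrightarrow> foldr pd (us @ a # vs) f = foldr pd (a # us @ vs) f"
proof (induction us)
  case (Cons u us)
  then have "foldr pd ((u # us) @ a # vs) f = pd u (pd a (foldr pd (us @ vs) f))" by simp
  also have "\<dots> = pd a (pd u (foldr pd (us @ vs) f))" by (intro pd_commute smooth_foldr_pd Cons.prems)
  finally show ?case by simp
qed simp

lemma foldr_pd_mset:
  "f \<in> smooth_functions \<Longrightarrow> mset xs = mset ys \<Longrightarrow> foldr pd xs f = foldr pd ys f"
proof (induction xs arbitrary: ys)
  case (Cons a xs)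
  then have "a \<in> set ys" by (metis list.set_intros(1) set_mset_mset)
  then obtain us vs where ys: "ys = us @ a # vs" by (meson split_list)
  then have "mset xs = mset (us @ vs)" using Cons.prems by simp
  from Cons.IH[OF Cons.prems(1) this] show ?case
    unfolding ys foldr_pd_move_front[OF Cons.prems(1)] by simp
qed simp

section \<open>Jets of smooth functions\<close>

lemma lagrange_basis:
  "\<exists>l :: nat \<Rightarrow> real poly. \<forall>k\<le>N. degree (l k) \<le> N \<and> (\<forall>i\<le>N. poly (l k) (real i) = (if i = k then 1 else 0))"
proof -
  define l :: "nat \<Rightarrow> real poly" where
    "l k = smult (inverse (\<Prod>j\<in>{..N}-{k}. real k - real j)) (\<Prod>j\<in>{..N}-{k}. [:- real j, 1:])" for k
  have "degree (l k) \<le> N" if "k \<le> N" for k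
  proof -
    have "degree (\<Prod>j\<in>{..N}-{k}. [:- real j, 1:]) \<le> (\<Sum>j\<in>{..N}-{k}. degree [:- real j, 1:])"
      using degree_prod_sum_le[of "{..N}-{k}" "\<lambda>j. [:- real j, 1:]"] by (simp add: o_def)
    also have "\<dots> = N" using that by simp
    finally show ?thesis unfolding l_def by (rule le_trans[OF degree_smult_le])
  qed
  moreover have "poly (l k) (real i) = (if i = k then 1 else 0)" if "k \<le> N" "i \<le> N" for k i
    using that by (auto simp: l_def poly_prod prod_zero_iff)
  ultimately show ?thesis by (intro exI[of _ l]) simp
qed

text \<open>
  The coefficients are those of the Lagrange basis for the nodes \<open>0, \<dots>, N\<close>: interpolating \<open>X\<^sup>n\<close> at these
  nodes reproduces it, and one compares the coefficients of \<open>X\<^sup>m\<close>.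
\<close>

lemma vandermonde_inverse:
  "\<exists>c :: nat \<Rightarrow> nat \<Rightarrow> real. \<forall>m\<le>N. \<forall>n\<le>N. (\<Sum>k\<le>N. c m k * real k ^ n) = (if n = m then 1 else 0)"
proof -
  obtain l :: "nat \<Rightarrow> real poly" where
    l': "\<forall>k\<le>N. degree (l k) \<le> N \<and> (\<forall>i\<le>N. poly (l k) (real i) = (if i = k then 1 else 0))"
    using lagrange_basis[of N] by (rule exE)
  have l: "k \<le> N \<Longrightarrow> degree (l k) \<le> N"
    "k \<le> N \<Longrightarrow> i \<le> N \<Longrightarrow> poly (l k) (real i) = (if i = k then 1 else 0)" for k i
    using l' by simp_all
  have "(\<Sum>k\<le>N. coeff (l k) m * real k ^ n) = (if n = m then 1 else 0)" if n: "n \<le> N" for m n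
  proof -
    define p where "p = (\<Sum>k\<le>N. smult (real k ^ n) (l k)) - monom 1 n"
    have "degree (\<Sum>k\<le>N. smult (real k ^ n) (l k)) \<le> N"
      by (intro degree_sum_le) (auto intro: le_trans[OF degree_smult_le] l)
    then have deg: "degree p \<le> N" unfolding p_def
      by (intro degree_diff_le) (use n in \<open>auto simp: degree_monom_eq\<close>)
    have "poly p (real i) = 0" if "i \<le> N" for i
      using that by (simp add: p_def poly_sum poly_monom l if_distrib cong: if_cong)
    then have sub: "real ` {..N} \<subseteq> {x. poly p x = 0}" by auto
    have "p = 0"
    proof (rule ccontr)
      assume p: "p \<noteq> 0"
      have "card (real ` {..N}) \<le> card {x. poly p x = 0}"
        by (intro card_mono sub poly_roots_finite p)
      also have "\<dots> \<le> degree p" by (rule card_poly_roots_bound[OF p])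
      finally show False using deg by (simp add: card_image)
    qed
    then have "coeff (\<Sum>k\<le>N. smult (real k ^ n) (l k)) m = coeff (monom 1 n) m"
      by (simp add: p_def)
    then show ?thesis by (simp add: coeff_sum mult.commute)
  qed
  then show ?thesis by (intro exI[of _ "\<lambda>m k. coeff (l k) m"]) auto
qed

lemma sum_powers_zero:
  fixes F :: "nat \<Rightarrow> real"
  assumes "\<And>t::nat. (\<Sum>k\<le>N. real t ^ k * F k) = 0" and m: "m \<le> N"
  shows "F m = 0"
proof -
  obtain c :: "nat \<Rightarrow> nat \<Rightarrow> real" where c':
    "\<forall>m\<le>N. \<forall>n\<le>N. (\<Sum>k\<le>N. c m k * real k ^ n) = (if n = m then 1 else 0)"
    using vandermonde_inverse[of N] by (rule exE)
  have c: "m \<le> N \<Longrightarrow> n \<le> N \<Longrightarrow> (\<Sum>k\<le>N. c m k * real k ^ n) = (if n = m then 1 else 0)" for m n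
    using c' by simp
  have "0 = (\<Sum>t\<le>N. c m t * (\<Sum>k\<le>N. real t ^ k * F k))" using assms by simp
  also have "\<dots> = (\<Sum>k\<le>N. (\<Sum>t\<le>N. c m t * real t ^ k) * F k)"
    by (subst sum_distrib_left, subst sum.swap) (simp add: sum_distrib_right mult.assoc)
  also have "\<dots> = F m" using m by (simp add: c if_distrib[of "\<lambda>z. z * _"] cong: if_cong)
  finally show ?thesis by simp
qed

lemma prod_list_count:
  fixes r :: "'d::finite \<Rightarrow> real"
  shows "(\<Prod>i\<leftarrow>is. r i) = (\<Prod>i\<in>UNIV. r i ^ count (mset is) i)"
proof (induction "is")
  case (Cons a "is")
  have "(\<Prod>i\<in>UNIV. r i ^ count (mset (a # is)) i) = (\<Prod>i\<in>UNIV. (if i = a then r a else 1) * r i ^ count (mset is) i)"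
    by (intro prod.cong) auto
  also have "\<dots> = r a * (\<Prod>i\<in>UNIV. r i ^ count (mset is) i)"
    by (simp add: prod.distrib)
  finally show ?case using Cons by simp
qed simp

text \<open>
  The products on the right-hand side are the derivatives at \<open>x\<close> of multiples of exponentials, whose
  covectors \<open>\<kappa>\<close> run through the grid \<open>{0, \<dots>, N}\<^sup>d\<close>. By symmetry, a derivative of \<open>f\<close> only depends on the
  multiplicities of the directions, and the product over all directions of inverted Vandermonde
  matrices picks out any given multiplicities.
\<close>

lemma jet_interpolation:
  fixes f :: "real^'d::finite \<Rightarrow> real"
  assumes f: "f \<in> smooth_functions"
  shows "\<exists>a. \<forall>is. length is \<le> N \<longrightarrow> foldr pd is f x =
    (\<Sum>\<kappa>\<in>UNIV \<rightarrow>\<^sub>E {..N}. a \<kappa> * (\<Prod>i\<leftarrow>is. real (\<kappa> i)))"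
proof -
  obtain c :: "nat \<Rightarrow> nat \<Rightarrow> real" where c':
    "\<forall>m\<le>N. \<forall>n\<le>N. (\<Sum>k\<le>N. c m k * real k ^ n) = (if n = m then 1 else 0)"
    using vandermonde_inverse[of N] by (rule exE)
  have c: "m \<le> N \<Longrightarrow> n \<le> N \<Longrightarrow> (\<Sum>k\<le>N. c m k * real k ^ n) = (if n = m then 1 else 0)" for m n
    using c' by simp
  let ?K = "(UNIV :: 'd set) \<rightarrow>\<^sub>E {..N}"
  have finK: "finite ?K" by (simp add: finite_PiE)
  have "\<exists>w. \<forall>i. count (mset w) i = \<mu> i" for \<mu> :: "'d \<Rightarrow> nat"
  proof -
    obtain w where "mset w = (\<Sum>i\<in>UNIV. replicate_mset (\<mu> i) i)" using ex_mset by blast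
    then show ?thesis by (intro exI[of _ w]) (simp add: count_sum)
  qed
  then obtain w where w: "\<And>(\<mu> :: 'd \<Rightarrow> nat) i. count (mset (w \<mu>)) i = \<mu> i" by metis
  define a where "a \<kappa> = (\<Sum>\<mu>\<in>?K. foldr pd (w \<mu>) f x * (\<Prod>i\<in>UNIV. c (\<mu> i) (\<kappa> i)))" for \<kappa>
  have "foldr pd is f x = (\<Sum>\<kappa>\<in>?K. a \<kappa> * (\<Prod>i\<leftarrow>is. real (\<kappa> i)))" if len: "length is \<le> N" for "is"
  proof -
    define \<nu> where "\<nu> = count (mset is)"
    have \<nu>: "\<nu> i \<le> N" for i using len unfolding \<nu>_def
      by (metis count_mset count_le_length le_trans)
    have "(\<Sum>\<kappa>\<in>?K. a \<kappa> * (\<Prod>i\<leftarrow>is. real (\<kappa> i)))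
        = (\<Sum>\<kappa>\<in>?K. \<Sum>\<mu>\<in>?K. foldr pd (w \<mu>) f x * (\<Prod>i\<in>UNIV. c (\<mu> i) (\<kappa> i) * real (\<kappa> i) ^ \<nu> i))"
      by (simp add: a_def sum_distrib_right prod_list_count \<nu>_def prod.distrib mult.assoc)
    also have "\<dots> = (\<Sum>\<mu>\<in>?K. foldr pd (w \<mu>) f x * (\<Sum>\<kappa>\<in>?K. \<Prod>i\<in>UNIV. c (\<mu> i) (\<kappa> i) * real (\<kappa> i) ^ \<nu> i))"
      by (subst sum.swap) (simp add: sum_distrib_left)
    also have "\<dots> = (\<Sum>\<mu>\<in>?K. foldr pd (w \<mu>) f x * (\<Prod>i\<in>UNIV. \<Sum>k\<le>N. c (\<mu> i) k * real k ^ \<nu> i))"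
      by (subst prod_sum_PiE) auto
    also have "\<dots> = (\<Sum>\<mu>\<in>?K. if \<mu> = \<nu> then foldr pd (w \<mu>) f x else 0)"
    proof (intro sum.cong refl)
      fix \<mu> assume \<mu>: "\<mu> \<in> ?K"
      have \<mu>N: "\<mu> i \<le> N" for i using \<mu> by (auto simp: PiE_def Pi_def)
      have "(\<Prod>i\<in>UNIV. \<Sum>k\<le>N. c (\<mu> i) k * real k ^ \<nu> i) = (\<Prod>i\<in>UNIV. if \<nu> i = \<mu> i then 1 else 0)"
        by (intro prod.cong refl c \<mu>N \<nu>)
      also have "\<dots> = (if \<mu> = \<nu> then 1 else 0)"
        by (auto simp: fun_eq_iff) metis
      finally show "foldr pd (w \<mu>) f x * (\<Prod>i\<in>UNIV. \<Sum>k\<le>N. c (\<mu> i) k * real k ^ \<nu> i)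
        = (if \<mu> = \<nu> then foldr pd (w \<mu>) f x else 0)" by simp
    qed
    also have "\<dots> = foldr pd (w \<nu>) f x"
      using \<nu> finK by (simp add: PiE_def Pi_def)
    also have "\<dots> = foldr pd is f x"
      by (intro fun_cong[OF foldr_pd_mset] f multiset_eqI) (simp add: w \<nu>_def)
    finally show ?thesis by simp
  qed
  then show ?thesis by blast
qed

section \<open>The Leibniz rule\<close>

lemma pd_prod:
  assumes "finite U" "\<And>u. u \<in> U \<Longrightarrow> F u \<in> smooth_functions"
  shows "pd i (\<lambda>x. \<Prod>u\<in>U. F u x) = (\<lambda>x. \<Sum>v\<in>U. \<Prod>u\<in>U. (if u = v then pd i (F u) else F u) x)"
  using assms
proof (induction U)
  case (insert w U)
  have "pd i (\<lambda>x. \<Prod>u\<in>insert w U. F u x) = pd i (\<lambda>x. F w x * (\<Prod>u\<in>U. F u x))"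
    using insert by simp
  also have "\<dots> = (\<lambda>x. pd i (F w) x * (\<Prod>u\<in>U. F u x) + F w x * pd i (\<lambda>x. \<Prod>u\<in>U. F u x) x)"
    by (intro pd_mult smooth_prod insert.prems) auto
  also have "\<dots> = (\<lambda>x. pd i (F w) x * (\<Prod>u\<in>U. F u x) + F w x * (\<Sum>v\<in>U. \<Prod>u\<in>U. (if u = v then pd i (F u) else F u) x))"
    using insert by simp
  also have "\<dots> = (\<lambda>x. \<Sum>v\<in>insert w U. \<Prod>u\<in>insert w U. (if u = v then pd i (F u) else F u) x)"
  proof
    fix x
    have 1: "(\<Prod>u\<in>U. (if u = w then pd i (F u) else F u) x) = (\<Prod>u\<in>U. F u x)"
      using insert.hyps by (intro prod.cong) auto
    have 2: "(\<Sum>v\<in>U. (if w = v then pd i (F w) else F w) x * (\<Prod>u\<in>U. (if u = v then pd i (F u) else F u) x))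
       = F w x * (\<Sum>v\<in>U. \<Prod>u\<in>U. (if u = v then pd i (F u) else F u) x)"
      unfolding sum_distrib_left using insert.hyps by (intro sum.cong) auto
    show "pd i (F w) x * (\<Prod>u\<in>U. F u x) + F w x * (\<Sum>v\<in>U. \<Prod>u\<in>U. (if u = v then pd i (F u) else F u) x)
      = (\<Sum>v\<in>insert w U. \<Prod>u\<in>insert w U. (if u = v then pd i (F u) else F u) x)"
      using insert.hyps by (simp add: 1 2)
  qed
  finally show ?case .
qed simp

lemma smooth_foldr_pd_edges [intro, simp]:
  "h \<in> smooth_functions \<Longrightarrow> foldr (\<lambda>e. pd (I e)) es h \<in> smooth_functions"
  by (induction es) auto

text \<open>
  \<open>g\<close> tells which factor each of the derivatives hits. The derivatives are indexed by edges rather than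
  by directions, because in a graph different edges may carry the same direction.
\<close>

lemma leibniz_foldr:
  fixes F :: "'u \<Rightarrow> real^'d::finite \<Rightarrow> real" and es :: "'e list"
  assumes "finite U" and F: "\<And>u. u \<in> U \<Longrightarrow> F u \<in> smooth_functions" and "distinct es"
  shows "foldr (\<lambda>e. pd (I e)) es (\<lambda>x. \<Prod>u\<in>U. F u x) =
    (\<lambda>x. \<Sum>g\<in>set es \<rightarrow>\<^sub>E U. \<Prod>u\<in>U. foldr (\<lambda>e. pd (I e)) (filter (\<lambda>e. g e = u) es) (F u) x)"
  using assms(3)
proof (induction es)
  case (Cons e es)
  let ?D = "\<lambda>es. foldr (\<lambda>e. pd (I e)) es"
  let ?G = "set es \<rightarrow>\<^sub>E U"
  from Cons.prems have e: "e \<notin> set es" and d: "distinct es" by auto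
  have "?D (e # es) (\<lambda>x. \<Prod>u\<in>U. F u x) =
    pd (I e) (\<lambda>x. \<Sum>g\<in>?G. \<Prod>u\<in>U. ?D (filter (\<lambda>e. g e = u) es) (F u) x)"
    using Cons.IH[OF d] by simp
  also have "\<dots> = (\<lambda>x. \<Sum>g\<in>?G. pd (I e) (\<lambda>x. \<Prod>u\<in>U. ?D (filter (\<lambda>e. g e = u) es) (F u) x) x)"
    by (intro pd_sum smooth_prod smooth_foldr_pd_edges F)
  also have "\<dots> = (\<lambda>x. \<Sum>g\<in>?G. \<Sum>v\<in>U. \<Prod>u\<in>U. (if u = v then pd (I e) (?D (filter (\<lambda>e. g e = u) es) (F u)) else ?D (filter (\<lambda>e. g e = u) es) (F u)) x)"
    by (subst pd_prod) (use assms in auto)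
  also have "\<dots> = (\<lambda>x. \<Sum>g\<in>set (e # es) \<rightarrow>\<^sub>E U. \<Prod>u\<in>U. ?D (filter (\<lambda>e. g e = u) (e # es)) (F u) x)"
  proof
    fix x
    have "(\<Sum>g\<in>set (e # es) \<rightarrow>\<^sub>E U. \<Prod>u\<in>U. ?D (filter (\<lambda>e. g e = u) (e # es)) (F u) x)
      = (\<Sum>(v, g)\<in>U \<times> ?G. \<Prod>u\<in>U. ?D (filter (\<lambda>e'. (g(e := v)) e' = u) (e # es)) (F u) x)"
      unfolding list.set PiE_insert_eq
      by (subst sum.reindex[OF inj_combinator[OF e]]) (simp add: split_def o_def fun_upd_def)
    also have "\<dots> = (\<Sum>v\<in>U. \<Sum>g\<in>?G. \<Prod>u\<in>U. ?D (filter (\<lambda>e'. (g(e := v)) e' = u) (e # es)) (F u) x)"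
      by (simp add: sum.cartesian_product)
    also have "\<dots> = (\<Sum>g\<in>?G. \<Sum>v\<in>U. \<Prod>u\<in>U. ?D (filter (\<lambda>e'. (g(e := v)) e' = u) (e # es)) (F u) x)"
      by (rule sum.swap)
    also have "\<dots> = (\<Sum>g\<in>?G. \<Sum>v\<in>U. \<Prod>u\<in>U. (if u = v then pd (I e) (?D (filter (\<lambda>e. g e = u) es) (F u)) else ?D (filter (\<lambda>e. g e = u) es) (F u)) x)"
    proof (intro sum.cong prod.cong refl)
      fix g :: "'e \<Rightarrow> 'u" and v u
      have "filter (\<lambda>e'. (g(e := v)) e' = u) es = filter (\<lambda>e. g e = u) es"
        using e by (intro filter_cong) auto
      then show "?D (filter (\<lambda>e'. (g(e := v)) e' = u) (e # es)) (F u) x =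
        (if u = v then pd (I e) (?D (filter (\<lambda>e. g e = u) es) (F u)) else ?D (filter (\<lambda>e. g e = u) es) (F u)) x"
        by (auto simp del: fun_upd_apply simp add: fun_upd_same)
    qed
    finally show "(\<Sum>g\<in>?G. \<Sum>v\<in>U. \<Prod>u\<in>U. (if u = v then pd (I e) (?D (filter (\<lambda>e. g e = u) es) (F u)) else ?D (filter (\<lambda>e. g e = u) es) (F u)) x)
     = (\<Sum>g\<in>set (e # es) \<rightarrow>\<^sub>E U. \<Prod>u\<in>U. ?D (filter (\<lambda>e. g e = u) (e # es)) (F u) x)" by simp
  qed
  finally show ?case .
qed simp

section \<open>Polynomial group cocycles\<close>

definition group_coboundary :: "('v::ab_semigroup_add \<Rightarrow> 'v \<Rightarrow> real) \<Rightarrow> 'v \<Rightarrow> 'v \<Rightarrow> 'v \<Rightarrow> real" where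
  "group_coboundary B p q r = B q r - B (p + q) r + B p (q + r) - B p q"

definition group_cocycle :: "('v::ab_semigroup_add \<Rightarrow> 'v \<Rightarrow> 'v \<Rightarrow> real) \<Rightarrow> bool" where
  "group_cocycle E \<longleftrightarrow>
     (\<forall>p q r s. E q r s - E (p + q) r s + E p (q + r) s - E p q (r + s) + E p q r = 0)"

text \<open>
  Up to values on the diagonal, the cocycle identity gives \<open>B (2p) (2q) = 3 B p q - B q p\<close>, which multiplies symmetric
  cocycles by 2 and antisymmetric ones by 4.
\<close>

lemma two_cocycle_zero:
  fixes B :: "'v::ab_semigroup_add \<Rightarrow> 'v \<Rightarrow> real"
  assumes coc: "\<And>p q r. group_coboundary B p q r = 0"
    and diag: "\<And>p. B p p = 0" and scale: "\<And>p q. B (p + p) (q + q) = M * B p q"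
    and M: "M \<noteq> 2" "M \<noteq> 4"
  shows "B p q = 0"
proof -
  have *: "M * B p q = 3 * B p q - B q p" for p q
  proof -
    have "B (p + p) (q + q) = 3 * B p q - B q p"
      using coc[of p p "q + q"] coc[of p "p + q" q] coc[of p q q] coc[of "p + q" p q] coc[of p q p]
        diag[of p] diag[of q] diag[of "p + q"]
      unfolding group_coboundary_def by (simp only: add_ac)
    then show ?thesis using scale[of p q] by simp
  qed
  have "(M - 4) * (B p q - B q p) = 0" using *[of p q] *[of q p] by (simp add: algebra_simps)
  then have "B q p = B p q" using M by simp
  then have "(M - 2) * B p q = 0" using *[of p q] by (simp add: algebra_simps)
  then show ?thesis using M by simp
qed

text \<open>
  The second Adams operation in degree 3, \<open>2 pqr + p \<squnion> qr + pq \<squnion> r\<close> with the signed shuffle product \<open>\<squnion>\<close>: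
  first cut the word \<open>pqr\<close> in all possible ways, then shuffle the two pieces.
\<close>

definition lambda_square :: "('v \<Rightarrow> 'v \<Rightarrow> 'v \<Rightarrow> real) \<Rightarrow> 'v \<Rightarrow> 'v \<Rightarrow> 'v \<Rightarrow> real" where
  "lambda_square E p q r = 4 * E p q r - E q p r + E q r p - E p r q + E r p q"

text \<open>
  A homotopy between doubling of all arguments and the Adams operation. Both are induced by the map of
  degree 2 on the circle, the bar construction of a group \<open>V\<close> being its tensor product with the circle.
\<close>

definition doubling_homotopy :: "('v::ab_semigroup_add \<Rightarrow> 'v \<Rightarrow> 'v \<Rightarrow> real) \<Rightarrow> 'v \<Rightarrow> 'v \<Rightarrow> real" where
  "doubling_homotopy E p q = E p q q - E q p q + E p q (p + q) - E p p (q + q)"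

definition alternation :: "('v \<Rightarrow> 'v \<Rightarrow> 'v \<Rightarrow> real) \<Rightarrow> 'v \<Rightarrow> 'v \<Rightarrow> 'v \<Rightarrow> real" where
  "alternation E p q r = E p q r - E q p r + E q r p - E r q p + E r p q - E p r q"

text \<open>
  The difference of the two sides is a combination of 19 instances of the cocycle identity, with
  coefficients \<open>1\<close> and \<open>-1\<close>, which solve the linear system for the instances with small arguments.
\<close>

lemma doubling_homotopic:
  assumes "group_cocycle E"
  shows "E (p + p) (q + q) (r + r) = lambda_square E p q r + group_coboundary (doubling_homotopy E) p q r"
proof -
  note coc = assms[unfolded group_cocycle_def, rule_format]
  show ?thesis
    using coc[of "p" "q" "r" "r"] coc[of "p" "q" "(q + r)" "r"] coc[of "p" "(q + r)" "q" "r"] coc[of "(p + q)" "r" "q" "r"] coc[of "r" "q" "r" "q"] coc[of "r" "p" "q" "q"] coc[of "r" "(p + q)" "r" "q"] coc[of "q" "r" "r" "q"] coc[of "p" "r" "q" "q"] coc[of "p" "q" "r" "q"] coc[of "(p +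
    q)" "r" "r" "q"] coc[of "p" "q" "r" "(q + r)"] coc[of "q" "r" "(p + (q + r))" "p"] coc[of "q" "q" "r" "p"] coc[of "q" "(p + q)" "(r + r)" "p"] coc[of "(q + r)" "q" "r" "p"] coc[of "(q + q)" "r" "r" "p"] coc[of "p" "(q + q)" "(r + r)" "p"] coc[of "q" "r" "q" "(p + r)"]
    unfolding lambda_square_def group_coboundary_def doubling_homotopy_def
    by (simp only: add_ac)
qed

lemma group_coboundary_cocycle: "group_cocycle (group_coboundary B)"
  by (simp add: group_cocycle_def group_coboundary_def add_ac)

lemma alternation_coboundary: "alternation (group_coboundary B) p q r = 0"
  by (simp add: alternation_def group_coboundary_def add_ac)

text \<open>
  In general \<open>(\<psi> - 2) (\<psi> - 4) (\<psi> - 8) = 0\<close> holds for the Adams operation \<open>\<psi>\<close>, and \<open>(\<psi> - 2) (\<psi> - 4)\<close> is a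
  multiple of the alternation.
\<close>

lemma lambda_square_square:
  assumes "\<And>p q r. alternation E p q r = 0"
  shows "lambda_square (lambda_square E) p q r = 6 * lambda_square E p q r - 8 * E p q r"
  using assms[of p q r] unfolding lambda_square_def alternation_def by (simp add: algebra_simps)

text \<open>
  Alternation kills coboundaries and turns the Adams operation into multiplication by 8, whereas
  doubling multiplies by \<open>M\<close>.
\<close>

lemma alternation_cocycle_zero:
  assumes coc: "group_cocycle E"
    and scale: "\<And>p q r. E (p + p) (q + q) (r + r) = M * E p q r" and M: "M \<noteq> 8"
  shows "alternation E p q r = 0"
proof -
  have *: "group_coboundary (doubling_homotopy E) = (\<lambda>p q r. M * E p q r - lambda_square E p q r)"
    by (intro ext) (use doubling_homotopic[OF coc] scale in \<open>simp add: algebra_simps\<close>)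
  have "alternation (\<lambda>p q r. M * E p q r - lambda_square E p q r) p q r = 0"
    using alternation_coboundary[of "doubling_homotopy E"] by (simp add: *)
  then have "(M - 8) * alternation E p q r = 0"
    by (simp add: alternation_def lambda_square_def algebra_simps)
  then show ?thesis using M by simp
qed

text \<open>
  With \<open>h\<close> the homotopy, \<open>(M - \<psi>) E = \<delta> (h E)\<close> and \<open>(M - \<psi>) (\<psi> E) = \<delta> (h (\<psi> E))\<close>; adding \<open>M - 6\<close> times the first
  identity to the second leaves \<open>(M - 2) (M - 4) E\<close> because \<open>\<psi>\<^sup>2 E = 6 \<psi> E - 8 E\<close>.
\<close>

lemma three_cocycle_coboundary:
  fixes E :: "'v::ab_semigroup_add \<Rightarrow> 'v \<Rightarrow> 'v \<Rightarrow> real"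
  assumes coc: "group_cocycle E"
    and scale: "\<And>p q r. E (p + p) (q + q) (r + r) = M * E p q r"
    and M: "M \<noteq> 2" "M \<noteq> 4" and alt: "\<And>p q r. alternation E p q r = 0"
  shows "group_coboundary (\<lambda>p q. (doubling_homotopy (lambda_square E) p q + (M - 6) * doubling_homotopy E p q)
      / ((M - 2) * (M - 4))) p q r = E p q r"
proof -
  let ?L = "lambda_square E"
  have *: "group_coboundary (doubling_homotopy E) p q r = M * E p q r - ?L p q r" for p q r
    using doubling_homotopic[OF coc, of p q r] scale[of p q r] by simp
  have cocL: "group_cocycle ?L"
  proof -
    have L: "?L = (\<lambda>p q r. M * E p q r - group_coboundary (doubling_homotopy E) p q r)"
      by (intro ext) (simp add: *)
    note 1 = coc[unfolded group_cocycle_def, rule_format]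
    note 2 = group_coboundary_cocycle[of "doubling_homotopy E", unfolded group_cocycle_def, rule_format]
    let ?H = "group_coboundary (doubling_homotopy E)"
    have "(M * E q r s - ?H q r s) - (M * E (p + q) r s - ?H (p + q) r s) + (M * E p (q + r) s - ?H p (q + r) s)
        - (M * E p q (r + s) - ?H p q (r + s)) + (M * E p q r - ?H p q r)
      = M * (E q r s - E (p + q) r s + E p (q + r) s - E p q (r + s) + E p q r)
        - (?H q r s - ?H (p + q) r s + ?H p (q + r) s - ?H p q (r + s) + ?H p q r)" for p q r s
      by (simp add: algebra_simps)
    then show ?thesis unfolding L group_cocycle_def by (simp only: 1 2) simp
  qed
  have scaleL: "?L (p + p) (q + q) (r + r) = M * ?L p q r" for p q r
    by (simp add: lambda_square_def scale algebra_simps)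
  have "group_coboundary (doubling_homotopy ?L) p q r = M * ?L p q r - lambda_square ?L p q r"
    using doubling_homotopic[OF cocL, of p q r] scaleL[of p q r] by simp
  also have "\<dots> = (M - 6) * ?L p q r + 8 * E p q r"
    unfolding lambda_square_square[OF alt] by (simp add: algebra_simps)
  finally have "group_coboundary (doubling_homotopy ?L) p q r + (M - 6) * group_coboundary (doubling_homotopy E) p q r
     = ((M - 2) * (M - 4)) * E p q r"
    unfolding * by (simp add: algebra_simps)
  then have "(group_coboundary (doubling_homotopy ?L) p q r + (M - 6) * group_coboundary (doubling_homotopy E) p q r)
     / ((M - 2) * (M - 4)) = E p q r" using M by simp
  then show ?thesis
    by (simp add: group_coboundary_def add_divide_distrib diff_divide_distrib algebra_simps)
qed

section \<open>Edges and vertices\<close>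

lemma set_edges: "set (edges \<Gamma>) = {..<length \<Gamma>} \<times> UNIV"
  by (auto simp: edges_def)

lemma distinct_edges [simp]: "distinct (edges \<Gamma>)"
  by (simp add: edges_def distinct_product)

lemma set_vertices: "set (vertices n m) = Inner ` {..<n} \<union> Bdry ` {..<m}"
  by (auto simp: vertices_def)

lemma distinct_vertices [simp]: "distinct (vertices n m)"
  by (auto simp: vertices_def distinct_map inj_on_def)

lemma set_incoming: "set (incoming \<Gamma> u) = {e \<in> set (edges \<Gamma>). target \<Gamma> e = u}"
  by (simp add: incoming_def)

lemma distinct_incoming [simp]: "distinct (incoming \<Gamma> u)"
  by (simp add: incoming_def)

section \<open>Isomorphisms of oriented graphs\<close>

text \<open>
  Isomorphisms in terms of edges: the edge \<open>(v, b)\<close> corresponds to \<open>(\<sigma> v, b)\<close>, with \<open>b\<close> negated for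
  \<open>v \<in> S\<close>. Unlike in \<open>oriented_iso\<close>, the set \<open>S\<close> may contain numbers that are not vertices, which spares
  a side condition when isomorphisms are composed.
\<close>

definition iso_via :: "(nat \<Rightarrow> nat) \<Rightarrow> nat set \<Rightarrow> graph \<Rightarrow> graph \<Rightarrow> bool" where
  "iso_via \<sigma> S \<Gamma> \<Gamma>' \<longleftrightarrow> length \<Gamma>' = length \<Gamma> \<and> \<sigma> permutes {..<length \<Gamma>} \<and>
     (\<forall>v<length \<Gamma>. \<forall>b. target \<Gamma>' (\<sigma> v, b \<noteq> (v \<in> S)) = relabel \<sigma> (target \<Gamma> (v, b)))"

definition flip_sign :: "nat \<Rightarrow> nat set \<Rightarrow> int" where
  "flip_sign n S = (\<Prod>v<n. if v \<in> S then -1 else 1)"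

lemma flip_sign_card: "S \<subseteq> {..<n} \<Longrightarrow> flip_sign n S = (-1) ^ card S"
proof -
  assume S: "S \<subseteq> {..<n}"
  have "flip_sign n S = (\<Prod>v\<in>S. -1) * (\<Prod>v\<in>{..<n} - S. 1)"
    unfolding flip_sign_def using S by (subst prod.If_cases) (auto simp: Int_absorb1 Diff_eq)
  then show ?thesis by simp
qed

lemma flip_sign_cases: "flip_sign n S = 1 \<or> flip_sign n S = -1"
  by (induction n) (auto simp: flip_sign_def)

lemma oriented_iso_iff:
  "oriented_iso s \<Gamma> \<Gamma>' \<longleftrightarrow> (\<exists>\<sigma> S. iso_via \<sigma> S \<Gamma> \<Gamma>' \<and> s = flip_sign (length \<Gamma>) S)"
proof -
  have eq: "\<Gamma>' ! \<sigma> v = (if v \<in> S then prod.swap else id) (map_prod (relabel \<sigma>) (relabel \<sigma>) (\<Gamma> ! v))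
      \<longleftrightarrow> (\<forall>b. target \<Gamma>' (\<sigma> v, b \<noteq> (v \<in> S)) = relabel \<sigma> (target \<Gamma> (v, b)))" for \<sigma> v and S :: "nat set"
    by (cases "v \<in> S") (auto simp: target_def prod_eq_iff all_bool_eq)
  show ?thesis
  proof
    assume "oriented_iso s \<Gamma> \<Gamma>'"
    then show "\<exists>\<sigma> S. iso_via \<sigma> S \<Gamma> \<Gamma>' \<and> s = flip_sign (length \<Gamma>) S"
      unfolding oriented_iso_def eq iso_via_def using flip_sign_card by metis
  next
    assume "\<exists>\<sigma> S. iso_via \<sigma> S \<Gamma> \<Gamma>' \<and> s = flip_sign (length \<Gamma>) S"
    then obtain \<sigma> S where 1: "iso_via \<sigma> S \<Gamma> \<Gamma>'" "s = flip_sign (length \<Gamma>) S" by blast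
    have "iso_via \<sigma> (S \<inter> {..<length \<Gamma>}) \<Gamma> \<Gamma>'" using 1(1) by (auto simp: iso_via_def)
    moreover have "s = (-1) ^ card (S \<inter> {..<length \<Gamma>})"
    proof -
      have "flip_sign (length \<Gamma>) S = flip_sign (length \<Gamma>) (S \<inter> {..<length \<Gamma>})"
        unfolding flip_sign_def by (rule prod.cong) auto
      then show ?thesis using 1(2) flip_sign_card[of "S \<inter> {..<length \<Gamma>}" "length \<Gamma>"] by simp
    qed
    ultimately show "oriented_iso s \<Gamma> \<Gamma>'"
      unfolding oriented_iso_def eq iso_via_def by (auto intro!: exI[of _ \<sigma>] exI[of _ "S \<inter> {..<length \<Gamma>}"])
  qed
qed

lemma oriented_iso_sign: "oriented_iso s \<Gamma> \<Gamma>' \<Longrightarrow> s = 1 \<or> s = -1"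
  using flip_sign_cases by (auto simp: oriented_iso_iff)

lemma oriented_iso_length: "oriented_iso s \<Gamma> \<Gamma>' \<Longrightarrow> length \<Gamma>' = length \<Gamma>"
  by (auto simp: oriented_iso_def)

lemma relabel_id [simp]: "relabel id u = u" by (cases u) auto
lemma relabel_comp: "relabel (\<tau> \<circ> \<sigma>) u = relabel \<tau> (relabel \<sigma> u)" by (cases u) auto

lemma oriented_iso_refl: "oriented_iso 1 \<Gamma> \<Gamma>"
  unfolding oriented_iso_iff
  by (intro exI[of _ id] exI[of _ "{}"]) (simp add: iso_via_def flip_sign_def permutes_id)

lemma oriented_iso_trans:
  assumes "oriented_iso s \<Gamma> \<Gamma>'" "oriented_iso t \<Gamma>' \<Gamma>''"
  shows "oriented_iso (s * t) \<Gamma> \<Gamma>''"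
proof -
  obtain \<sigma> S where 1: "iso_via \<sigma> S \<Gamma> \<Gamma>'" "s = flip_sign (length \<Gamma>) S" using assms by (auto simp: oriented_iso_iff)
  obtain \<tau> T where 2: "iso_via \<tau> T \<Gamma>' \<Gamma>''" "t = flip_sign (length \<Gamma>') T" using assms by (auto simp: oriented_iso_iff)
  let ?n = "length \<Gamma>"
  have len: "length \<Gamma>' = ?n" and \<sigma>: "\<sigma> permutes {..<?n}" using 1 by (auto simp: iso_via_def)
  define R where "R = {v. (v \<in> S) \<noteq> (\<sigma> v \<in> T)}"
  have "iso_via (\<tau> \<circ> \<sigma>) R \<Gamma> \<Gamma>''"
    unfolding iso_via_def
  proof (intro conjI allI impI)
    fix v b assume v: "v < ?n"
    have \<sigma>v: "\<sigma> v < ?n" using permutes_in_image[OF \<sigma>, of v] v by simp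
    have "(b \<noteq> (v \<in> R)) = ((b \<noteq> (v \<in> S)) \<noteq> (\<sigma> v \<in> T))" by (auto simp: R_def)
    then have "target \<Gamma>'' ((\<tau> \<circ> \<sigma>) v, b \<noteq> (v \<in> R)) = target \<Gamma>'' (\<tau> (\<sigma> v), (b \<noteq> (v \<in> S)) \<noteq> (\<sigma> v \<in> T))" by simp
    also have "\<dots> = relabel \<tau> (target \<Gamma>' (\<sigma> v, b \<noteq> (v \<in> S)))" using 2 \<sigma>v len by (auto simp: iso_via_def)
    also have "\<dots> = relabel (\<tau> \<circ> \<sigma>) (target \<Gamma> (v, b))" using 1 v by (auto simp: iso_via_def relabel_comp)
    finally show "target \<Gamma>'' ((\<tau> \<circ> \<sigma>) v, b \<noteq> (v \<in> R)) = relabel (\<tau> \<circ> \<sigma>) (target \<Gamma> (v, b))" .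
  qed (use 1 2 in \<open>auto simp: iso_via_def intro: permutes_compose\<close>)
  moreover have "s * t = flip_sign ?n R"
  proof -
    have "t = (\<Prod>v<?n. if \<sigma> v \<in> T then -1 else 1)"
      unfolding 2 flip_sign_def len by (subst prod.permute[OF \<sigma>]) (simp add: o_def)
    then show ?thesis unfolding 1(2) flip_sign_def prod.distrib[symmetric]
      by (auto simp: R_def prod.distrib[symmetric] intro!: prod.cong)
  qed
  ultimately show ?thesis unfolding oriented_iso_iff by blast
qed

lemma oriented_iso_sym:
  assumes "oriented_iso s \<Gamma> \<Gamma>'" shows "oriented_iso s \<Gamma>' \<Gamma>"
proof -
  obtain \<sigma> S where 1: "iso_via \<sigma> S \<Gamma> \<Gamma>'" "s = flip_sign (length \<Gamma>) S" using assms by (auto simp: oriented_iso_iff)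
  let ?n = "length \<Gamma>" and ?\<tau> = "inv \<sigma>"
  have len: "length \<Gamma>' = ?n" and \<sigma>: "\<sigma> permutes {..<?n}" using 1 by (auto simp: iso_via_def)
  have \<tau>: "?\<tau> permutes {..<?n}" by (rule permutes_inv[OF \<sigma>])
  have inv: "\<sigma> (?\<tau> v) = v" "?\<tau> (\<sigma> v) = v" for v using permutes_inverses[OF \<sigma>] by auto
  have rel: "relabel ?\<tau> (relabel \<sigma> u) = u" for u by (cases u) (auto simp: inv)
  define R where "R = {v. ?\<tau> v \<in> S}"
  have "iso_via ?\<tau> R \<Gamma>' \<Gamma>"
    unfolding iso_via_def len
  proof (intro conjI allI impI)
    fix v b assume v: "v < ?n"
    have \<tau>v: "?\<tau> v < ?n" using permutes_in_image[OF \<tau>, of v] v by simp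
    have "target \<Gamma>' (\<sigma> (?\<tau> v), (b \<noteq> (?\<tau> v \<in> S)) \<noteq> (?\<tau> v \<in> S)) = relabel \<sigma> (target \<Gamma> (?\<tau> v, b \<noteq> (?\<tau> v \<in> S)))"
      using 1 \<tau>v by (auto simp: iso_via_def)
    moreover have "((b \<noteq> (?\<tau> v \<in> S)) \<noteq> (?\<tau> v \<in> S)) = b" by auto
    ultimately have "target \<Gamma>' (v, b) = relabel \<sigma> (target \<Gamma> (?\<tau> v, b \<noteq> (?\<tau> v \<in> S)))" by (simp add: inv)
    then show "target \<Gamma> (?\<tau> v, b \<noteq> (v \<in> R)) = relabel ?\<tau> (target \<Gamma>' (v, b))" by (simp add: rel R_def)
  qed (use \<tau> in auto)
  moreover have "s = flip_sign ?n R"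
    unfolding 1(2) flip_sign_def by (subst (2) prod.permute[OF \<sigma>]) (simp add: o_def R_def inv)
  ultimately show ?thesis unfolding oriented_iso_iff len by (metis len)
qed

lemma oriented_iso_unique:
  assumes "oriented_iso s \<Gamma> \<Gamma>'" "oriented_iso t \<Gamma> \<Gamma>'" "\<not> vanishes \<Gamma>"
  shows "s = t"
proof -
  have "oriented_iso (s * t) \<Gamma> \<Gamma>" using assms oriented_iso_trans oriented_iso_sym by blast
  then have "s * t \<noteq> -1" using assms(3) by (auto simp: vanishes_def)
  then show ?thesis using oriented_iso_sign[OF assms(1)] oriented_iso_sign[OF assms(2)] by auto
qed

lemma vanishes_iso:
  assumes "oriented_iso s \<Gamma> \<Gamma>'" "vanishes \<Gamma>" shows "vanishes \<Gamma>'"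
proof -
  have "oriented_iso (s * (-1 * s)) \<Gamma>' \<Gamma>'"
    using assms oriented_iso_trans oriented_iso_sym unfolding vanishes_def by blast
  then show ?thesis using oriented_iso_sign[OF assms(1)] by (auto simp: vanishes_def)
qed

lemma vanishes_parallel:
  assumes v: "v < length \<Gamma>" and eq: "target \<Gamma> (v, False) = target \<Gamma> (v, True)"
  shows "vanishes \<Gamma>"
proof -
  have "iso_via id {v} \<Gamma> \<Gamma>"
    using eq by (auto simp: iso_via_def permutes_id) (metis (full_types))+
  moreover have "flip_sign (length \<Gamma>) {v} = -1" using v by (subst flip_sign_card) auto
  ultimately show ?thesis unfolding vanishes_def oriented_iso_iff by metis
qed

section \<open>Representatives of classes\<close>

lemma weightsD: "F \<in> weights \<Longrightarrow> oriented_iso s \<Gamma> \<Gamma>' \<Longrightarrow> F \<Gamma>' = of_int s * F \<Gamma>"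
  by (auto simp: weights_def)

lemma weights_vanishes: "F \<in> weights \<Longrightarrow> vanishes \<Gamma> \<Longrightarrow> F \<Gamma> = 0"
  using weightsD[of F "-1" \<Gamma> \<Gamma>] by (simp add: vanishes_def)

lemma tree_graphsD:
  assumes "\<Gamma> \<in> tree_graphs n m"
  shows "length \<Gamma> = n" "e \<in> set (edges \<Gamma>) \<Longrightarrow> target \<Gamma> e \<in> set (vertices n m)"
    "acyclic {(v, w). \<exists>b. (v, b) \<in> set (edges \<Gamma>) \<and> target \<Gamma> (v, b) = Inner w}"
    "v < n \<Longrightarrow> length (incoming \<Gamma> (Inner v)) \<le> 1"
  using assms unfolding tree_graphs_def by blast+

lemma class_rel_equiv: "equiv {\<Gamma> \<in> tree_graphs n m. \<not> vanishes \<Gamma>} (class_rel n m)"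
  by (intro equivI) (auto simp: class_rel_def refl_on_def sym_def trans_def
      intro: oriented_iso_refl oriented_iso_sym oriented_iso_trans)

lemma graph_reps_class:
  assumes "\<Gamma> \<in> graph_reps n m"
  obtains C where "C \<in> {\<Gamma> \<in> tree_graphs n m. \<not> vanishes \<Gamma>} // class_rel n m" "\<Gamma> \<in> C" "\<Gamma> = (SOME \<Gamma>. \<Gamma> \<in> C)"
proof -
  obtain C where C: "C \<in> {\<Gamma> \<in> tree_graphs n m. \<not> vanishes \<Gamma>} // class_rel n m" "\<Gamma> = (SOME \<Gamma>. \<Gamma> \<in> C)"
    using assms by (auto simp: graph_reps_def)
  have "C \<noteq> {}" using in_quotient_imp_non_empty[OF class_rel_equiv C(1)] .
  then have "\<Gamma> \<in> C" using C(2) by (simp add: some_in_eq)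
  then show ?thesis using that C by blast
qed

lemma graph_repsD:
  assumes "\<Gamma> \<in> graph_reps n m" shows "\<Gamma> \<in> tree_graphs n m" "\<not> vanishes \<Gamma>"
proof -
  obtain C where C: "C \<in> {\<Gamma> \<in> tree_graphs n m. \<not> vanishes \<Gamma>} // class_rel n m" "\<Gamma> \<in> C"
    using assms by (rule graph_reps_class)
  from in_quotient_imp_subset[OF class_rel_equiv C(1)] C(2)
  show "\<Gamma> \<in> tree_graphs n m" "\<not> vanishes \<Gamma>" by auto
qed

lemma graph_reps_length: "\<Gamma> \<in> graph_reps n m \<Longrightarrow> length \<Gamma> = n"
  using graph_repsD(1) by (auto simp: tree_graphs_def)

lemma graph_reps_unique:
  assumes "\<Gamma> \<in> graph_reps n m" "\<Gamma>' \<in> graph_reps n m" "oriented_iso s \<Gamma> \<Gamma>'"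
  shows "\<Gamma> = \<Gamma>'"
proof -
  let ?A = "{\<Gamma> \<in> tree_graphs n m. \<not> vanishes \<Gamma>} // class_rel n m"
  obtain C where C1: "C \<in> ?A" "\<Gamma> \<in> C" "\<Gamma> = (SOME \<Gamma>. \<Gamma> \<in> C)"
    using assms(1) by (rule graph_reps_class)
  obtain C' where C2: "C' \<in> ?A" "\<Gamma>' \<in> C'" "\<Gamma>' = (SOME \<Gamma>. \<Gamma> \<in> C')"
    using assms(2) by (rule graph_reps_class)
  have "(\<Gamma>, \<Gamma>') \<in> class_rel n m" using graph_repsD assms by (auto simp: class_rel_def)
  then have "C = C'" by (rule quotient_eqI[OF class_rel_equiv C1(1) C2(1) C1(2) C2(2)])
  then show ?thesis using C1(3) C2(3) by simp
qed

lemma graph_reps_exists: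
  assumes "T \<in> tree_graphs n m" "\<not> vanishes T"
  obtains \<Gamma> s where "\<Gamma> \<in> graph_reps n m" "oriented_iso s T \<Gamma>"
proof -
  let ?C = "class_rel n m `` {T}"
  have C: "?C \<in> {\<Gamma> \<in> tree_graphs n m. \<not> vanishes \<Gamma>} // class_rel n m" using assms by (auto intro: quotientI)
  have "(SOME \<Gamma>. \<Gamma> \<in> ?C) \<in> ?C"
    using in_quotient_imp_non_empty[OF class_rel_equiv C] by (simp only: some_in_eq not_False_eq_True)
  then have "(T, SOME \<Gamma>. \<Gamma> \<in> ?C) \<in> class_rel n m" by blast
  moreover have "(SOME \<Gamma>. \<Gamma> \<in> ?C) \<in> graph_reps n m" unfolding graph_reps_def using C by (rule imageI)
  ultimately show ?thesis using that by (auto simp: class_rel_def)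
qed

lemma finite_tree_graphs: "finite (tree_graphs n m)"
proof (rule finite_subset)
  let ?V = "set (vertices n m)"
  show "tree_graphs n m \<subseteq> {\<Gamma>. set \<Gamma> \<subseteq> ?V \<times> ?V \<and> length \<Gamma> = n}"
  proof
    fix \<Gamma> assume g: "\<Gamma> \<in> tree_graphs n m"
    have nth: "\<Gamma> ! v \<in> ?V \<times> ?V" if "v < n" for v
    proof -
      have "target \<Gamma> (v, b) \<in> ?V" for b
        using tree_graphsD(1,2)[OF g] that by (simp add: set_edges)
      from this[of False] this[of True] show ?thesis by (simp add: target_def mem_Times_iff)
    qed
    note len = tree_graphsD(1)[OF g]
    have "p \<in> ?V \<times> ?V" if p: "p \<in> set \<Gamma>" for p
    proof -
      obtain v where "v < length \<Gamma>" "\<Gamma> ! v = p" using p unfolding in_set_conv_nth by blast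
      with nth[of v] len show ?thesis by simp
    qed
    then have "set \<Gamma> \<subseteq> ?V \<times> ?V" by (rule subsetI)
    with len show "\<Gamma> \<in> {\<Gamma>. set \<Gamma> \<subseteq> ?V \<times> ?V \<and> length \<Gamma> = n}"
      by (intro CollectI conjI)
  qed
  show "finite {\<Gamma>. set \<Gamma> \<subseteq> ?V \<times> ?V \<and> length \<Gamma> = n}" by (rule finite_lists_length_eq) auto
qed

lemma finite_graph_reps [simp]: "finite (graph_reps n m)"
  by (rule finite_subset[OF _ finite_tree_graphs[of n m]]) (auto dest: graph_repsD)

lemma class_sign_iso:
  assumes "\<not> vanishes T" "oriented_iso s T \<Gamma>" shows "class_sign T \<Gamma> = s"
proof -
  have "oriented_iso 1 T \<Gamma> \<longleftrightarrow> s = 1" "oriented_iso (-1) T \<Gamma> \<longleftrightarrow> s = -1"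
    using oriented_iso_unique[OF assms(2) _ assms(1)] assms(2) by metis+
  then show ?thesis using assms(1) oriented_iso_sign[OF assms(2)] by (auto simp: class_sign_def)
qed

lemma class_sign_zero: "(\<And>s. \<not> oriented_iso s T \<Gamma>) \<Longrightarrow> class_sign T \<Gamma> = 0"
  by (simp add: class_sign_def)

lemma class_sign_weights: "(\<lambda>\<Gamma>. of_int (class_sign T \<Gamma>)) \<in> weights"
  unfolding weights_def
proof (intro CollectI allI impI)
  fix s \<Gamma> \<Gamma>' assume i: "oriented_iso s \<Gamma> \<Gamma>'"
  show "(of_int (class_sign T \<Gamma>') :: real) = of_int s * of_int (class_sign T \<Gamma>)"
  proof (cases "vanishes T \<or> (\<forall>t. \<not> oriented_iso t T \<Gamma>)")
    case True
    moreover have "oriented_iso (t * s) T \<Gamma>" if "oriented_iso t T \<Gamma>'" for t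
      by (rule oriented_iso_trans[OF that oriented_iso_sym[OF i]])
    ultimately show ?thesis by (auto simp: class_sign_def)
  next
    case False
    then obtain t where t: "\<not> vanishes T" "oriented_iso t T \<Gamma>" by auto
    have "class_sign T \<Gamma> = t" "class_sign T \<Gamma>' = t * s"
      using class_sign_iso[OF t] class_sign_iso[OF t(1) oriented_iso_trans[OF t(2) i]] by auto
    then show ?thesis by simp
  qed
qed

text \<open>
  The expansion of \<open>T\<close> in the basis of representatives. The alternative \<open>F T = 0\<close> covers the insertions
  that create an internal vertex with two incoming edges; they are not in the span of this basis, but
  their operators vanish.
\<close>

lemma graph_reps_expand:
  assumes F: "F \<in> weights" and T: "T \<in> tree_graphs n m \<or> F T = 0"
  shows "(\<Sum>\<Gamma>\<in>graph_reps n m. of_int (class_sign T \<Gamma>) * F \<Gamma>) = F T"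
proof (cases "F T = 0")
  case True
  have "of_int (class_sign T \<Gamma>) * F \<Gamma> = 0" for \<Gamma>
  proof (cases "\<exists>s. oriented_iso s T \<Gamma>")
    case True
    with weightsD[OF F] \<open>F T = 0\<close> show ?thesis by force
  next
    case False then show ?thesis by (simp add: class_sign_zero)
  qed
  then show ?thesis using True by (simp add: sum.neutral)
next
  case False
  then have T: "T \<in> tree_graphs n m" "\<not> vanishes T" using T weights_vanishes[OF F] by auto
  obtain \<Gamma>\<^sub>0 s where g: "\<Gamma>\<^sub>0 \<in> graph_reps n m" "oriented_iso s T \<Gamma>\<^sub>0" using graph_reps_exists[OF T] .
  have "of_int (class_sign T \<Gamma>) * F \<Gamma> = (if \<Gamma> = \<Gamma>\<^sub>0 then F T else 0)" if "\<Gamma> \<in> graph_reps n m" for \<Gamma>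
  proof (cases "\<exists>t. oriented_iso t T \<Gamma>")
    case True
    then have "\<Gamma> = \<Gamma>\<^sub>0" using graph_reps_unique[OF g(1) that] g(2) oriented_iso_sym oriented_iso_trans by blast
    moreover have "class_sign T \<Gamma>\<^sub>0 = s" "F \<Gamma>\<^sub>0 = of_int s * F T"
      using class_sign_iso[OF T(2) g(2)] weightsD[OF F g(2)] by auto
    ultimately show ?thesis using oriented_iso_sign[OF g(2)] by auto
  next
    case False then show ?thesis using g by (auto simp: class_sign_zero)
  qed
  then show ?thesis using g(1) by simp
qed

lemma weights_sum: "(\<And>a. a \<in> A \<Longrightarrow> F a \<in> weights) \<Longrightarrow> (\<lambda>\<Gamma>. \<Sum>a\<in>A. c a * F a \<Gamma>) \<in> weights"
  unfolding weights_def by (auto simp: sum_distrib_left mult.left_commute intro!: sum.cong)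

text \<open>
  Any combination of graphs, representatives or not, comes from weights: sum the coefficients over
  each class with the appropriate signs.
\<close>

lemma weights_spanning:
  assumes "finite S" "S \<subseteq> tree_graphs n m"
  obtains W where "W \<in> weights"
    "\<And>F. F \<in> weights \<Longrightarrow> (\<Sum>\<Gamma>\<in>graph_reps n m. W \<Gamma> * F \<Gamma>) = (\<Sum>T\<in>S. w T * F T)"
proof
  let ?W = "\<lambda>\<Gamma>. \<Sum>T\<in>S. w T * of_int (class_sign T \<Gamma>)"
  show "?W \<in> weights" by (intro weights_sum class_sign_weights)
  fix F :: "graph \<Rightarrow> real" assume F: "F \<in> weights"
  have "(\<Sum>\<Gamma>\<in>graph_reps n m. ?W \<Gamma> * F \<Gamma>) = (\<Sum>T\<in>S. w T * (\<Sum>\<Gamma>\<in>graph_reps n m. of_int (class_sign T \<Gamma>) * F \<Gamma>))"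
    by (simp add: sum_distrib_right sum_distrib_left mult.assoc) (rule sum.swap)
  also have "\<dots> = (\<Sum>T\<in>S. w T * F T)"
    using assms by (intro sum.cong refl) (auto simp: graph_reps_expand[OF F])
  finally show "(\<Sum>\<Gamma>\<in>graph_reps n m. ?W \<Gamma> * F \<Gamma>) = (\<Sum>T\<in>S. w T * F T)" .
qed

section \<open>Insertion as a sum over reattachments\<close>

definition graph_of :: "nat \<Rightarrow> (edge \<Rightarrow> vertex) \<Rightarrow> graph" where
  "graph_of n t = map (\<lambda>v. (t (v, False), t (v, True))) [0..<n]"

lemma length_graph_of [simp]: "length (graph_of n t) = n" by (simp add: graph_of_def)

lemma target_graph_of [simp]: "v < n \<Longrightarrow> target (graph_of n t) (v, b) = t (v, b)"
  by (cases b) (auto simp: target_def graph_of_def)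

lemma graph_eqI:
  assumes "length \<Gamma> = length \<Gamma>'" "\<And>v b. v < length \<Gamma> \<Longrightarrow> target \<Gamma> (v, b) = target \<Gamma>' (v, b)"
  shows "\<Gamma> = \<Gamma>'"
proof (intro nth_equalityI assms)
  fix v assume "v < length \<Gamma>"
  from assms(2)[OF this, of True] assms(2)[OF this, of False] show "\<Gamma> ! v = \<Gamma>' ! v"
    by (simp add: target_def prod_eq_iff)
qed

lemma target_append:
  "target (\<Gamma> @ \<Delta>) (v, b) = (if v < length \<Gamma> then target \<Gamma> (v, b) else target \<Delta> (v - length \<Gamma>, b))"
  by (auto simp: target_def nth_append)

lemma target_map: "v < length \<Gamma> \<Longrightarrow> target (map (map_prod f f) \<Gamma>) (v, b) = f (target \<Gamma> (v, b))"
  by (auto simp: target_def)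

lemma inj_embed: "inj (embed n i)"
proof (rule injI)
  fix u w show "embed n i u = embed n i w \<Longrightarrow> u = w" by (cases u; cases w) auto
qed

lemma distinct_reattach: "distinct (reattach i m \<Gamma> n u)"
  by (cases u) (auto simp: distinct_map intro: inj_on_subset[OF inj_embed])

definition graft :: "nat \<Rightarrow> graph \<Rightarrow> graph \<Rightarrow> (edge \<Rightarrow> vertex) \<Rightarrow> graph" where
  "graft i \<Gamma>\<^sub>1 \<Gamma>\<^sub>2 r = graph_of (length \<Gamma>\<^sub>1) r @
     map (map_prod (embed (length \<Gamma>\<^sub>1) i) (embed (length \<Gamma>\<^sub>1) i)) \<Gamma>\<^sub>2"

lemma length_graft [simp]: "length (graft i \<Gamma>\<^sub>1 \<Gamma>\<^sub>2 r) = length \<Gamma>\<^sub>1 + length \<Gamma>\<^sub>2"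
  by (simp add: graft_def)

lemma target_graft:
  "v < length \<Gamma>\<^sub>1 \<Longrightarrow> target (graft i \<Gamma>\<^sub>1 \<Gamma>\<^sub>2 r) (v, b) = r (v, b)"
  "v < length \<Gamma>\<^sub>2 \<Longrightarrow> target (graft i \<Gamma>\<^sub>1 \<Gamma>\<^sub>2 r) (length \<Gamma>\<^sub>1 + v, b) = embed (length \<Gamma>\<^sub>1) i (target \<Gamma>\<^sub>2 (v, b))"
  by (simp_all add: graft_def target_append target_map)

text \<open>
  The choices listed by an insertion are the functions \<open>r\<close> that give the new targets of the edges of
  the outer graph.
\<close>

lemma sum_insertion:
  fixes f :: "graph \<Rightarrow> 'a::comm_monoid_add"
  shows "(\<Sum>T\<leftarrow>insertion i m \<Gamma>\<^sub>1 \<Gamma>\<^sub>2. f T) =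
    (\<Sum>r\<in>(\<Pi>\<^sub>E e\<in>set (edges \<Gamma>\<^sub>1). set (reattach i m \<Gamma>\<^sub>2 (length \<Gamma>\<^sub>1) (target \<Gamma>\<^sub>1 e))).
      f (graft i \<Gamma>\<^sub>1 \<Gamma>\<^sub>2 r))"
proof -
  let ?n = "length \<Gamma>\<^sub>1" and ?E = "set (edges \<Gamma>\<^sub>1)"
  let ?R = "\<lambda>u. reattach i m \<Gamma>\<^sub>2 ?n u"
  let ?L = "map (\<lambda>(a, b). List.product (?R a) (?R b)) \<Gamma>\<^sub>1"
  let ?tl = "map (map_prod (embed ?n i) (embed ?n i)) \<Gamma>\<^sub>2"
  have dist: "distinct (product_lists ?L)"
    by (rule distinct_product_lists) (auto simp: distinct_product distinct_reattach)
  have mem: "\<Delta> \<in> set (product_lists ?L) \<longleftrightarrow> length \<Delta> = ?n \<and> (\<forall>v<?n. \<forall>b. target \<Delta> (v, b) \<in> set (?R (target \<Gamma>\<^sub>1 (v, b))))" for \<Delta>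
    by (auto simp: product_lists_set list_all2_conv_all_nth target_def split_def mem_Times_iff all_bool_eq)
  have "(\<Sum>T\<leftarrow>insertion i m \<Gamma>\<^sub>1 \<Gamma>\<^sub>2. f T) = (\<Sum>\<Delta>\<in>set (product_lists ?L). f (\<Delta> @ ?tl))"
    unfolding insertion_def Let_def
    by (simp add: o_def sum_list_distinct_conv_sum_set[OF dist])
  also have "\<dots> = (\<Sum>r\<in>(\<Pi>\<^sub>E e\<in>?E. set (?R (target \<Gamma>\<^sub>1 e))). f (graph_of ?n r @ ?tl))"
    by (rule sum.reindex_bij_witness[of _ "graph_of ?n" "\<lambda>\<Delta>. restrict (target \<Delta>) ?E"])
       (auto simp: mem set_edges PiE_def extensional_def restrict_def fun_eq_iff intro!: graph_eqI
         intro: arg_cong[of _ _ f])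
  finally show ?thesis unfolding graft_def .
qed

section \<open>Forests\<close>

lemma edge_in_edges [simp]: "(v, b) \<in> set (edges \<Gamma>) \<longleftrightarrow> v < length \<Gamma>"
  by (simp add: set_edges)

definition leaf_edges :: "graph \<Rightarrow> edge set" where
  "leaf_edges \<Gamma> = {e \<in> set (edges \<Gamma>). \<exists>j. target \<Gamma> e = Bdry j}"

lemma finite_leaf_edges [simp]: "finite (leaf_edges \<Gamma>)"
  by (simp add: leaf_edges_def)

definition successor_rel :: "graph \<Rightarrow> (nat \<times> nat) set" where
  "successor_rel \<Gamma> = {(v, w). \<exists>b. (v, b) \<in> set (edges \<Gamma>) \<and> target \<Gamma> (v, b) = Inner w}"

lemma target_cases:
  assumes "\<Gamma> \<in> tree_graphs n m" "e \<in> set (edges \<Gamma>)"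
  obtains w where "w < n" "target \<Gamma> e = Inner w" | j where "j < m" "target \<Gamma> e = Bdry j"
  using tree_graphsD(2)[OF assms] by (auto simp: set_vertices)

lemma inner_target_less:
  assumes "\<Gamma> \<in> tree_graphs n m" "v < n" "target \<Gamma> (v, b) = Inner w" shows "w < n"
  using tree_graphsD(1)[OF assms(1)] tree_graphsD(2)[OF assms(1), of "(v, b)"] assms
  by (auto simp: set_vertices)

lemma successor_rel_finite_acyclic:
  assumes "\<Gamma> \<in> tree_graphs n m"
  shows "finite (successor_rel \<Gamma>)" "acyclic (successor_rel \<Gamma>)"
proof -
  have "successor_rel \<Gamma> \<subseteq> {..<n} \<times> {..<n}"
    using tree_graphsD(1)[OF assms] inner_target_less[OF assms] by (auto simp: successor_rel_def)
  then show "finite (successor_rel \<Gamma>)" by (rule finite_subset) simp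
  show "acyclic (successor_rel \<Gamma>)" using tree_graphsD(3)[OF assms] by (simp add: successor_rel_def)
qed

text \<open>
  A maximal vertex for the acyclic relation of being joined by an edge.
\<close>

lemma bottom_vertex:
  assumes "\<Gamma> \<in> tree_graphs n m" "n > 0"
  obtains v where "v < n" "\<And>b. (v, b) \<in> leaf_edges \<Gamma>"
proof -
  note f = successor_rel_finite_acyclic[OF assms(1)]
  have "wf ((successor_rel \<Gamma>)\<inverse>)" by (rule finite_acyclic_wf_converse[OF f])
  then obtain v where v: "v \<in> {..<n}" "\<And>w. (v, w) \<in> successor_rel \<Gamma> \<Longrightarrow> w \<notin> {..<n}"
    by (rule wfE_min[of _ 0 "{..<n}"]) (use assms in auto)
  have "(v, b) \<in> leaf_edges \<Gamma>" for b
  proof -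
    have e: "(v, b) \<in> set (edges \<Gamma>)" using v tree_graphsD(1)[OF assms(1)] by simp
    show ?thesis
    proof (rule target_cases[OF assms(1) e])
      fix w assume w: "w < n" "target \<Gamma> (v, b) = Inner w"
      then have "(v, w) \<in> successor_rel \<Gamma>" using e unfolding successor_rel_def by blast
      then show ?thesis using v(2) w by auto
    qed (use e in \<open>auto simp: leaf_edges_def\<close>)
  qed
  then show ?thesis using that v by auto
qed

text \<open>
  Of the \<open>2 n\<close> edges, those with internal targets have different targets and miss a vertex that is
  minimal for the acyclic relation; so there are at most \<open>n - 1\<close> of them.
\<close>

lemma card_leaf_edges:
  assumes g: "\<Gamma> \<in> tree_graphs n m" and n: "n > 0"
  shows "card (leaf_edges \<Gamma>) \<ge> n + 1"
proof -
  note f = successor_rel_finite_acyclic[OF g] and len = tree_graphsD(1)[OF g]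
  have "wf (successor_rel \<Gamma>)" by (rule finite_acyclic_wf[OF f])
  then obtain r where r: "r \<in> {..<n}" "\<And>w. (w, r) \<in> successor_rel \<Gamma> \<Longrightarrow> w \<notin> {..<n}"
    by (rule wfE_min[of _ 0 "{..<n}"]) (use n in auto)
  define I where "I = {e \<in> set (edges \<Gamma>). \<exists>w. target \<Gamma> e = Inner w}"
  have "inj_on (target \<Gamma>) I"
  proof (rule inj_onI)
    fix e e' assume e: "e \<in> I" "e' \<in> I" "target \<Gamma> e = target \<Gamma> e'"
    then obtain w where w: "target \<Gamma> e = Inner w" by (auto simp: I_def)
    have "w < n" by (rule target_cases[OF g, of e]) (use e w in \<open>auto simp: I_def\<close>)
    from tree_graphsD(4)[OF g this] have "card (set (incoming \<Gamma> (Inner w))) \<le> 1"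
      by (simp add: distinct_card)
    moreover have "e \<in> set (incoming \<Gamma> (Inner w))" "e' \<in> set (incoming \<Gamma> (Inner w))"
      using e w by (auto simp: set_incoming I_def)
    ultimately show "e = e'" by (metis card_le_Suc0_iff_eq One_nat_def List.finite_set)
  qed
  then have "card I = card (target \<Gamma> ` I)" by (simp add: card_image)
  also have "\<dots> \<le> card (Inner ` ({..<n} - {r}))"
  proof (rule card_mono)
    show "target \<Gamma> ` I \<subseteq> Inner ` ({..<n} - {r})"
    proof
      fix u assume "u \<in> target \<Gamma> ` I"
      then obtain e w where e: "e \<in> set (edges \<Gamma>)" "u = target \<Gamma> e" "target \<Gamma> e = Inner w" by (auto simp: I_def)
      have w: "w < n" by (rule target_cases[OF g e(1)]) (use e in auto)
      have "(fst e, w) \<in> successor_rel \<Gamma>" "fst e \<in> {..<n}" using e len by (auto simp: successor_rel_def set_edges)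
      then have "w \<noteq> r" using r(2) by blast
      with w e show "u \<in> Inner ` ({..<n} - {r})" by auto
    qed
  qed simp
  also have "\<dots> = n - 1" using r by (simp add: card_image inj_on_def)
  finally have I: "card I \<le> n - 1" .
  have "card (set (edges \<Gamma>)) = 2 * n" by (simp add: set_edges len card_cartesian_product)
  moreover have "set (edges \<Gamma>) = leaf_edges \<Gamma> \<union> I"
    by (auto simp: leaf_edges_def I_def) (metis vertex.exhaust)
  then have "card (set (edges \<Gamma>)) \<le> card (leaf_edges \<Gamma>) + card I"
    by (metis card_Un_le)
  ultimately show ?thesis using I n by linarith
qed

section \<open>Changing the boundary\<close>

lemma tree_graphs_cong:
  assumes g: "\<Gamma> \<in> tree_graphs n m" and len: "length \<Gamma>' = n"
    and inner: "\<And>v b w. v < n \<Longrightarrow> target \<Gamma>' (v, b) = Inner w \<longleftrightarrow> target \<Gamma> (v, b) = Inner w"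
    and bdry: "\<And>v b j. v < n \<Longrightarrow> target \<Gamma>' (v, b) = Bdry j \<Longrightarrow> j < m'"
  shows "\<Gamma>' \<in> tree_graphs n m'"
proof -
  note lg = tree_graphsD(1)[OF g]
  have 1: "target \<Gamma>' e \<in> set (vertices n m')" if e: "e \<in> set (edges \<Gamma>')" for e
  proof (cases "target \<Gamma>' e")
    case (Inner w)
    have v: "fst e < n" using e len by (auto simp: set_edges)
    then have "target \<Gamma> (fst e, snd e) = Inner w" using iffD1[OF inner[OF v, of "snd e" w]] Inner by simp
    then have "w < n" by (rule inner_target_less[OF g v])
    then show ?thesis using Inner by (simp add: set_vertices)
  next
    case (Bdry j)
    then show ?thesis using bdry[of "fst e" "snd e"] e len by (auto simp: set_vertices set_edges)
  qed
  have 2: "successor_rel \<Gamma>' = successor_rel \<Gamma>"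
    using inner len lg by (auto simp: successor_rel_def)
  have 3: "incoming \<Gamma>' (Inner w) = incoming \<Gamma> (Inner w)" for w
    unfolding incoming_def edges_def len lg by (rule filter_cong) (use inner in auto)
  have "acyclic (successor_rel \<Gamma>')" using successor_rel_finite_acyclic(2)[OF g] 2 by metis
  then show ?thesis using 1 tree_graphsD(4)[OF g] len 3
    unfolding tree_graphs_def successor_rel_def by (intro CollectI conjI) auto
qed

definition rebind :: "graph \<Rightarrow> (edge \<Rightarrow> nat) \<Rightarrow> graph" where
  "rebind \<Gamma> l = graph_of (length \<Gamma>)
     (\<lambda>e. case target \<Gamma> e of Inner w \<Rightarrow> Inner w | Bdry j \<Rightarrow> Bdry (l e))"

lemma length_rebind [simp]: "length (rebind \<Gamma> l) = length \<Gamma>" by (simp add: rebind_def)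

lemma target_rebind: "e \<in> set (edges \<Gamma>) \<Longrightarrow>
    target (rebind \<Gamma> l) e = (case target \<Gamma> e of Inner w \<Rightarrow> Inner w | Bdry j \<Rightarrow> Bdry (l e))"
  by (cases e, hypsubst, simp add: rebind_def)

lemma edges_rebind [simp]: "edges (rebind \<Gamma> l) = edges \<Gamma>" by (simp add: edges_def)

lemma rebind_tree:
  assumes "\<Gamma> \<in> tree_graphs n m" "\<And>e. e \<in> leaf_edges \<Gamma> \<Longrightarrow> l e < m'"
  shows "rebind \<Gamma> l \<in> tree_graphs n m'"
  using tree_graphsD(1)[OF assms(1)] assms(2)
  by (intro tree_graphs_cong[OF assms(1)])
     (auto simp: target_rebind leaf_edges_def split: vertex.splits)

fun map_bdry :: "(nat \<Rightarrow> nat) \<Rightarrow> vertex \<Rightarrow> vertex" where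
  "map_bdry f (Inner v) = Inner v"
| "map_bdry f (Bdry j) = Bdry (f j)"

definition bdry_image :: "(nat \<Rightarrow> nat) \<Rightarrow> graph \<Rightarrow> graph" where
  "bdry_image f = map (map_prod (map_bdry f) (map_bdry f))"

lemma length_bdry_image [simp]: "length (bdry_image f \<Gamma>) = length \<Gamma>"
  by (simp add: bdry_image_def)

lemma target_bdry_image: "v < length \<Gamma> \<Longrightarrow> target (bdry_image f \<Gamma>) (v, b) = map_bdry f (target \<Gamma> (v, b))"
  by (simp add: bdry_image_def target_map)

lemma oriented_iso_bdry_image:
  assumes "oriented_iso s \<Gamma> \<Gamma>'" shows "oriented_iso s (bdry_image f \<Gamma>) (bdry_image f \<Gamma>')"
proof -
  obtain \<sigma> S where 1: "iso_via \<sigma> S \<Gamma> \<Gamma>'" "s = flip_sign (length \<Gamma>) S" using assms by (auto simp: oriented_iso_iff)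
  have \<sigma>: "\<sigma> permutes {..<length \<Gamma>}" using 1 by (simp add: iso_via_def)
  have c: "map_bdry f (relabel \<sigma> u) = relabel \<sigma> (map_bdry f u)" for u by (cases u) auto
  have "iso_via \<sigma> S (bdry_image f \<Gamma>) (bdry_image f \<Gamma>')"
    using 1 permutes_in_image[OF \<sigma>] by (auto simp: iso_via_def target_bdry_image c)
  then show ?thesis unfolding oriented_iso_iff using 1(2) by auto
qed

lemma oriented_iso_bdry_edge:
  assumes "oriented_iso s \<Gamma> \<Gamma>'" "v < length \<Gamma>" "target \<Gamma> (v, b) = Bdry j"
  shows "\<exists>v b. v < length \<Gamma>' \<and> target \<Gamma>' (v, b) = Bdry j"
proof -
  obtain \<sigma> S where 1: "iso_via \<sigma> S \<Gamma> \<Gamma>'" using assms by (auto simp: oriented_iso_iff)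
  have \<sigma>: "\<sigma> permutes {..<length \<Gamma>}" using 1 by (simp add: iso_via_def)
  have "target \<Gamma>' (\<sigma> v, b \<noteq> (v \<in> S)) = Bdry j" using 1 assms by (simp add: iso_via_def)
  moreover have "\<sigma> v < length \<Gamma>'" using permutes_in_image[OF \<sigma>, of v] assms 1 by (simp add: iso_via_def)
  ultimately show ?thesis by blast
qed

section \<open>Leading terms of the coproduct\<close>

text \<open>
  Merging of the boundary vertices \<open>i\<close> and \<open>i + 1\<close>, the left inverse of the insertion of \<open>b\<^sub>0\<close> at \<open>i\<close>.
\<close>

definition bdry_collapse :: "nat \<Rightarrow> nat \<Rightarrow> nat" where
  "bdry_collapse i j = (if j \<le> i then j else j - 1)"

text \<open>
  The contribution of \<open>\<gamma> = b\<^sub>0\<close> at position \<open>i\<close> to the coproduct.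
\<close>

definition doubling_coeff :: "nat \<Rightarrow> graph \<Rightarrow> graph \<Rightarrow> int" where
  "doubling_coeff i \<Gamma>\<^sub>1 \<Gamma> = (\<Sum>T\<leftarrow>insertion i 2 \<Gamma>\<^sub>1 []. class_sign T \<Gamma>)"

lemma reattach_nil:
  "u' \<in> set (reattach i 2 [] n u) \<Longrightarrow> map_bdry (bdry_collapse i) u' = u"
  by (cases u) (auto simp: vertices_def bdry_collapse_def split: if_splits)

lemma doubling_terms:
  "doubling_coeff i \<Gamma>\<^sub>1 \<Gamma> = (\<Sum>r\<in>(\<Pi>\<^sub>E e\<in>set (edges \<Gamma>\<^sub>1). set (reattach i 2 [] (length \<Gamma>\<^sub>1) (target \<Gamma>\<^sub>1 e))).
      class_sign (graph_of (length \<Gamma>\<^sub>1) r) \<Gamma>)"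
  unfolding doubling_coeff_def sum_insertion by (simp add: graft_def)

lemma doubling_collapse:
  assumes "r \<in> (\<Pi>\<^sub>E e\<in>set (edges \<Gamma>\<^sub>1). set (reattach i 2 [] (length \<Gamma>\<^sub>1) (target \<Gamma>\<^sub>1 e)))"
  shows "bdry_image (bdry_collapse i) (graph_of (length \<Gamma>\<^sub>1) r) = \<Gamma>\<^sub>1"
proof (rule graph_eqI)
  fix v b assume "v < length (bdry_image (bdry_collapse i) (graph_of (length \<Gamma>\<^sub>1) r))"
  then have v: "v < length \<Gamma>\<^sub>1" by simp
  then have "r (v, b) \<in> set (reattach i 2 [] (length \<Gamma>\<^sub>1) (target \<Gamma>\<^sub>1 (v, b)))"
    using assms by (auto simp: PiE_def Pi_def)
  from reattach_nil[OF this] v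
  show "target (bdry_image (bdry_collapse i) (graph_of (length \<Gamma>\<^sub>1) r)) (v, b) = target \<Gamma>\<^sub>1 (v, b)"
    by (simp add: target_bdry_image)
qed simp

lemma doubling_coeff_zero:
  assumes "\<And>s. \<not> oriented_iso s \<Gamma>\<^sub>1 (bdry_image (bdry_collapse i) \<Gamma>)"
  shows "doubling_coeff i \<Gamma>\<^sub>1 \<Gamma> = 0"
  unfolding doubling_terms
proof (intro sum.neutral ballI class_sign_zero notI)
  fix r s assume r: "r \<in> (\<Pi>\<^sub>E e\<in>set (edges \<Gamma>\<^sub>1). set (reattach i 2 [] (length \<Gamma>\<^sub>1) (target \<Gamma>\<^sub>1 e)))"
    and "oriented_iso s (graph_of (length \<Gamma>\<^sub>1) r) \<Gamma>"
  from oriented_iso_bdry_image[OF this(2), of "bdry_collapse i"] assms show False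
    by (simp add: doubling_collapse[OF r])
qed

text \<open>
  Every term of the insertion of \<open>b\<^sub>0\<close> into \<open>\<Gamma>\<^sub>0\<close> collapses to \<open>\<Gamma>\<^sub>0\<close>. So if it is isomorphic to \<open>\<Gamma>'\<close>, and hence to \<open>\<Gamma>\<close>,
  the sign of the latter isomorphism is that of an automorphism of the nonvanishing graph \<open>\<Gamma>\<^sub>0\<close>, namely 1.
  Hence all these terms count with the same sign \<open>t\<close>, and \<open>\<Gamma>\<close> itself is one of them.
\<close>

lemma doubling_coeff_nonzero:
  assumes nv: "\<not> vanishes \<Gamma>\<^sub>0" and len: "length \<Gamma> = length \<Gamma>\<^sub>0" and i: "i < 2"
    and coll: "bdry_image (bdry_collapse i) \<Gamma> = \<Gamma>\<^sub>0"
    and small: "\<And>v b j. v < length \<Gamma>\<^sub>0 \<Longrightarrow> target \<Gamma> (v, b) = Bdry j \<Longrightarrow> j < 3"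
    and iso: "oriented_iso t \<Gamma> \<Gamma>'"
  shows "doubling_coeff i \<Gamma>\<^sub>0 \<Gamma>' \<noteq> 0"
proof -
  let ?n = "length \<Gamma>\<^sub>0"
  let ?R = "\<Pi>\<^sub>E e\<in>set (edges \<Gamma>\<^sub>0). set (reattach i 2 [] ?n (target \<Gamma>\<^sub>0 e))"
  have nvG: "\<not> vanishes \<Gamma>"
    using nv oriented_iso_bdry_image[of "-1" \<Gamma> \<Gamma> "bdry_collapse i"] by (auto simp: vanishes_def coll)
  have t: "t = 1 \<or> t = -1" by (rule oriented_iso_sign[OF iso])
  have ge: "t * class_sign (graph_of ?n r) \<Gamma>' \<ge> 0" if r: "r \<in> ?R" for r
  proof (cases "vanishes (graph_of ?n r) \<or> (\<forall>s. \<not> oriented_iso s (graph_of ?n r) \<Gamma>')")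
    case False
    then obtain s where s: "\<not> vanishes (graph_of ?n r)" "oriented_iso s (graph_of ?n r) \<Gamma>'" by blast
    have "oriented_iso (s * t) (graph_of ?n r) \<Gamma>"
      by (rule oriented_iso_trans[OF s(2) oriented_iso_sym[OF iso]])
    from oriented_iso_bdry_image[OF this, of "bdry_collapse i"] have "oriented_iso (s * t) \<Gamma>\<^sub>0 \<Gamma>\<^sub>0"
      by (simp add: doubling_collapse[OF r] coll)
    from oriented_iso_unique[OF this oriented_iso_refl nv] show ?thesis
      by (simp add: class_sign_iso[OF s] mult.commute)
  qed (auto simp: class_sign_def)
  let ?r = "restrict (target \<Gamma>) (set (edges \<Gamma>\<^sub>0))"
  have "target \<Gamma> (v, b) \<in> set (reattach i 2 [] ?n (target \<Gamma>\<^sub>0 (v, b)))" if v: "v < ?n" for v b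
  proof -
    have "target \<Gamma>\<^sub>0 (v, b) = map_bdry (bdry_collapse i) (target \<Gamma> (v, b))"
      using target_bdry_image[of v \<Gamma> "bdry_collapse i" b] v len coll by simp
    then show ?thesis using small[OF v, of b] i
      by (cases "target \<Gamma> (v, b)") (auto simp: bdry_collapse_def vertices_def less_Suc_eq numeral_2_eq_2 numeral_3_eq_3)
  qed
  then have r: "?r \<in> ?R" by (auto simp: PiE_def Pi_def extensional_def set_edges)
  have "graph_of ?n ?r = \<Gamma>" by (rule graph_eqI) (auto simp: len)
  then have "class_sign (graph_of ?n ?r) \<Gamma>' = t" using class_sign_iso[OF nvG iso] by simp
  then have pos: "t * class_sign (graph_of ?n ?r) \<Gamma>' > 0" using t by auto
  have "(\<Sum>r\<in>?R. t * class_sign (graph_of ?n r) \<Gamma>') > 0"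
    by (rule sum_pos2[where i = ?r, OF _ r]) (use pos ge in \<open>auto intro: finite_PiE\<close>)
  then show ?thesis unfolding doubling_terms by (auto simp: sum_distrib_left[symmetric])
qed

lemma graph_reps_0: "graph_reps 0 m = {[]}"
proof -
  have "\<not> vanishes []" by (auto simp: vanishes_def oriented_iso_def)
  moreover have t: "[] \<in> tree_graphs 0 m" by (auto simp: tree_graphs_def edges_def acyclic_def)
  ultimately obtain \<Gamma> s where "\<Gamma> \<in> graph_reps 0 m" "oriented_iso s [] \<Gamma>" using graph_reps_exists by blast
  then show ?thesis using graph_reps_length by fastforce
qed

text \<open>
  An insertion into \<open>b\<^sub>0\<close> leaves the first or the last of the three boundary vertices isolated.
\<close>

lemma composition_nil_left:
  assumes g: "\<Gamma>\<^sub>2 \<in> tree_graphs n 2" and e: "v < length \<Gamma>" "target \<Gamma> (v, b) = Bdry 0"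
    and e': "v' < length \<Gamma>" "target \<Gamma> (v', b') = Bdry 2"
  shows "composition_coeff [] \<Gamma>\<^sub>2 \<Gamma> = 0"
proof -
  let ?T = "\<lambda>i. map (map_prod (embed 0 i) (embed 0 i)) \<Gamma>\<^sub>2"
  have ins: "insertion i 2 [] \<Gamma>\<^sub>2 = [?T i]" for i by (simp add: insertion_def)
  have bdry: "i \<le> j \<and> j < i + 2" if v: "v < length \<Gamma>\<^sub>2" and j: "target (?T i) (v, b) = Bdry j" for v b i j
  proof -
    have "embed 0 i (target \<Gamma>\<^sub>2 (v, b)) = Bdry j" using j v by (simp add: target_map)
    moreover have "(v, b) \<in> set (edges \<Gamma>\<^sub>2)" using v by simp
    from tree_graphsD(2)[OF g this] have "target \<Gamma>\<^sub>2 (v, b) \<in> set (vertices n 2)" .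
    ultimately show ?thesis by (auto simp: set_vertices)
  qed
  have "\<not> oriented_iso s (?T 0) \<Gamma>" for s
  proof
    assume "oriented_iso s (?T 0) \<Gamma>"
    from oriented_iso_bdry_edge[OF oriented_iso_sym[OF this] e'] bdry[where i=0] show False by force
  qed
  moreover have "\<not> oriented_iso s (?T 1) \<Gamma>" for s
  proof
    assume "oriented_iso s (?T 1) \<Gamma>"
    from oriented_iso_bdry_edge[OF oriented_iso_sym[OF this] e] bdry[where i=1] show False by force
  qed
  ultimately show ?thesis unfolding composition_coeff_def ins by (simp add: class_sign_zero)
qed

text \<open>
  In all other terms both factors have fewer than \<open>n\<close> vertices, where the weights agree.
\<close>

lemma weight_coproduct_diff:
  assumes n: "n \<ge> 2" and W: "W [] = 1" "W' [] = 1" "agree_below n W W'"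
    and g: "length \<Gamma> = n"
  shows "weight_coproduct W \<Gamma> - weight_coproduct W' \<Gamma> =
    (\<Sum>\<Gamma>\<^sub>1\<in>graph_reps n 2. of_int (composition_coeff \<Gamma>\<^sub>1 [] \<Gamma> + composition_coeff [] \<Gamma>\<^sub>1 \<Gamma>) * (W \<Gamma>\<^sub>1 - W' \<Gamma>\<^sub>1))"
proof -
  define t where "t V l = (\<Sum>\<Gamma>\<^sub>1\<in>graph_reps (n - l) 2. \<Sum>\<Gamma>\<^sub>2\<in>graph_reps l 2.
        of_int (coproduct \<Gamma> (\<Gamma>\<^sub>1, \<Gamma>\<^sub>2)) * (V \<Gamma>\<^sub>1 * V \<Gamma>\<^sub>2))" for V :: "graph \<Rightarrow> real" and l
  have wc: "weight_coproduct V \<Gamma> = (\<Sum>l\<le>n. t V l)" for V by (simp add: weight_coproduct_def t_def g)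
  have eq: "t W l = t W' l" if "l \<in> {..n} - {0, n}" for l
  proof -
    have l: "n - l < n" "l < n" using that by auto
    have "W \<Gamma>\<^sub>1 = W' \<Gamma>\<^sub>1" if "\<Gamma>\<^sub>1 \<in> graph_reps (n - l) 2" for \<Gamma>\<^sub>1
      using W(3) that l unfolding agree_below_def by blast
    moreover have "W \<Gamma>\<^sub>1 = W' \<Gamma>\<^sub>1" if "\<Gamma>\<^sub>1 \<in> graph_reps l 2" for \<Gamma>\<^sub>1
      using W(3) that l unfolding agree_below_def by blast
    ultimately show ?thesis unfolding t_def by (intro sum.cong refl) auto
  qed
  have "(\<Sum>l\<le>n. t W l) - (\<Sum>l\<le>n. t W' l) = (\<Sum>l\<le>n. t W l - t W' l)" by (simp add: sum_subtractf)
  also have "\<dots> = (\<Sum>l\<in>{0, n}. t W l - t W' l)"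
    by (rule sum.mono_neutral_right) (use eq in auto)
  also have "\<dots> = (t W 0 - t W' 0) + (t W n - t W' n)" using n by simp
  finally show ?thesis unfolding wc
    by (simp add: t_def graph_reps_0 W coproduct_def sum_subtractf[symmetric] sum.distrib[symmetric] algebra_simps)
qed

text \<open>
  Take a vertex with both edges at the boundary. They end at different vertices, since \<open>\<Gamma>\<^sub>0\<close> does not
  vanish, and there is a third edge \<open>z\<close> at the boundary. Pull the one of the two edges that shares its end
  with \<open>z\<close> onto a new boundary vertex in the middle. One collapse gives back \<open>\<Gamma>\<^sub>0\<close>, and the other one makes
  the two edges parallel; by \<open>z\<close> and the edge that was not moved, the first and the last boundary vertex
  are still in use.
\<close>

lemma separating_graph:
  assumes n: "n \<ge> 2" and g: "\<Gamma>\<^sub>0 \<in> graph_reps n 2"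
  obtains \<Gamma> i v b v' b' where "\<Gamma> \<in> tree_graphs n 3" "i < 2" "bdry_image (bdry_collapse i) \<Gamma> = \<Gamma>\<^sub>0"
    "vanishes (bdry_image (bdry_collapse (1 - i)) \<Gamma>)"
    "v < n" "target \<Gamma> (v, b) = Bdry 0" "v' < n" "target \<Gamma> (v', b') = Bdry 2"
proof -
  note t = graph_repsD(1)[OF g] and nv = graph_repsD(2)[OF g]
  have len: "length \<Gamma>\<^sub>0 = n" by (rule tree_graphsD(1)[OF t])
  obtain v where v: "v < n" "\<And>b. (v, b) \<in> leaf_edges \<Gamma>\<^sub>0" using bottom_vertex[OF t] n by auto
  have two: "target \<Gamma>\<^sub>0 e = Bdry 0 \<or> target \<Gamma>\<^sub>0 e = Bdry 1" if "e \<in> leaf_edges \<Gamma>\<^sub>0" for e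
    using that by (auto simp: leaf_edges_def less_Suc_eq numeral_2_eq_2 elim!: target_cases[OF t])
  have "target \<Gamma>\<^sub>0 (v, False) \<noteq> target \<Gamma>\<^sub>0 (v, True)"
    using vanishes_parallel[of v \<Gamma>\<^sub>0] v nv len by auto
  with two[OF v(2)[of False]] two[OF v(2)[of True]] obtain b where
    b: "target \<Gamma>\<^sub>0 (v, b) = Bdry 0" "target \<Gamma>\<^sub>0 (v, \<not> b) = Bdry 1" by (metis (full_types))
  have "card {(v, b), (v, \<not> b)} < card (leaf_edges \<Gamma>\<^sub>0)"
    using card_leaf_edges[OF t] n by simp
  then obtain z where z: "z \<in> leaf_edges \<Gamma>\<^sub>0" "z \<notin> {(v, b), (v, \<not> b)}"
    by (metis card_mono finite.emptyI finite.insertI not_less subsetI)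
  have zn: "fst z < n" "(fst z, snd z) = z" using z len by (auto simp: leaf_edges_def set_edges)
  show ?thesis
  proof (cases "target \<Gamma>\<^sub>0 z = Bdry 0")
    case False
    then have z1: "target \<Gamma>\<^sub>0 z = Bdry 1" using two[OF z(1)] by simp
    let ?l = "\<lambda>e. if target \<Gamma>\<^sub>0 e = Bdry 0 then 0 else if e = (v, \<not> b) then 1 else 2 :: nat"
    have tg: "target (rebind \<Gamma>\<^sub>0 ?l) e = (case target \<Gamma>\<^sub>0 e of Inner w \<Rightarrow> Inner w | Bdry j \<Rightarrow> Bdry (?l e))"
      if "fst e < n" for e using that len by (intro target_rebind) (simp add: set_edges prod.case_eq_if mem_Times_iff)
    have "bdry_image (bdry_collapse 1) (rebind \<Gamma>\<^sub>0 ?l) = \<Gamma>\<^sub>0"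
    proof (rule graph_eqI)
      fix w c assume "w < length (bdry_image (bdry_collapse 1) (rebind \<Gamma>\<^sub>0 ?l))"
      then have w: "w < n" by (simp add: len)
      show "target (bdry_image (bdry_collapse 1) (rebind \<Gamma>\<^sub>0 ?l)) (w, c) = target \<Gamma>\<^sub>0 (w, c)"
        using w two[of "(w, c)"] len by (cases "target \<Gamma>\<^sub>0 (w, c)") (auto simp: target_bdry_image tg bdry_collapse_def leaf_edges_def)
    qed simp
    moreover have "vanishes (bdry_image (bdry_collapse (1 - 1)) (rebind \<Gamma>\<^sub>0 ?l))"
      using v b len by (intro vanishes_parallel[of v]) (cases b; auto simp: target_bdry_image tg bdry_collapse_def)+
    moreover have "rebind \<Gamma>\<^sub>0 ?l \<in> tree_graphs n 3" by (rule rebind_tree[OF t]) auto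
    moreover have "target (rebind \<Gamma>\<^sub>0 ?l) (v, b) = Bdry 0" using v b by (simp add: tg)
    moreover have "target (rebind \<Gamma>\<^sub>0 ?l) (fst z, snd z) = Bdry 2" using z z1 zn by (auto simp: tg)
    ultimately show ?thesis using that[of "rebind \<Gamma>\<^sub>0 ?l" 1 v b "fst z" "snd z"] v zn by simp
  next
    case True
    let ?l = "\<lambda>e. if target \<Gamma>\<^sub>0 e \<noteq> Bdry 0 then 2 else if e = (v, b) then 1 else 0 :: nat"
    have tg: "target (rebind \<Gamma>\<^sub>0 ?l) e = (case target \<Gamma>\<^sub>0 e of Inner w \<Rightarrow> Inner w | Bdry j \<Rightarrow> Bdry (?l e))"
      if "fst e < n" for e using that len by (intro target_rebind) (simp add: set_edges prod.case_eq_if mem_Times_iff)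
    have "bdry_image (bdry_collapse 0) (rebind \<Gamma>\<^sub>0 ?l) = \<Gamma>\<^sub>0"
    proof (rule graph_eqI)
      fix w c assume "w < length (bdry_image (bdry_collapse 0) (rebind \<Gamma>\<^sub>0 ?l))"
      then have w: "w < n" by (simp add: len)
      show "target (bdry_image (bdry_collapse 0) (rebind \<Gamma>\<^sub>0 ?l)) (w, c) = target \<Gamma>\<^sub>0 (w, c)"
        using w two[of "(w, c)"] len by (cases "target \<Gamma>\<^sub>0 (w, c)") (auto simp: target_bdry_image tg bdry_collapse_def leaf_edges_def)
    qed simp
    moreover have "vanishes (bdry_image (bdry_collapse (1 - 0)) (rebind \<Gamma>\<^sub>0 ?l))"
      using v b len by (intro vanishes_parallel[of v]) (cases b; auto simp: target_bdry_image tg bdry_collapse_def)+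
    moreover have "rebind \<Gamma>\<^sub>0 ?l \<in> tree_graphs n 3" by (rule rebind_tree[OF t]) auto
    moreover have "target (rebind \<Gamma>\<^sub>0 ?l) (v, \<not> b) = Bdry 2" using v b by (simp add: tg)
    moreover have "target (rebind \<Gamma>\<^sub>0 ?l) (fst z, snd z) = Bdry 0" using z True zn by (auto simp: tg)
    ultimately show ?thesis using that[of "rebind \<Gamma>\<^sub>0 ?l" 0 "fst z" "snd z" v "\<not> b"] v zn by simp
  qed
qed

text \<open>
  For the graph of the preceding lemma, only one of the two collapses contributes to the difference of
  the coproducts, and only with the weight of \<open>\<Gamma>\<^sub>0\<close>.
\<close>

lemma coproduct_determines_weights:
  assumes n: "n \<ge> 2" and W: "W [] = 1" "W' [] = 1" "agree_below n W W'"
    and eq: "\<And>\<Gamma>. \<Gamma> \<in> graph_reps n 3 \<Longrightarrow> weight_coproduct W \<Gamma> = weight_coproduct W' \<Gamma>"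
    and g: "\<Gamma>\<^sub>0 \<in> graph_reps n 2"
  shows "W \<Gamma>\<^sub>0 = W' \<Gamma>\<^sub>0"
proof -
  note nv = graph_repsD(2)[OF g] and len = graph_reps_length[OF g]
  obtain \<Gamma> i v b v' b' where G: "\<Gamma> \<in> tree_graphs n 3" "i < 2" "bdry_image (bdry_collapse i) \<Gamma> = \<Gamma>\<^sub>0"
    "vanishes (bdry_image (bdry_collapse (1 - i)) \<Gamma>)"
    "v < n" "target \<Gamma> (v, b) = Bdry 0" "v' < n" "target \<Gamma> (v', b') = Bdry 2"
    by (rule separating_graph[OF n g])
  have lenG: "length \<Gamma> = n" by (rule tree_graphsD(1)[OF G(1)])
  have nvG: "\<not> vanishes \<Gamma>"
    using nv oriented_iso_bdry_image[of "-1" \<Gamma> \<Gamma> "bdry_collapse i"] by (auto simp: vanishes_def G(3))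
  obtain \<Gamma>' s where G': "\<Gamma>' \<in> graph_reps n 3" "oriented_iso s \<Gamma> \<Gamma>'" by (rule graph_reps_exists[OF G(1) nvG])
  have lenG': "length \<Gamma>' = n" by (rule graph_reps_length[OF G'(1)])
  obtain w c where w: "w < length \<Gamma>'" "target \<Gamma>' (w, c) = Bdry 0"
    using oriented_iso_bdry_edge[OF G'(2) _ G(6)] G(5) lenG by auto
  obtain w' c' where w': "w' < length \<Gamma>'" "target \<Gamma>' (w', c') = Bdry 2"
    using oriented_iso_bdry_edge[OF G'(2) _ G(8)] G(7) lenG by auto
  have right: "composition_coeff [] \<Gamma>\<^sub>1 \<Gamma>' = 0" if "\<Gamma>\<^sub>1 \<in> graph_reps n 2" for \<Gamma>\<^sub>1
    by (rule composition_nil_left[OF graph_repsD(1)[OF that] w w'])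
  have zero: "doubling_coeff (1 - i) \<Gamma>\<^sub>1 \<Gamma>' = 0" if "\<Gamma>\<^sub>1 \<in> graph_reps n 2" for \<Gamma>\<^sub>1
  proof (rule doubling_coeff_zero, rule notI)
    fix t assume "oriented_iso t \<Gamma>\<^sub>1 (bdry_image (bdry_collapse (1 - i)) \<Gamma>')"
    moreover have "vanishes (bdry_image (bdry_collapse (1 - i)) \<Gamma>')"
      by (rule vanishes_iso[OF oriented_iso_bdry_image[OF G'(2)] G(4)])
    ultimately have "vanishes \<Gamma>\<^sub>1" using vanishes_iso oriented_iso_sym by blast
    then show False using graph_repsD(2)[OF that] by simp
  qed
  have other: "doubling_coeff i \<Gamma>\<^sub>1 \<Gamma>' = 0" if "\<Gamma>\<^sub>1 \<in> graph_reps n 2" "\<Gamma>\<^sub>1 \<noteq> \<Gamma>\<^sub>0" for \<Gamma>\<^sub>1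
  proof (rule doubling_coeff_zero, rule notI)
    fix t assume a: "oriented_iso t \<Gamma>\<^sub>1 (bdry_image (bdry_collapse i) \<Gamma>')"
    have "oriented_iso s \<Gamma>\<^sub>0 (bdry_image (bdry_collapse i) \<Gamma>')"
      using oriented_iso_bdry_image[OF G'(2), of "bdry_collapse i"] by (simp add: G(3))
    from oriented_iso_trans[OF a oriented_iso_sym[OF this]] that g show False using graph_reps_unique by blast
  qed
  have main: "doubling_coeff i \<Gamma>\<^sub>0 \<Gamma>' \<noteq> 0"
  proof (rule doubling_coeff_nonzero[OF nv _ G(2,3) _ G'(2)])
    fix v b j assume "v < length \<Gamma>\<^sub>0" "target \<Gamma> (v, b) = Bdry j"
    then show "j < 3" using tree_graphsD(2)[OF G(1), of "(v, b)"] len lenG by (auto simp: set_vertices)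
  qed (simp add: len lenG)
  have cc: "composition_coeff \<Gamma>\<^sub>1 [] \<Gamma>' = (if i = 0 then 1 else -1) * doubling_coeff i \<Gamma>\<^sub>1 \<Gamma>'"
    if "\<Gamma>\<^sub>1 \<in> graph_reps n 2" for \<Gamma>\<^sub>1
    using zero[OF that] G(2) by (auto simp: composition_coeff_def doubling_coeff_def less_Suc_eq numeral_2_eq_2)
  have "0 = weight_coproduct W \<Gamma>' - weight_coproduct W' \<Gamma>'" using eq[OF G'(1)] by simp
  also have "\<dots> = (\<Sum>\<Gamma>\<^sub>1\<in>graph_reps n 2. of_int (composition_coeff \<Gamma>\<^sub>1 [] \<Gamma>') * (W \<Gamma>\<^sub>1 - W' \<Gamma>\<^sub>1))"
    unfolding weight_coproduct_diff[OF n W lenG'] using right by (intro sum.cong) auto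
  also have "\<dots> = (\<Sum>\<Gamma>\<^sub>1\<in>{\<Gamma>\<^sub>0}. of_int (composition_coeff \<Gamma>\<^sub>1 [] \<Gamma>') * (W \<Gamma>\<^sub>1 - W' \<Gamma>\<^sub>1))"
    by (rule sum.mono_neutral_right) (use g other in \<open>auto simp: cc\<close>)
  finally show ?thesis using main by (auto simp: cc[OF g] split: if_splits)
qed

section \<open>Operators of graphs\<close>

definition vertex_fun :: "'d::finite bivector \<Rightarrow> (nat \<Rightarrow> real^'d \<Rightarrow> real) \<Rightarrow> (edge \<Rightarrow> 'd) \<Rightarrow> vertex \<Rightarrow> real^'d \<Rightarrow> real" where
  "vertex_fun \<alpha> \<phi> I u = (case u of Inner v \<Rightarrow> \<alpha> (I (v, False)) (I (v, True)) | Bdry j \<Rightarrow> \<phi> j)"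

lemma vertex_fun_simps [simp]:
  "vertex_fun \<alpha> \<phi> I (Inner v) = \<alpha> (I (v, False)) (I (v, True))"
  "vertex_fun \<alpha> \<phi> I (Bdry j) = \<phi> j"
  by (simp_all add: vertex_fun_def)

text \<open>
  The operator of a graph with internal and boundary vertices on the same footing. The functions at
  the boundary are a family instead of a list, so that one of them can be exchanged by updating it.
\<close>

definition graph_operator :: "'d::finite bivector \<Rightarrow> graph \<Rightarrow> nat \<Rightarrow> (nat \<Rightarrow> real^'d \<Rightarrow> real) \<Rightarrow> real^'d \<Rightarrow> real" where
  "graph_operator \<alpha> \<Gamma> m \<phi> x = (\<Sum>I \<in> set (edges \<Gamma>) \<rightarrow>\<^sub>E UNIV.
     \<Prod>u\<in>set (vertices (length \<Gamma>) m). diff_along \<Gamma> I u (vertex_fun \<alpha> \<phi> I u) x)"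

lemma prod_vertices: "(\<Prod>u\<in>set (vertices n m). F u) = (\<Prod>v<n. F (Inner v)) * (\<Prod>j<m. F (Bdry j))"
proof -
  have "inj_on Inner A" "inj_on Bdry A" for A by (auto simp: inj_on_def)
  then show ?thesis unfolding set_vertices
    by (subst prod.union_disjoint) (auto simp: prod.reindex)
qed

lemma graph_op_operator: "graph_op \<alpha> \<Gamma> fs x = graph_operator \<alpha> \<Gamma> (length fs) (nth fs) x"
  by (simp add: graph_op_def graph_operator_def prod_vertices)

lemma diff_along_smooth [intro, simp]: "h \<in> smooth_functions \<Longrightarrow> diff_along \<Gamma> I u h \<in> smooth_functions"
  by (simp add: diff_along_def)

lemma diff_along_foldr: "diff_along \<Gamma> I u h = foldr pd (map I (incoming \<Gamma> u)) h"
  by (simp add: diff_along_def foldr_map o_def)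

lemma diff_along_cong:
  "(\<And>e. e \<in> set (edges \<Gamma>) \<Longrightarrow> I e = I' e) \<Longrightarrow> diff_along \<Gamma> I u h = diff_along \<Gamma> I' u h"
  unfolding diff_along_foldr by (auto simp: set_incoming intro!: arg_cong2[of _ _ _ _ "foldr pd"])

lemma diff_along_cmult: "h \<in> smooth_functions \<Longrightarrow> diff_along \<Gamma> I u (\<lambda>x. c * h x) = (\<lambda>x. c * diff_along \<Gamma> I u h x)"
  by (simp add: diff_along_foldr foldr_pd_cmult)

locale skew_bivector =
  fixes \<alpha> :: "'d::finite bivector"
  assumes smooth [simp]: "\<alpha> i j \<in> smooth_functions" and skew: "\<alpha> j i x = - \<alpha> i j x"
begin

lemma vertex_fun_smooth:
  assumes "\<And>j. j < m \<Longrightarrow> \<phi> j \<in> smooth_functions" "u \<in> set (vertices n m)"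
  shows "vertex_fun \<alpha> \<phi> I u \<in> smooth_functions"
  using assms by (auto simp: set_vertices)

lemma graph_operator_smooth:
  assumes "\<And>j. j < m \<Longrightarrow> \<phi> j \<in> smooth_functions"
  shows "graph_operator \<alpha> \<Gamma> m \<phi> \<in> smooth_functions"
  unfolding graph_operator_def[abs_def]
  by (intro smooth_sum smooth_prod diff_along_smooth vertex_fun_smooth[OF assms])

lemma graph_operator_cong:
  "(\<And>j. j < m \<Longrightarrow> \<phi> j = \<psi> j) \<Longrightarrow> graph_operator \<alpha> \<Gamma> m \<phi> x = graph_operator \<alpha> \<Gamma> m \<psi> x"
  by (simp add: graph_operator_def prod_vertices)

text \<open>
  Reindex the sum over the labellings of edges along the isomorphism. The derivatives at a vertex are
  permuted, and each exchange of the two edges at a vertex contributes the sign of \<open>\<alpha>\<^sup>j\<^sup>i = - \<alpha>\<^sup>i\<^sup>j\<close>.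
\<close>

lemma graph_operator_iso:
  assumes iso: "oriented_iso s \<Gamma> \<Gamma>'" and \<phi>: "\<And>j. j < m \<Longrightarrow> \<phi> j \<in> smooth_functions"
  shows "graph_operator \<alpha> \<Gamma>' m \<phi> x = of_int s * graph_operator \<alpha> \<Gamma> m \<phi> x"
proof -
  obtain \<sigma> S where via: "iso_via \<sigma> S \<Gamma> \<Gamma>'" and s: "s = flip_sign (length \<Gamma>) S"
    using iso by (auto simp: oriented_iso_iff)
  let ?n = "length \<Gamma>" and ?E = "set (edges \<Gamma>)" and ?E' = "set (edges \<Gamma>')" and ?\<tau> = "inv \<sigma>"
  let ?V = "set (vertices ?n m)"
  have len: "length \<Gamma>' = ?n" and \<sigma>: "\<sigma> permutes {..<?n}" using via by (auto simp: iso_via_def)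
  have \<tau>: "?\<tau> permutes {..<?n}" by (rule permutes_inv[OF \<sigma>])
  have inv: "\<sigma> (?\<tau> v) = v" "?\<tau> (\<sigma> v) = v" for v using permutes_inverses[OF \<sigma>] by auto
  have lt: "\<sigma> v < ?n \<longleftrightarrow> v < ?n" "?\<tau> v < ?n \<longleftrightarrow> v < ?n" for v
    using permutes_in_image[OF \<sigma>, of v] permutes_in_image[OF \<tau>, of v] by auto
  define f :: "edge \<Rightarrow> edge" where "f = (\<lambda>(v, b). (\<sigma> v, b \<noteq> (v \<in> S)))"
  define g :: "edge \<Rightarrow> edge" where "g = (\<lambda>(v, b). (?\<tau> v, b \<noteq> (?\<tau> v \<in> S)))"
  have fg: "f (g e) = e" "g (f e) = e" for e by (auto simp: f_def g_def inv split: prod.splits)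
  have fE: "f e \<in> ?E' \<longleftrightarrow> e \<in> ?E" and gE: "g e \<in> ?E \<longleftrightarrow> e \<in> ?E'" for e
    by (cases e; simp add: f_def g_def len lt)+
  have tf: "target \<Gamma>' (f e) = relabel \<sigma> (target \<Gamma> e)" if "e \<in> ?E" for e
    using that via by (cases e rule: prod.exhaust) (auto simp: f_def iso_via_def)
  have inj_rel: "relabel \<sigma> u = relabel \<sigma> w \<longleftrightarrow> u = w" for u w
    by (cases u; cases w) (auto dest: arg_cong[of _ _ ?\<tau>] simp: inv)
  have inc: "mset (incoming \<Gamma>' (relabel \<sigma> u)) = mset (map f (incoming \<Gamma> u))" for u
  proof -
    have injf: "inj f" by (metis fg(2) injI)
    have "set (incoming \<Gamma>' (relabel \<sigma> u)) = f ` set (incoming \<Gamma> u)"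
    proof (intro set_eqI iffI)
      fix e assume e: "e \<in> set (incoming \<Gamma>' (relabel \<sigma> u))"
      then have "g e \<in> ?E" "e = f (g e)" by (auto simp: set_incoming gE fg)
      with tf[of "g e"] e have "g e \<in> set (incoming \<Gamma> u)" by (auto simp: set_incoming fg inj_rel)
      then show "e \<in> f ` set (incoming \<Gamma> u)" using \<open>e = f (g e)\<close> by blast
    next
      fix e assume "e \<in> f ` set (incoming \<Gamma> u)"
      then show "e \<in> set (incoming \<Gamma>' (relabel \<sigma> u))" by (auto simp: set_incoming tf fE simp del: edge_in_edges)
    qed
    then show ?thesis
      by (intro iffD1[OF set_eq_iff_mset_eq_distinct]) (auto simp: distinct_map intro: inj_on_subset[OF injf])
  qed
  have diff: "diff_along \<Gamma>' I (relabel \<sigma> u) h = diff_along \<Gamma> (I \<circ> f) u h" if "h \<in> smooth_functions" for I u h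
    unfolding diff_along_foldr by (rule foldr_pd_mset[OF that]) (simp add: inc multiset.map_comp)
  let ?\<epsilon> = "\<lambda>u. case u of Inner v \<Rightarrow> (if v \<in> S then -1 else 1) | Bdry j \<Rightarrow> (1::real)"
  have vf: "vertex_fun \<alpha> \<phi> I (relabel \<sigma> u) = (\<lambda>x. ?\<epsilon> u * vertex_fun \<alpha> \<phi> (I \<circ> f) u x)" for I u
  proof (cases u)
    case (Inner v)
    then show ?thesis using skew[of "I (\<sigma> v, False)" "I (\<sigma> v, True)"] skew[of "I (\<sigma> v, True)" "I (\<sigma> v, False)"]
      by (auto simp: f_def)
  qed simp
  have eps: "(\<Prod>u\<in>?V. ?\<epsilon> u) = of_int s"
    by (auto simp: prod_vertices s flip_sign_def if_distrib[of real_of_int] intro!: prod.cong)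
  have bij: "bij_betw (relabel \<sigma>) ?V ?V"
  proof (rule bij_betwI')
    fix u assume "u \<in> ?V"
    then show "\<exists>w\<in>?V. u = relabel \<sigma> w"
      by (intro bexI[of _ "relabel ?\<tau> u"]) (auto simp: set_vertices lt inv image_iff)
  qed (auto simp: set_vertices lt inj_rel)
  have summand: "(\<Prod>u\<in>?V. diff_along \<Gamma>' I u (vertex_fun \<alpha> \<phi> I u) x)
      = of_int s * (\<Prod>u\<in>?V. diff_along \<Gamma> (I \<circ> f) u (vertex_fun \<alpha> \<phi> (I \<circ> f) u) x)" for I
  proof -
    have "(\<Prod>u\<in>?V. diff_along \<Gamma>' I u (vertex_fun \<alpha> \<phi> I u) x)
      = (\<Prod>u\<in>?V. diff_along \<Gamma>' I (relabel \<sigma> u) (vertex_fun \<alpha> \<phi> I (relabel \<sigma> u)) x)"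
      by (rule prod.reindex_bij_betw[OF bij, symmetric])
    also have "\<dots> = (\<Prod>u\<in>?V. ?\<epsilon> u * diff_along \<Gamma> (I \<circ> f) u (vertex_fun \<alpha> \<phi> (I \<circ> f) u) x)"
    proof (rule prod.cong[OF refl])
      fix u assume u: "u \<in> ?V"
      have sm: "vertex_fun \<alpha> \<phi> (I \<circ> f) u \<in> smooth_functions" by (rule vertex_fun_smooth[OF \<phi> u])
      show "diff_along \<Gamma>' I (relabel \<sigma> u) (vertex_fun \<alpha> \<phi> I (relabel \<sigma> u)) x
        = ?\<epsilon> u * diff_along \<Gamma> (I \<circ> f) u (vertex_fun \<alpha> \<phi> (I \<circ> f) u) x"
        unfolding vf by (subst diff[OF smooth_cmult[OF sm]]) (simp add: diff_along_cmult[OF sm])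
    qed
    finally show ?thesis by (simp add: prod.distrib eps)
  qed
  have "graph_operator \<alpha> \<Gamma>' m \<phi> x = (\<Sum>I \<in> ?E' \<rightarrow>\<^sub>E UNIV.
      of_int s * (\<Prod>u\<in>?V. diff_along \<Gamma> (I \<circ> f) u (vertex_fun \<alpha> \<phi> (I \<circ> f) u) x))"
    unfolding graph_operator_def len summand ..
  also have "\<dots> = (\<Sum>I \<in> ?E \<rightarrow>\<^sub>E UNIV. of_int s * (\<Prod>u\<in>?V. diff_along \<Gamma> I u (vertex_fun \<alpha> \<phi> I u) x))"
  proof (rule sum.reindex_bij_witness[of _ "\<lambda>I. restrict (I \<circ> g) ?E'" "\<lambda>I. restrict (I \<circ> f) ?E"])
    fix I assume I: "I \<in> ?E' \<rightarrow>\<^sub>E (UNIV :: 'd set)"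
    show "restrict (restrict (I \<circ> f) ?E \<circ> g) ?E' = I"
      using I by (auto simp: fun_eq_iff restrict_def gE fg PiE_def extensional_def simp del: edge_in_edges)
    have "diff_along \<Gamma> (restrict (I \<circ> f) ?E) u h = diff_along \<Gamma> (I \<circ> f) u h" for u h
      by (rule diff_along_cong) simp
    moreover have "vertex_fun \<alpha> \<phi> (restrict (I \<circ> f) ?E) u = vertex_fun \<alpha> \<phi> (I \<circ> f) u" if "u \<in> ?V" for u
      using that by (auto simp: set_vertices)
    ultimately show "of_int s * (\<Prod>u\<in>?V. diff_along \<Gamma> (restrict (I \<circ> f) ?E) u (vertex_fun \<alpha> \<phi> (restrict (I \<circ> f) ?E) u) x)
      = of_int s * (\<Prod>u\<in>?V. diff_along \<Gamma> (I \<circ> f) u (vertex_fun \<alpha> \<phi> (I \<circ> f) u) x)"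
      by simp
  next
    fix I assume I: "I \<in> ?E \<rightarrow>\<^sub>E (UNIV :: 'd set)"
    show "restrict (restrict (I \<circ> g) ?E' \<circ> f) ?E = I"
      using I by (auto simp: fun_eq_iff restrict_def fE fg PiE_def extensional_def simp del: edge_in_edges)
  qed auto
  finally show ?thesis by (simp add: graph_operator_def sum_distrib_left)
qed

lemma graph_operator_weights:
  assumes "\<And>j. j < m \<Longrightarrow> \<phi> j \<in> smooth_functions"
  shows "(\<lambda>\<Gamma>. graph_operator \<alpha> \<Gamma> m \<phi> x) \<in> weights"
  unfolding weights_def by (intro CollectI allI impI graph_operator_iso assms)

end

section \<open>Operators of inserted graphs\<close>

fun outer_vertex :: "nat \<Rightarrow> nat \<Rightarrow> vertex \<Rightarrow> vertex" where
  "outer_vertex i m (Inner v) = Inner v"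
| "outer_vertex i m (Bdry j) = (if j < i then Bdry j else Bdry (j + m - 1))"

lemma reattach_other: "u \<noteq> Bdry i \<Longrightarrow> reattach i m \<Gamma> n u = [outer_vertex i m u]"
  by (cases u) auto

lemma edges_append: "edges (\<Gamma> @ \<Delta>) = edges \<Gamma> @ map (\<lambda>(v, b). (length \<Gamma> + v, b)) (edges \<Delta>)"
proof -
  have "[0..<length \<Gamma> + length \<Delta>] = [0..<length \<Gamma>] @ map ((+) (length \<Gamma>)) [0..<length \<Delta>]"
    by (simp add: upt_add_eq_append[of 0]) (rule nth_equalityI, auto)
  then have "edges (\<Gamma> @ \<Delta>) = List.product [0..<length \<Gamma>] [False, True] @ List.product (map ((+) (length \<Gamma>)) [0..<length \<Delta>]) [False, True]"
    by (simp add: edges_def product_concat_map)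
  also have "List.product (map ((+) (length \<Gamma>)) [0..<length \<Delta>]) [False, True] = map (\<lambda>(v, b). (length \<Gamma> + v, b)) (edges \<Delta>)"
    by (simp add: edges_def product_concat_map map_concat o_def)
  finally show ?thesis by (simp add: edges_def)
qed

context skew_bivector
begin

text \<open>
  The Leibniz rule: the derivatives of the edges of \<open>\<Gamma>\<^sub>1\<close> ending at the boundary vertex \<open>i\<close> are distributed
  over the vertices of \<open>\<Gamma>\<^sub>2\<close> by a function \<open>g\<close>, and these functions are the reattachments of an insertion.
  The edges of \<open>\<Gamma>\<^sub>1\<close> precede those of \<open>\<Gamma>\<^sub>2\<close>, so even the order of the derivatives is the same on both
  sides.
\<close>

lemma graph_operator_insertion:
  assumes g1: "\<Gamma>\<^sub>1 \<in> tree_graphs n\<^sub>1 m\<^sub>1" and g2: "\<Gamma>\<^sub>2 \<in> tree_graphs n\<^sub>2 m\<^sub>2" and i: "i < m\<^sub>1"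
    and \<phi>: "\<And>j. j < m\<^sub>1 + m\<^sub>2 - 1 \<Longrightarrow> \<phi> j \<in> smooth_functions"
    and \<phi>\<^sub>1: "\<phi>\<^sub>1 = (\<lambda>j. if j < i then \<phi> j else if j = i then graph_operator \<alpha> \<Gamma>\<^sub>2 m\<^sub>2 (\<lambda>k. \<phi> (i + k)) else \<phi> (j + m\<^sub>2 - 1))"
  shows "graph_operator \<alpha> \<Gamma>\<^sub>1 m\<^sub>1 \<phi>\<^sub>1 x = (\<Sum>T\<leftarrow>insertion i m\<^sub>2 \<Gamma>\<^sub>1 \<Gamma>\<^sub>2. graph_operator \<alpha> T (m\<^sub>1 + m\<^sub>2 - 1) \<phi> x)"
proof -
  note len1 = tree_graphsD(1)[OF g1] and len2 = tree_graphsD(1)[OF g2]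
  let ?\<phi>\<^sub>2 = "\<lambda>k. \<phi> (i + k)" and ?M = "m\<^sub>1 + m\<^sub>2 - 1"
  let ?E1 = "set (edges \<Gamma>\<^sub>1)" and ?E2 = "set (edges \<Gamma>\<^sub>2)"
  let ?V1 = "set (vertices n\<^sub>1 m\<^sub>1) - {Bdry i}" and ?V2 = "set (vertices n\<^sub>2 m\<^sub>2)" and ?V = "set (vertices (n\<^sub>1 + n\<^sub>2) ?M)"
  let ?inc = "incoming \<Gamma>\<^sub>1 (Bdry i)"
  let ?out = "outer_vertex i m\<^sub>2" and ?emb = "embed n\<^sub>1 i"
  let ?R = "\<Pi>\<^sub>E e\<in>?E1. set (reattach i m\<^sub>2 \<Gamma>\<^sub>2 n\<^sub>1 (target \<Gamma>\<^sub>1 e))"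
  let ?P1 = "?E1 \<rightarrow>\<^sub>E (UNIV :: 'd set)" and ?P2 = "?E2 \<rightarrow>\<^sub>E (UNIV :: 'd set)" and ?G = "set ?inc \<rightarrow>\<^sub>E ?V2"
  define T where "T r = graft i \<Gamma>\<^sub>1 \<Gamma>\<^sub>2 r" for r
  define shift :: "edge \<Rightarrow> edge" where "shift = (\<lambda>(v, b). (n\<^sub>1 + v, b))"
  have edgesT: "edges (T r) = edges \<Gamma>\<^sub>1 @ map shift (edges \<Gamma>\<^sub>2)" for r
    unfolding T_def graft_def edges_append by (simp add: shift_def edges_def len1)
  have lenT: "length (T r) = n\<^sub>1 + n\<^sub>2" for r by (simp add: T_def len1 len2)
  have tT1: "target (T r) e = r e" if "e \<in> ?E1" for r e
    using that by (cases e rule: prod.exhaust) (simp add: T_def target_graft)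
  have tT2: "target (T r) (shift e) = ?emb (target \<Gamma>\<^sub>2 e)" if "e \<in> ?E2" for r e
    using that by (cases e rule: prod.exhaust) (simp add: T_def shift_def target_graft(2)[of _ \<Gamma>\<^sub>2 i \<Gamma>\<^sub>1, unfolded len1] len2)
  have \<phi>1s: "\<phi>\<^sub>1 j \<in> smooth_functions" if "j < m\<^sub>1" for j
    unfolding \<phi>\<^sub>1 using that i by (auto intro!: graph_operator_smooth \<phi>)
  \<comment> \<open>The factor \<open>A\<close> collects the vertices of \<open>\<Gamma>\<^sub>1\<close> that remain, and \<open>B\<close> those of \<open>\<Gamma>\<^sub>2\<close>.\<close>
  define A where "A I1 = (\<Prod>u\<in>?V1. diff_along \<Gamma>\<^sub>1 I1 u (vertex_fun \<alpha> \<phi>\<^sub>1 I1 u) x)" for I1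
  define B where "B I1 I2 g = (\<Prod>w\<in>?V2. foldr (\<lambda>e. pd (I1 e)) (filter (\<lambda>e. g e = w) ?inc)
      (diff_along \<Gamma>\<^sub>2 I2 w (vertex_fun \<alpha> ?\<phi>\<^sub>2 I2 w)) x)" for I1 :: "edge \<Rightarrow> 'd" and I2 and g :: "edge \<Rightarrow> vertex"
  have sm2: "diff_along \<Gamma>\<^sub>2 I2 w (vertex_fun \<alpha> ?\<phi>\<^sub>2 I2 w) \<in> smooth_functions" if "w \<in> ?V2" for I2 w
    using that i by (intro diff_along_smooth vertex_fun_smooth[of m\<^sub>2]) (auto intro!: \<phi>)
  have inner: "diff_along \<Gamma>\<^sub>1 I1 (Bdry i) (graph_operator \<alpha> \<Gamma>\<^sub>2 m\<^sub>2 ?\<phi>\<^sub>2) x = (\<Sum>I2\<in>?P2. \<Sum>g\<in>?G. B I1 I2 g)" for I1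
  proof -
    have "diff_along \<Gamma>\<^sub>1 I1 (Bdry i) (graph_operator \<alpha> \<Gamma>\<^sub>2 m\<^sub>2 ?\<phi>\<^sub>2) x =
       foldr pd (map I1 ?inc) (\<lambda>y. \<Sum>I2\<in>?P2. \<Prod>w\<in>?V2. diff_along \<Gamma>\<^sub>2 I2 w (vertex_fun \<alpha> ?\<phi>\<^sub>2 I2 w) y) x"
      unfolding diff_along_foldr[of \<Gamma>\<^sub>1] graph_operator_def[abs_def] len2 ..
    also have "\<dots> = (\<Sum>I2\<in>?P2. foldr (\<lambda>e. pd (I1 e)) ?inc (\<lambda>y. \<Prod>w\<in>?V2. diff_along \<Gamma>\<^sub>2 I2 w (vertex_fun \<alpha> ?\<phi>\<^sub>2 I2 w) y) x)"
      by (subst foldr_pd_sum) (auto intro!: smooth_prod sm2 simp: foldr_map o_def)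
    also have "\<dots> = (\<Sum>I2\<in>?P2. \<Sum>g\<in>?G. B I1 I2 g)"
      unfolding B_def by (subst leibniz_foldr[OF _ sm2]) auto
    finally show ?thesis .
  qed
  have "Bdry i \<in> set (vertices n\<^sub>1 m\<^sub>1)" using i by (auto simp: set_vertices)
  note split = prod.remove[OF List.finite_set this]
  have "graph_operator \<alpha> \<Gamma>\<^sub>1 m\<^sub>1 \<phi>\<^sub>1 x = (\<Sum>I1\<in>?P1. diff_along \<Gamma>\<^sub>1 I1 (Bdry i) (\<phi>\<^sub>1 i) x * A I1)"
    unfolding graph_operator_def len1 A_def by (intro sum.cong refl, subst split) simp
  also have "\<dots> = (\<Sum>I1\<in>?P1. \<Sum>I2\<in>?P2. \<Sum>g\<in>?G. A I1 * B I1 I2 g)"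
    unfolding \<phi>\<^sub>1 by (simp add: inner sum_distrib_left mult.commute)
  finally have lhs: "graph_operator \<alpha> \<Gamma>\<^sub>1 m\<^sub>1 \<phi>\<^sub>1 x = (\<Sum>I1\<in>?P1. \<Sum>I2\<in>?P2. \<Sum>g\<in>?G. A I1 * B I1 I2 g)" .
  \<comment> \<open>\<open>mk\<close> turns a distribution of derivatives into a reattachment, \<open>cb\<close> combines labellings of the two graphs.\<close>
  define mk where "mk g = restrict (\<lambda>e. if target \<Gamma>\<^sub>1 e = Bdry i then ?emb (g e) else ?out (target \<Gamma>\<^sub>1 e)) ?E1"
    for g :: "edge \<Rightarrow> vertex"
  define cb where "cb I1 I2 = restrict (\<lambda>(v, b). if v < n\<^sub>1 then I1 (v, b) else I2 (v - n\<^sub>1, b)) (set (edges (\<Gamma>\<^sub>1 @ \<Gamma>\<^sub>2)))"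
    for I1 I2 :: "edge \<Rightarrow> 'd"
  let ?PT = "set (edges (\<Gamma>\<^sub>1 @ \<Gamma>\<^sub>2)) \<rightarrow>\<^sub>E (UNIV :: 'd set)"
  have edgesT': "set (edges (T r)) = set (edges (\<Gamma>\<^sub>1 @ \<Gamma>\<^sub>2))" for r by (simp add: set_edges lenT len1 len2)
  have inj_out: "?out u = ?out u' \<longleftrightarrow> u = u'" if "u \<noteq> Bdry i" "u' \<noteq> Bdry i" for u u'
    using that by (cases u; cases u') auto
  have out_emb: "?out u \<noteq> ?emb w" if "u \<in> ?V1" "w \<in> ?V2" for u w
    using that by (cases u; cases w) (auto simp: set_vertices)
  have inj_emb: "?emb w = ?emb w' \<longleftrightarrow> w = w'" for w w' using inj_embed[of n\<^sub>1 i] by (auto dest: injD)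
  have tg1: "target \<Gamma>\<^sub>1 e \<in> ?V1" if "e \<in> ?E1" "target \<Gamma>\<^sub>1 e \<noteq> Bdry i" for e
    using tree_graphsD(2)[OF g1 that(1)] that(2) by simp
  have tg2: "target \<Gamma>\<^sub>2 e \<in> ?V2" if "e \<in> ?E2" for e using tree_graphsD(2)[OF g2 that] .
  have inc_out: "incoming (T (mk g)) (?out u) = incoming \<Gamma>\<^sub>1 u" if u: "u \<in> ?V1" and g: "g \<in> ?G" for u g
  proof -
    have "filter (\<lambda>e. target (T (mk g)) e = ?out u) (edges \<Gamma>\<^sub>1) = filter (\<lambda>e. target \<Gamma>\<^sub>1 e = u) (edges \<Gamma>\<^sub>1)"
    proof (rule filter_cong[OF refl])
      fix e assume e: "e \<in> ?E1"
      show "(target (T (mk g)) e = ?out u) = (target \<Gamma>\<^sub>1 e = u)"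
      proof (cases "target \<Gamma>\<^sub>1 e = Bdry i")
        case True
        with e have "g e \<in> ?V2" by (intro PiE_mem[OF g]) (simp add: set_incoming)
        from out_emb[OF u this] show ?thesis using True e u by (auto simp: tT1 mk_def)
      next
        case False
        then show ?thesis using e u by (simp add: tT1 mk_def inj_out)
      qed
    qed
    moreover have "filter (\<lambda>e. target (T (mk g)) e = ?out u) (map shift (edges \<Gamma>\<^sub>2)) = []"
      using out_emb[OF u tg2] by (auto simp: filter_empty_conv tT2 dest: sym simp del: edge_in_edges)
    ultimately show ?thesis unfolding incoming_def edgesT by simp
  qed
  have inc_emb: "incoming (T (mk g)) (?emb w) = filter (\<lambda>e. g e = w) ?inc @ map shift (incoming \<Gamma>\<^sub>2 w)"
    if w: "w \<in> ?V2" for w g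
  proof -
    have "filter (\<lambda>e. target (T (mk g)) e = ?emb w) (edges \<Gamma>\<^sub>1) = filter (\<lambda>e. g e = w) ?inc"
      unfolding incoming_def filter_filter
    proof (rule filter_cong[OF refl])
      fix e assume e: "e \<in> ?E1"
      show "(target (T (mk g)) e = ?emb w) = (target \<Gamma>\<^sub>1 e = Bdry i \<and> g e = w)"
        using e out_emb[OF tg1[OF e] w] by (auto simp: tT1 mk_def inj_emb)
    qed
    moreover have "filter (\<lambda>e. target (T (mk g)) e = ?emb w) (map shift (edges \<Gamma>\<^sub>2)) = map shift (incoming \<Gamma>\<^sub>2 w)"
      unfolding incoming_def filter_map o_def
      by (intro arg_cong[of _ _ "map shift"] filter_cong) (simp_all add: tT2 inj_emb)
    ultimately show ?thesis unfolding incoming_def edgesT by simp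
  qed
  have V: "?V = ?out ` ?V1 \<union> ?emb ` ?V2"
  proof (intro set_eqI iffI)
    fix u assume u: "u \<in> ?V"
    show "u \<in> ?out ` ?V1 \<union> ?emb ` ?V2"
    proof (cases u)
      case (Inner v)
      show ?thesis
      proof (cases "v < n\<^sub>1")
        case True then show ?thesis using Inner by (auto simp: set_vertices image_iff intro!: bexI[of _ "Inner v"])
      next
        case False then have "Inner v = ?emb (Inner (v - n\<^sub>1))" "Inner (v - n\<^sub>1) \<in> ?V2"
          using u Inner by (auto simp: set_vertices)
        then show ?thesis using Inner by blast
      qed
    next
      case (Bdry j)
      then have j: "j < ?M" using u by (auto simp: set_vertices)
      consider "j < i" | "i \<le> j" "j < i + m\<^sub>2" | "i + m\<^sub>2 \<le> j" by linarith
      then show ?thesis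
      proof cases
        case 1 then have "Bdry j = ?out (Bdry j)" "Bdry j \<in> ?V1" using i by (auto simp: set_vertices)
        then show ?thesis using Bdry by blast
      next
        case 2 then have "Bdry j = ?emb (Bdry (j - i))" "Bdry (j - i) \<in> ?V2" by (auto simp: set_vertices)
        then show ?thesis using Bdry by blast
      next
        case 3 then have "Bdry j = ?out (Bdry (j + 1 - m\<^sub>2))" "Bdry (j + 1 - m\<^sub>2) \<in> ?V1" using j i by (auto simp: set_vertices)
        then show ?thesis using Bdry by blast
      qed
    qed
  next
    fix u assume "u \<in> ?out ` ?V1 \<union> ?emb ` ?V2"
    then show "u \<in> ?V" using i by (auto simp: set_vertices split: if_splits)
  qed
  have summand: "(\<Prod>u\<in>?V. diff_along (T (mk g)) (cb I1 I2) u (vertex_fun \<alpha> \<phi> (cb I1 I2) u) x) = A I1 * B I1 I2 g"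
    if g: "g \<in> ?G" for I1 I2 g
  proof -
    let ?I = "cb I1 I2"
    have I1: "?I e = I1 e" if "e \<in> ?E1" for e using that by (cases e rule: prod.exhaust) (auto simp: cb_def len1 simp: set_edges)
    have I2: "?I (shift e) = I2 e" if "e \<in> ?E2" for e using that by (cases e rule: prod.exhaust) (auto simp: cb_def shift_def len1 set_edges)
    have "(\<Prod>u\<in>?V. diff_along (T (mk g)) ?I u (vertex_fun \<alpha> \<phi> ?I u) x) =
       (\<Prod>u\<in>?V1. diff_along (T (mk g)) ?I (?out u) (vertex_fun \<alpha> \<phi> ?I (?out u)) x) *
       (\<Prod>w\<in>?V2. diff_along (T (mk g)) ?I (?emb w) (vertex_fun \<alpha> \<phi> ?I (?emb w)) x)"
      unfolding V using out_emb
      by (subst prod.union_disjoint) (auto simp: prod.reindex inj_on_def inj_out inj_emb)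
    moreover have "(\<Prod>u\<in>?V1. diff_along (T (mk g)) ?I (?out u) (vertex_fun \<alpha> \<phi> ?I (?out u)) x) = A I1"
      unfolding A_def
    proof (rule prod.cong[OF refl])
      fix u assume u: "u \<in> ?V1"
      have "vertex_fun \<alpha> \<phi> ?I (?out u) = vertex_fun \<alpha> \<phi>\<^sub>1 I1 u"
        using u by (cases u) (auto simp: \<phi>\<^sub>1 set_vertices I1 len1)
      moreover have "map ?I (incoming \<Gamma>\<^sub>1 u) = map I1 (incoming \<Gamma>\<^sub>1 u)"
        by (auto simp: set_incoming I1 simp del: edge_in_edges)
      ultimately show "diff_along (T (mk g)) ?I (?out u) (vertex_fun \<alpha> \<phi> ?I (?out u)) x = diff_along \<Gamma>\<^sub>1 I1 u (vertex_fun \<alpha> \<phi>\<^sub>1 I1 u) x"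
        unfolding diff_along_foldr inc_out[OF u g] by (simp only:)
    qed
    moreover have "(\<Prod>w\<in>?V2. diff_along (T (mk g)) ?I (?emb w) (vertex_fun \<alpha> \<phi> ?I (?emb w)) x) = B I1 I2 g"
      unfolding B_def
    proof (rule prod.cong[OF refl])
      fix w assume w: "w \<in> ?V2"
      have "vertex_fun \<alpha> \<phi> ?I (?emb w) = vertex_fun \<alpha> ?\<phi>\<^sub>2 I2 w"
        using w I2[of "(_, _)"] by (cases w rule: vertex.exhaust) (auto simp: set_vertices shift_def len2)
      moreover have "map ?I (filter (\<lambda>e. g e = w) ?inc) = map I1 (filter (\<lambda>e. g e = w) ?inc)"
        by (auto simp: set_incoming I1 simp del: edge_in_edges)
      moreover have "map ?I (map shift (incoming \<Gamma>\<^sub>2 w)) = map I2 (incoming \<Gamma>\<^sub>2 w)"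
        by (auto simp: set_incoming I2 simp del: edge_in_edges)
      ultimately show "diff_along (T (mk g)) ?I (?emb w) (vertex_fun \<alpha> \<phi> ?I (?emb w)) x =
         foldr (\<lambda>e. pd (I1 e)) (filter (\<lambda>e. g e = w) ?inc) (diff_along \<Gamma>\<^sub>2 I2 w (vertex_fun \<alpha> ?\<phi>\<^sub>2 I2 w)) x"
        unfolding diff_along_foldr inc_emb[OF w] map_append foldr_append comp_apply
        by (simp only: foldr_map o_def)
    qed
    ultimately show ?thesis by simp
  qed
  have "(\<Sum>T\<leftarrow>insertion i m\<^sub>2 \<Gamma>\<^sub>1 \<Gamma>\<^sub>2. graph_operator \<alpha> T ?M \<phi> x) = (\<Sum>r\<in>?R. graph_operator \<alpha> (T r) ?M \<phi> x)"
    unfolding sum_insertion T_def by (simp add: len1)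
  also have "\<dots> = (\<Sum>g\<in>?G. graph_operator \<alpha> (T (mk g)) ?M \<phi> x)"
  proof (rule sum.reindex_bij_witness[of _ mk "\<lambda>r. restrict (inv ?emb \<circ> r) (set ?inc)"])
    fix r assume r: "r \<in> ?R"
    have rB: "r e \<in> ?emb ` ?V2" if "e \<in> set ?inc" for e
      using PiE_mem[OF r, of e] that by (simp add: set_incoming len2)
    have rO: "r e = ?out (target \<Gamma>\<^sub>1 e)" if "e \<in> ?E1" "target \<Gamma>\<^sub>1 e \<noteq> Bdry i" for e
      using PiE_mem[OF r that(1)] reattach_other[OF that(2), of m\<^sub>2 \<Gamma>\<^sub>2 n\<^sub>1] by simp
    have invr: "?emb (inv ?emb (r e)) = r e" if "e \<in> set ?inc" for e
      using rB[OF that] by (auto simp: f_inv_into_f)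
    show mkr: "mk (restrict (inv ?emb \<circ> r) (set ?inc)) = r"
    proof
      fix e show "mk (restrict (inv ?emb \<circ> r) (set ?inc)) e = r e"
        using PiE_arb[OF r, of e] invr[of e] rO[of e] by (auto simp: mk_def set_incoming simp del: edge_in_edges)
    qed
    show "restrict (inv ?emb \<circ> r) (set ?inc) \<in> ?G"
      using rB by (auto simp: inv_f_f[OF inj_embed] dest!: rB)
    show "graph_operator \<alpha> (T (mk (restrict (inv ?emb \<circ> r) (set ?inc)))) ?M \<phi> x = graph_operator \<alpha> (T r) ?M \<phi> x"
      unfolding mkr ..
  next
    fix g assume g: "g \<in> ?G"
    show "restrict (inv ?emb \<circ> mk g) (set ?inc) = g"
      using g by (auto simp: fun_eq_iff restrict_def mk_def set_incoming inv_f_f[OF inj_embed] PiE_def extensional_def simp del: edge_in_edges)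
    show "mk g \<in> ?R"
    proof (rule PiE_I)
      fix e assume e: "e \<in> ?E1"
      show "mk g e \<in> set (reattach i m\<^sub>2 \<Gamma>\<^sub>2 n\<^sub>1 (target \<Gamma>\<^sub>1 e))"
      proof (cases "target \<Gamma>\<^sub>1 e = Bdry i")
        case True
        with e have "g e \<in> ?V2" by (intro PiE_mem[OF g]) (simp add: set_incoming)
        then show ?thesis using True e by (simp add: mk_def len2)
      next
        case False then show ?thesis using e by (simp add: mk_def reattach_other[OF False])
      qed
    qed (simp add: mk_def)
  qed
  also have "\<dots> = (\<Sum>g\<in>?G. \<Sum>(I1, I2)\<in>?P1 \<times> ?P2. A I1 * B I1 I2 g)"
  proof (rule sum.cong[OF refl])
    fix g assume g: "g \<in> ?G"
    have "graph_operator \<alpha> (T (mk g)) ?M \<phi> x =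
      (\<Sum>I\<in>?PT. \<Prod>u\<in>?V. diff_along (T (mk g)) I u (vertex_fun \<alpha> \<phi> I u) x)"
      unfolding graph_operator_def lenT edgesT' ..
    also have "\<dots> = (\<Sum>(I1, I2)\<in>?P1 \<times> ?P2. \<Prod>u\<in>?V. diff_along (T (mk g)) (cb I1 I2) u (vertex_fun \<alpha> \<phi> (cb I1 I2) u) x)"
    proof (rule sum.reindex_bij_witness[of _ "\<lambda>(I1, I2). cb I1 I2" "\<lambda>I. (restrict I ?E1, restrict (I \<circ> shift) ?E2)"])
      fix I assume I: "I \<in> ?PT"
      show cI: "(case (restrict I ?E1, restrict (I \<circ> shift) ?E2) of (I1, I2) \<Rightarrow> cb I1 I2) = I"
        using I by (auto simp: fun_eq_iff cb_def restrict_def shift_def PiE_def extensional_def len1 len2 set_edges)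
      then show "(case (restrict I ?E1, restrict (I \<circ> shift) ?E2) of
          (I1, I2) \<Rightarrow> \<Prod>u\<in>?V. diff_along (T (mk g)) (cb I1 I2) u (vertex_fun \<alpha> \<phi> (cb I1 I2) u) x) =
        (\<Prod>u\<in>?V. diff_along (T (mk g)) I u (vertex_fun \<alpha> \<phi> I u) x)" by simp
    next
      fix p assume "p \<in> ?P1 \<times> ?P2"
      then obtain I1 I2 where p: "p = (I1, I2)" "I1 \<in> ?P1" "I2 \<in> ?P2" by auto
      have "restrict (cb I1 I2) ?E1 = I1" "restrict (cb I1 I2 \<circ> shift) ?E2 = I2"
        using p by (auto simp: fun_eq_iff cb_def restrict_def shift_def PiE_def extensional_def len1 len2 set_edges)
      then show "(restrict (case p of (I1, I2) \<Rightarrow> cb I1 I2) ?E1, restrict ((case p of (I1, I2) \<Rightarrow> cb I1 I2) \<circ> shift) ?E2) = p"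
        using p by simp
    qed (auto simp: cb_def)
    finally show "graph_operator \<alpha> (T (mk g)) ?M \<phi> x = (\<Sum>(I1, I2)\<in>?P1 \<times> ?P2. A I1 * B I1 I2 g)"
      by (simp only: summand[OF g])
  qed
  also have "\<dots> = (\<Sum>I1\<in>?P1. \<Sum>I2\<in>?P2. \<Sum>g\<in>?G. A I1 * B I1 I2 g)"
  proof -
    have "(\<Sum>g\<in>?G. \<Sum>(I1, I2)\<in>?P1 \<times> ?P2. A I1 * B I1 I2 g) = (\<Sum>g\<in>?G. \<Sum>I1\<in>?P1. \<Sum>I2\<in>?P2. A I1 * B I1 I2 g)"
      by (simp only: sum.cartesian_product)
    also have "\<dots> = (\<Sum>I1\<in>?P1. \<Sum>g\<in>?G. \<Sum>I2\<in>?P2. A I1 * B I1 I2 g)" by (rule sum.swap)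
    also have "\<dots> = (\<Sum>I1\<in>?P1. \<Sum>I2\<in>?P2. \<Sum>g\<in>?G. A I1 * B I1 I2 g)"
      by (intro sum.cong refl sum.swap)
    finally show ?thesis .
  qed
  finally show ?thesis unfolding lhs by (rule sym)
qed

end

section \<open>Symbols\<close>

definition leaf_label :: "graph \<Rightarrow> edge \<Rightarrow> nat" where
  "leaf_label \<Gamma> e = (case target \<Gamma> e of Inner v \<Rightarrow> 0 | Bdry j \<Rightarrow> j)"

text \<open>
  The polynomial by which the operator acts on exponentials with the covectors \<open>P\<close>.
\<close>

definition symbol :: "'d::finite bivector \<Rightarrow> graph \<Rightarrow> (nat \<Rightarrow> 'd \<Rightarrow> real) \<Rightarrow> real^'d \<Rightarrow> real" where
  "symbol \<alpha> \<Gamma> P x = (\<Sum>I \<in> set (edges \<Gamma>) \<rightarrow>\<^sub>E UNIV.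
     (\<Prod>v<length \<Gamma>. diff_along \<Gamma> I (Inner v) (\<alpha> (I (v, False)) (I (v, True))) x) *
     (\<Prod>e\<in>leaf_edges \<Gamma>. P (leaf_label \<Gamma> e) (I e)))"

lemma prod_leaf_edges:
  assumes "\<Gamma> \<in> tree_graphs n m"
  shows "(\<Prod>j<m. \<Prod>e\<leftarrow>incoming \<Gamma> (Bdry j). F j e) = (\<Prod>e\<in>leaf_edges \<Gamma>. F (leaf_label \<Gamma> e) e)"
proof -
  have inc: "set (incoming \<Gamma> (Bdry j)) = {e \<in> leaf_edges \<Gamma>. leaf_label \<Gamma> e = j}" for j
    by (auto simp: set_incoming leaf_edges_def leaf_label_def)
  have lab: "leaf_label \<Gamma> ` leaf_edges \<Gamma> \<subseteq> {..<m}"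
  proof
    fix j assume "j \<in> leaf_label \<Gamma> ` leaf_edges \<Gamma>"
    then obtain e where e: "e \<in> set (edges \<Gamma>)" "target \<Gamma> e = Bdry j"
      by (auto simp: leaf_edges_def leaf_label_def)
    from tree_graphsD(2)[OF assms e(1)] show "j \<in> {..<m}" unfolding e(2) by (auto simp: set_vertices)
  qed
  have "(\<Prod>j<m. \<Prod>e\<leftarrow>incoming \<Gamma> (Bdry j). F j e) = (\<Prod>j<m. \<Prod>e\<in>{e \<in> leaf_edges \<Gamma>. leaf_label \<Gamma> e = j}. F (leaf_label \<Gamma> e) e)"
    by (intro prod.cong refl) (simp add: prod.distinct_set_conv_list[symmetric] inc)
  also have "\<dots> = (\<Prod>e\<in>leaf_edges \<Gamma>. F (leaf_label \<Gamma> e) e)"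
    by (rule prod.group[OF _ _ lab]) auto
  finally show ?thesis .
qed

lemma length_incoming_le: "length (incoming \<Gamma> u) \<le> 2 * length \<Gamma>"
proof -
  have "length (incoming \<Gamma> u) \<le> length (edges \<Gamma>)" by (simp add: incoming_def)
  also have "\<dots> = 2 * length \<Gamma>" by (simp add: edges_def)
  finally show ?thesis .
qed

lemma graph_operator_expo:
  assumes "\<Gamma> \<in> tree_graphs n m"
  shows "graph_operator \<alpha> \<Gamma> m (\<lambda>j. expo (P j)) x = symbol \<alpha> \<Gamma> P x * (\<Prod>j<m. expo (P j) x)"
proof -
  have "(\<Prod>j<m. diff_along \<Gamma> I (Bdry j) (expo (P j)) x) =
    (\<Prod>e\<in>leaf_edges \<Gamma>. P (leaf_label \<Gamma> e) (I e)) * (\<Prod>j<m. expo (P j) x)" for I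
    using prod_leaf_edges[OF assms, of "\<lambda>j e. P j (I e)"]
    by (simp add: diff_along_foldr foldr_pd_expo prod.distrib o_def)
  then show ?thesis
    by (simp add: graph_operator_def symbol_def prod_vertices sum_distrib_right mult.assoc)
qed

text \<open>
  At a fixed point, every operator with \<open>n\<close> internal vertices sees the functions \<open>\<phi>\<close> only through their
  derivatives of order at most \<open>2 n\<close>; these may be replaced by those of combinations of exponentials,
  with coefficients that do not depend on the graph.
\<close>

lemma graph_operator_from_symbols:
  assumes \<phi>: "\<And>j. j < m \<Longrightarrow> \<phi> j \<in> smooth_functions"
  obtains K :: "(nat \<Rightarrow> 'd::finite \<Rightarrow> nat) set" and b where "finite K"
    "\<And>\<Gamma>. \<Gamma> \<in> tree_graphs n m \<Longrightarrow>
      graph_operator \<alpha> \<Gamma> m \<phi> x = (\<Sum>k\<in>K. b k * symbol \<alpha> \<Gamma> (\<lambda>j i. real (k j i)) x)"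
proof -
  let ?Q = "(UNIV :: 'd set) \<rightarrow>\<^sub>E {..2 * n}"
  have finQ: "finite ?Q" by (simp add: finite_PiE)
  let ?jet = "\<lambda>j a. \<forall>is. length is \<le> 2 * n \<longrightarrow>
      foldr pd is (\<phi> j) x = (\<Sum>\<kappa>\<in>?Q. a \<kappa> * (\<Prod>i\<leftarrow>is. real (\<kappa> i)))"
  define a where "a j = (SOME a. ?jet j a)" for j
  have a: "foldr pd is (\<phi> j) x = (\<Sum>\<kappa>\<in>?Q. a j \<kappa> * (\<Prod>i\<leftarrow>is. real (\<kappa> i)))"
    if "j < m" "length is \<le> 2 * n" for j "is"
    using someI_ex[OF jet_interpolation[OF \<phi>[OF that(1)]], of "2 * n" x] that(2) unfolding a_def by simp
  let ?K = "{..<m} \<rightarrow>\<^sub>E ?Q"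
  have "graph_operator \<alpha> \<Gamma> m \<phi> x = (\<Sum>k\<in>?K. (\<Prod>j<m. a j (k j)) * symbol \<alpha> \<Gamma> (\<lambda>j i. real (k j i)) x)"
    if g: "\<Gamma> \<in> tree_graphs n m" for \<Gamma>
  proof -
    note len = tree_graphsD(1)[OF g]
    let ?A = "\<lambda>I. \<Prod>v<n. diff_along \<Gamma> I (Inner v) (\<alpha> (I (v, False)) (I (v, True))) x"
    have bd: "(\<Prod>j<m. diff_along \<Gamma> I (Bdry j) (\<phi> j) x) =
      (\<Sum>k\<in>?K. (\<Prod>j<m. a j (k j)) * (\<Prod>e\<in>leaf_edges \<Gamma>. real (k (leaf_label \<Gamma> e) (I e))))" for I
    proof -
      have "(\<Prod>j<m. diff_along \<Gamma> I (Bdry j) (\<phi> j) x) =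
        (\<Prod>j<m. \<Sum>\<kappa>\<in>?Q. a j \<kappa> * (\<Prod>e\<leftarrow>incoming \<Gamma> (Bdry j). real (\<kappa> (I e))))"
        using length_incoming_le[of \<Gamma>] by (intro prod.cong refl) (simp add: diff_along_foldr a len o_def)
      also have "\<dots> = (\<Sum>k\<in>?K. \<Prod>j<m. a j (k j) * (\<Prod>e\<leftarrow>incoming \<Gamma> (Bdry j). real (k j (I e))))"
        by (rule prod_sum_PiE) (auto simp: finQ)
      also have "\<dots> = (\<Sum>k\<in>?K. (\<Prod>j<m. a j (k j)) * (\<Prod>e\<in>leaf_edges \<Gamma>. real (k (leaf_label \<Gamma> e) (I e))))"
        using prod_leaf_edges[OF g, of "\<lambda>j e. real (_ j (I e))"] by (simp add: prod.distrib)
      finally show ?thesis .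
    qed
    have "graph_operator \<alpha> \<Gamma> m \<phi> x = (\<Sum>I\<in>set (edges \<Gamma>) \<rightarrow>\<^sub>E UNIV. \<Sum>k\<in>?K.
        (\<Prod>j<m. a j (k j)) * (?A I * (\<Prod>e\<in>leaf_edges \<Gamma>. real (k (leaf_label \<Gamma> e) (I e)))))"
      by (simp add: graph_operator_def prod_vertices len bd sum_distrib_left mult.left_commute)
    also have "\<dots> = (\<Sum>k\<in>?K. (\<Prod>j<m. a j (k j)) * symbol \<alpha> \<Gamma> (\<lambda>j i. real (k j i)) x)"
      by (subst sum.swap) (simp add: symbol_def len sum_distrib_left)
    finally show ?thesis .
  qed
  then show ?thesis using that[of ?K] finQ by (simp add: finite_PiE)
qed

lemma operators_from_symbols:
  assumes S: "S \<subseteq> tree_graphs n m"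
    and zero: "\<And>P. (\<Sum>\<Gamma>\<in>S. w \<Gamma> * symbol \<alpha> \<Gamma> P x) = 0"
    and \<phi>: "\<And>j. j < m \<Longrightarrow> \<phi> j \<in> smooth_functions"
  shows "(\<Sum>\<Gamma>\<in>S. w \<Gamma> * graph_operator \<alpha> \<Gamma> m \<phi> x) = 0"
proof -
  obtain K b where K: "finite K" "\<And>\<Gamma>. \<Gamma> \<in> tree_graphs n m \<Longrightarrow>
      graph_operator \<alpha> \<Gamma> m \<phi> x = (\<Sum>k\<in>K. b k * symbol \<alpha> \<Gamma> (\<lambda>j i. real (k j i)) x)"
    using \<phi> by (rule graph_operator_from_symbols[where m = m and \<phi> = \<phi> and n = n and \<alpha> = \<alpha> and x = x])
       (assumption, rule that)
  have "(\<Sum>\<Gamma>\<in>S. w \<Gamma> * graph_operator \<alpha> \<Gamma> m \<phi> x) =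
    (\<Sum>\<Gamma>\<in>S. \<Sum>k\<in>K. b k * (w \<Gamma> * symbol \<alpha> \<Gamma> (\<lambda>j i. real (k j i)) x))"
    using S by (intro sum.cong refl) (auto simp: K(2) sum_distrib_left mult.left_commute)
  also have "\<dots> = (\<Sum>k\<in>K. b k * (\<Sum>\<Gamma>\<in>S. w \<Gamma> * symbol \<alpha> \<Gamma> (\<lambda>j i. real (k j i)) x))"
    by (subst sum.swap) (simp add: sum_distrib_left)
  finally show ?thesis by (simp add: zero)
qed

lemma symbol_scale: "symbol \<alpha> \<Gamma> (\<lambda>j i. t * P j i) x = t ^ card (leaf_edges \<Gamma>) * symbol \<alpha> \<Gamma> P x"
  by (simp add: symbol_def prod.distrib sum_distrib_left mult.left_commute)

lemma leaf_edges_rebind [simp]: "leaf_edges (rebind \<Gamma> l) = leaf_edges \<Gamma>"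
  unfolding leaf_edges_def edges_rebind by (auto simp: target_rebind simp del: edge_in_edges split: vertex.splits)

lemma leaf_label_rebind: "e \<in> leaf_edges \<Gamma> \<Longrightarrow> leaf_label (rebind \<Gamma> l) e = l e"
  by (auto simp: leaf_edges_def leaf_label_def target_rebind)

lemma incoming_inner_rebind: "incoming (rebind \<Gamma> l) (Inner v) = incoming \<Gamma> (Inner v)"
  unfolding incoming_def edges_rebind
  by (rule filter_cong) (auto simp: target_rebind split: vertex.splits)

lemma symbol_rebind:
  "symbol \<alpha> (rebind \<Gamma> l) P x = (\<Sum>I \<in> set (edges \<Gamma>) \<rightarrow>\<^sub>E UNIV.
     (\<Prod>v<length \<Gamma>. diff_along \<Gamma> I (Inner v) (\<alpha> (I (v, False)) (I (v, True))) x) *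
     (\<Prod>e\<in>leaf_edges \<Gamma>. P (l e) (I e)))"
  by (simp add: symbol_def leaf_label_rebind diff_along_foldr incoming_inner_rebind)

text \<open>
  Linear substitutions of covectors stay within the span of graphs: expand the product over the
  edges at the boundary.
\<close>

lemma symbol_substitution:
  "symbol \<alpha> \<Gamma> (\<lambda>j i. \<Sum>k<m'. a j k * P k i) x =
    (\<Sum>l \<in> leaf_edges \<Gamma> \<rightarrow>\<^sub>E {..<m'}. (\<Prod>e\<in>leaf_edges \<Gamma>. a (leaf_label \<Gamma> e) (l e)) * symbol \<alpha> (rebind \<Gamma> l) P x)"
proof -
  let ?A = "\<lambda>I. \<Prod>v<length \<Gamma>. diff_along \<Gamma> I (Inner v) (\<alpha> (I (v, False)) (I (v, True))) x"
  have "(\<Prod>e\<in>leaf_edges \<Gamma>. \<Sum>k<m'. a (leaf_label \<Gamma> e) k * P k (I e)) =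
    (\<Sum>l \<in> leaf_edges \<Gamma> \<rightarrow>\<^sub>E {..<m'}. (\<Prod>e\<in>leaf_edges \<Gamma>. a (leaf_label \<Gamma> e) (l e)) * (\<Prod>e\<in>leaf_edges \<Gamma>. P (l e) (I e)))" for I
    by (subst prod_sum_PiE) (auto simp: prod.distrib)
  then have "symbol \<alpha> \<Gamma> (\<lambda>j i. \<Sum>k<m'. a j k * P k i) x = (\<Sum>I \<in> set (edges \<Gamma>) \<rightarrow>\<^sub>E UNIV.
     \<Sum>l \<in> leaf_edges \<Gamma> \<rightarrow>\<^sub>E {..<m'}. (\<Prod>e\<in>leaf_edges \<Gamma>. a (leaf_label \<Gamma> e) (l e)) * (?A I * (\<Prod>e\<in>leaf_edges \<Gamma>. P (l e) (I e))))"
    by (simp add: symbol_def sum_distrib_left mult.left_commute)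
  also have "\<dots> = (\<Sum>l \<in> leaf_edges \<Gamma> \<rightarrow>\<^sub>E {..<m'}. (\<Prod>e\<in>leaf_edges \<Gamma>. a (leaf_label \<Gamma> e) (l e)) * symbol \<alpha> (rebind \<Gamma> l) P x)"
    by (subst sum.swap) (simp add: symbol_rebind sum_distrib_left)
  finally show ?thesis .
qed

context skew_bivector
begin

text \<open>
  When all covectors are equal, the boundary vertices may be merged, and then some vertex has two
  parallel edges.
\<close>

lemma symbol_diagonal:
  assumes g: "\<Gamma> \<in> tree_graphs n m" and n: "n > 0"
  shows "symbol \<alpha> \<Gamma> (\<lambda>j. p) x = 0"
proof -
  let ?R = "rebind \<Gamma> (\<lambda>_. 0)"
  obtain v where v: "v < n" "\<And>b. (v, b) \<in> leaf_edges \<Gamma>" using bottom_vertex[OF g n] by blast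
  have R: "?R \<in> tree_graphs n 1" by (rule rebind_tree[OF g]) simp
  have "target ?R (v, b) = Bdry 0" for b
    using v(2)[of b] v(1) tree_graphsD(1)[OF g] by (auto simp: target_rebind leaf_edges_def)
  then have "vanishes ?R" using v(1) tree_graphsD(1)[OF g] by (intro vanishes_parallel[of v]) auto
  then have "graph_operator \<alpha> ?R 1 (\<lambda>j. expo p) x = 0"
    by (intro weights_vanishes[OF graph_operator_weights]) auto
  then have "symbol \<alpha> ?R (\<lambda>j. p) x = 0" using graph_operator_expo[OF R, of \<alpha> "\<lambda>_. p" x] by simp
  then show ?thesis by (simp add: symbol_rebind symbol_def[of \<alpha> \<Gamma>])
qed

end

section \<open>Star-coefficients and the duality with the coproduct\<close>

lemma foldr_pd_linear_zero:
  fixes a :: "'d::finite \<Rightarrow> real"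
  shows "length is \<ge> 2 \<Longrightarrow> foldr pd is (\<lambda>x. \<Sum>k\<in>UNIV. a k * x $ k) = (\<lambda>x. 0)"
proof (induction "is")
  case (Cons i "is")
  show ?case
  proof (cases "length is \<ge> 2")
    case False
    with Cons.prems have "length is = Suc 0" by simp
    then obtain j where "is = [j]" by (auto simp: length_Suc_conv)
    then show ?thesis by (simp add: pd_linear_form)
  qed (use Cons.IH in simp)
qed simp

locale linear_poisson =
  fixes c :: "'d::finite \<Rightarrow> 'd \<Rightarrow> 'd \<Rightarrow> real" and \<alpha> :: "'d bivector"
  assumes linear: "\<alpha> = linear_bivector c" and poisson: "poisson_structure \<alpha>"

sublocale linear_poisson \<subseteq> skew_bivector \<alpha>
  using poisson unfolding poisson_structure_def by unfold_locales blast+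

context skew_bivector
begin

lemma graph_operator_sum:
  assumes i: "i < m" and F: "\<And>a. a \<in> A \<Longrightarrow> F a \<in> smooth_functions"
  shows "graph_operator \<alpha> \<Gamma> m (\<phi>(i := \<lambda>y. \<Sum>a\<in>A. w a * F a y)) x = (\<Sum>a\<in>A. w a * graph_operator \<alpha> \<Gamma> m (\<phi>(i := F a)) x)"
proof -
  let ?V = "set (vertices (length \<Gamma>) m)"
  have i': "Bdry i \<in> ?V" using i by (auto simp: set_vertices)
  have rest: "(\<Prod>u\<in>?V - {Bdry i}. diff_along \<Gamma> I u (vertex_fun \<alpha> (\<phi>(i := h)) I u) x)
     = (\<Prod>u\<in>?V - {Bdry i}. diff_along \<Gamma> I u (vertex_fun \<alpha> \<phi> I u) x)" for I h
  proof (rule prod.cong[OF refl])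
    fix u assume "u \<in> ?V - {Bdry i}"
    then have "vertex_fun \<alpha> (\<phi>(i := h)) I u = vertex_fun \<alpha> \<phi> I u" by (cases u rule: vertex.exhaust) auto
    then show "diff_along \<Gamma> I u (vertex_fun \<alpha> (\<phi>(i := h)) I u) x = diff_along \<Gamma> I u (vertex_fun \<alpha> \<phi> I u) x"
      by (simp only:)
  qed
  have split: "(\<Prod>u\<in>?V. diff_along \<Gamma> I u (vertex_fun \<alpha> (\<phi>(i := h)) I u) x)
     = diff_along \<Gamma> I (Bdry i) h x * (\<Prod>u\<in>?V - {Bdry i}. diff_along \<Gamma> I u (vertex_fun \<alpha> \<phi> I u) x)" for I h
    using prod.remove[OF List.finite_set i', of "\<lambda>u. diff_along \<Gamma> I u (vertex_fun \<alpha> (\<phi>(i := h)) I u) x"]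
    by (simp add: rest)
  have lin: "diff_along \<Gamma> I (Bdry i) (\<lambda>y. \<Sum>a\<in>A. w a * F a y) x = (\<Sum>a\<in>A. w a * diff_along \<Gamma> I (Bdry i) (F a) x)" for I
    unfolding diff_along_foldr using F
    by (subst foldr_pd_sum) (auto intro!: sum.cong simp: foldr_pd_cmult)
  have "graph_operator \<alpha> \<Gamma> m (\<phi>(i := \<lambda>y. \<Sum>a\<in>A. w a * F a y)) x = (\<Sum>I \<in> set (edges \<Gamma>) \<rightarrow>\<^sub>E UNIV.
     \<Sum>a\<in>A. w a * (diff_along \<Gamma> I (Bdry i) (F a) x * (\<Prod>u\<in>?V - {Bdry i}. diff_along \<Gamma> I u (vertex_fun \<alpha> \<phi> I u) x)))"
    unfolding graph_operator_def split lin by (simp add: sum_distrib_right mult.assoc)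
  also have "\<dots> = (\<Sum>a\<in>A. w a * graph_operator \<alpha> \<Gamma> m (\<phi>(i := F a)) x)"
    unfolding graph_operator_def split by (subst sum.swap) (simp add: sum_distrib_left)
  finally show ?thesis .
qed

lemma star_coeff_operator:
  "star_coeff \<alpha> W n f g x = (\<Sum>\<Gamma>\<in>graph_reps n 2. W \<Gamma> * graph_operator \<alpha> \<Gamma> 2 (nth [f, g]) x)"
  by (simp add: star_coeff_def graph_op_operator numeral_2_eq_2)

lemma nth_smooth: "set fs \<subseteq> smooth_functions \<Longrightarrow> j < length fs \<Longrightarrow> fs ! j \<in> smooth_functions"
  using nth_mem by blast

lemma star_coeff_smooth:
  assumes "f \<in> smooth_functions" "g \<in> smooth_functions"
  shows "star_coeff \<alpha> W n f g \<in> smooth_functions"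
  unfolding star_coeff_operator[abs_def]
  by (intro smooth_sum smooth_cmult graph_operator_smooth nth_smooth) (use assms in auto)

lemma star_coeff_sum_left:
  assumes "\<And>a. a \<in> A \<Longrightarrow> F a \<in> smooth_functions"
  shows "star_coeff \<alpha> W n (\<lambda>y. \<Sum>a\<in>A. w a * F a y) g x = (\<Sum>a\<in>A. w a * star_coeff \<alpha> W n (F a) g x)"
proof -
  have eq: "graph_operator \<alpha> \<Gamma> 2 (nth [h, g]) x = graph_operator \<alpha> \<Gamma> 2 ((nth [h, g])(0 := h)) x"
    "graph_operator \<alpha> \<Gamma> 2 ((nth [h, g])(0 := h')) x = graph_operator \<alpha> \<Gamma> 2 (nth [h', g]) x" for h h' \<Gamma>
    by (rule graph_operator_cong; auto simp: less_Suc_eq numeral_2_eq_2)+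
  have "graph_operator \<alpha> \<Gamma> 2 (nth [\<lambda>y. \<Sum>a\<in>A. w a * F a y, g]) x = (\<Sum>a\<in>A. w a * graph_operator \<alpha> \<Gamma> 2 (nth [F a, g]) x)" for \<Gamma>
    by (subst eq, subst graph_operator_sum) (auto simp: assms eq(2))
  then have "star_coeff \<alpha> W n (\<lambda>y. \<Sum>a\<in>A. w a * F a y) g x
    = (\<Sum>\<Gamma>\<in>graph_reps n 2. \<Sum>a\<in>A. w a * (W \<Gamma> * graph_operator \<alpha> \<Gamma> 2 (nth [F a, g]) x))"
    by (simp add: star_coeff_operator sum_distrib_left mult.left_commute)
  also have "\<dots> = (\<Sum>a\<in>A. w a * star_coeff \<alpha> W n (F a) g x)"
    by (subst sum.swap) (simp add: star_coeff_operator sum_distrib_left)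
  finally show ?thesis .
qed

lemma star_coeff_sum_right:
  assumes "\<And>a. a \<in> A \<Longrightarrow> F a \<in> smooth_functions"
  shows "star_coeff \<alpha> W n f (\<lambda>y. \<Sum>a\<in>A. w a * F a y) x = (\<Sum>a\<in>A. w a * star_coeff \<alpha> W n f (F a) x)"
proof -
  have eq: "graph_operator \<alpha> \<Gamma> 2 (nth [f, h]) x = graph_operator \<alpha> \<Gamma> 2 ((nth [f, h])(1 := h)) x"
    "graph_operator \<alpha> \<Gamma> 2 ((nth [f, h])(1 := h')) x = graph_operator \<alpha> \<Gamma> 2 (nth [f, h']) x" for h h' \<Gamma>
    by (rule graph_operator_cong; auto simp: less_Suc_eq numeral_2_eq_2)+
  have "graph_operator \<alpha> \<Gamma> 2 (nth [f, \<lambda>y. \<Sum>a\<in>A. w a * F a y]) x = (\<Sum>a\<in>A. w a * graph_operator \<alpha> \<Gamma> 2 (nth [f, F a]) x)" for \<Gamma>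
    by (subst eq, subst graph_operator_sum) (auto simp: assms eq(2) simp del: One_nat_def)
  then have "star_coeff \<alpha> W n f (\<lambda>y. \<Sum>a\<in>A. w a * F a y) x
    = (\<Sum>\<Gamma>\<in>graph_reps n 2. \<Sum>a\<in>A. w a * (W \<Gamma> * graph_operator \<alpha> \<Gamma> 2 (nth [f, F a]) x))"
    by (simp add: star_coeff_operator sum_distrib_left mult.left_commute)
  also have "\<dots> = (\<Sum>a\<in>A. w a * star_coeff \<alpha> W n f (F a) x)"
    by (subst sum.swap) (simp add: star_coeff_operator sum_distrib_left)
  finally show ?thesis .
qed

end

text \<open>
  The edges of a graft join two vertices of \<open>\<Gamma>\<^sub>1\<close>, two vertices of \<open>\<Gamma>\<^sub>2\<close>, or lead from \<open>\<Gamma>\<^sub>1\<close> to \<open>\<Gamma>\<^sub>2\<close>; so there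
  are no new circuits. But several edges may be attached to the same internal vertex of \<open>\<Gamma>\<^sub>2\<close>.
\<close>

lemma graft_tree:
  assumes g1: "\<Gamma>\<^sub>1 \<in> tree_graphs n\<^sub>1 m\<^sub>1" and g2: "\<Gamma>\<^sub>2 \<in> tree_graphs n\<^sub>2 m\<^sub>2" and i: "i < m\<^sub>1"
    and r: "r \<in> (\<Pi>\<^sub>E e\<in>set (edges \<Gamma>\<^sub>1). set (reattach i m\<^sub>2 \<Gamma>\<^sub>2 (length \<Gamma>\<^sub>1) (target \<Gamma>\<^sub>1 e)))"
  shows "graft i \<Gamma>\<^sub>1 \<Gamma>\<^sub>2 r \<in> tree_graphs (n\<^sub>1 + n\<^sub>2) (m\<^sub>1 + m\<^sub>2 - 1) \<or>
    (\<exists>v<n\<^sub>1 + n\<^sub>2. length (incoming (graft i \<Gamma>\<^sub>1 \<Gamma>\<^sub>2 r) (Inner v)) \<ge> 2)"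
proof -
  note len1 = tree_graphsD(1)[OF g1] and len2 = tree_graphsD(1)[OF g2]
  let ?T = "graft i \<Gamma>\<^sub>1 \<Gamma>\<^sub>2 r"
  have rt: "r (v, b) \<in> set (reattach i m\<^sub>2 \<Gamma>\<^sub>2 n\<^sub>1 (target \<Gamma>\<^sub>1 (v, b)))" if "v < n\<^sub>1" for v b
    using PiE_mem[OF r, of "(v, b)"] that by (simp add: len1)
  have t1: "target ?T (v, b) = r (v, b)" if "v < n\<^sub>1" for v b using that by (simp add: target_graft len1)
  have t2: "target ?T (v, b) = embed n\<^sub>1 i (target \<Gamma>\<^sub>2 (v - n\<^sub>1, b))" if "\<not> v < n\<^sub>1" "v < n\<^sub>1 + n\<^sub>2" for v b
    using target_graft(2)[of "v - n\<^sub>1" \<Gamma>\<^sub>2 i \<Gamma>\<^sub>1 r b] that by (simp add: len1 len2)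
  have tg1: "target \<Gamma>\<^sub>1 (v, b) \<in> set (vertices n\<^sub>1 m\<^sub>1)" if "v < n\<^sub>1" for v b
    using tree_graphsD(2)[OF g1, of "(v, b)"] that len1 by simp
  have tg2: "target \<Gamma>\<^sub>2 (v, b) \<in> set (vertices n\<^sub>2 m\<^sub>2)" if "v < n\<^sub>2" for v b
    using tree_graphsD(2)[OF g2, of "(v, b)"] that len2 by simp
  have targets: "target ?T e \<in> set (vertices (n\<^sub>1 + n\<^sub>2) (m\<^sub>1 + m\<^sub>2 - 1))" if e: "e \<in> set (edges ?T)" for e
  proof (cases e)
    case (Pair v b)
    then have v: "v < n\<^sub>1 + n\<^sub>2" using e by (simp add: len1 len2)
    show ?thesis
    proof (cases "v < n\<^sub>1")
      case True
      then show ?thesis using rt[OF True, of b] tg1[OF True, of b] i Pair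
        by (cases "target \<Gamma>\<^sub>1 (v, b)") (auto simp: t1 set_vertices len2 split: if_splits)
    next
      case False
      then have "v - n\<^sub>1 < n\<^sub>2" using v by simp
      from tg2[OF this, of b] False show ?thesis using v i Pair by (auto simp: t2 set_vertices)
    qed
  qed
  \<comment> \<open>A well-founded relation that contains the relation of the graft.\<close>
  let ?R1 = "successor_rel \<Gamma>\<^sub>1" and ?A = "{..<n\<^sub>1}" and ?B = "{n\<^sub>1..}"
  let ?R2 = "{(v, w). n\<^sub>1 \<le> v \<and> n\<^sub>1 \<le> w \<and> (v - n\<^sub>1, w - n\<^sub>1) \<in> successor_rel \<Gamma>\<^sub>2}"
  have wf1: "wf ?R1" using successor_rel_finite_acyclic[OF g1] by (rule finite_acyclic_wf)
  have "wf (successor_rel \<Gamma>\<^sub>2)" using successor_rel_finite_acyclic[OF g2] by (rule finite_acyclic_wf)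
  then have wf2: "wf ?R2" by (rule wf_subset[OF wf_inv_image[where f = "\<lambda>v. v - n\<^sub>1"]]) (auto simp: inv_image_def)
  have wf12: "wf (?A \<times> ?B)" by (rule wf_no_loop) auto
  have R1: "?R1 \<subseteq> ?A \<times> ?A" using inner_target_less[OF g1] by (auto simp: successor_rel_def len1)
  have "wf (?A \<times> ?B \<union> ?R2)" by (rule wf_Un[OF wf12 wf2]) auto
  then have "wf (?R1 \<union> (?A \<times> ?B \<union> ?R2))" by (rule wf_Un[OF wf1]) (use R1 in auto)
  then have ac: "acyclic (?R1 \<union> (?A \<times> ?B \<union> ?R2))" by (rule wf_acyclic)
  have "successor_rel ?T \<subseteq> ?R1 \<union> (?A \<times> ?B \<union> ?R2)"
  proof
    fix p assume "p \<in> successor_rel ?T"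
    then obtain v w b where p: "p = (v, w)" "v < n\<^sub>1 + n\<^sub>2" "target ?T (v, b) = Inner w"
      by (auto simp: successor_rel_def len1 len2)
    show "p \<in> ?R1 \<union> (?A \<times> ?B \<union> ?R2)"
    proof (cases "v < n\<^sub>1")
      case True
      then show ?thesis using rt[OF True, of b] p
        by (cases "target \<Gamma>\<^sub>1 (v, b)") (auto simp: t1 successor_rel_def len1 set_vertices split: if_splits)
    next
      case False
      then show ?thesis using p
        by (cases "target \<Gamma>\<^sub>2 (v - n\<^sub>1, b)") (auto simp: t2 successor_rel_def len2)
    qed
  qed
  then have "acyclic (successor_rel ?T)" by (rule acyclic_subset[OF ac])
  then have "?T \<in> tree_graphs (n\<^sub>1 + n\<^sub>2) (m\<^sub>1 + m\<^sub>2 - 1)" if "\<forall>v<n\<^sub>1 + n\<^sub>2. length (incoming ?T (Inner v)) \<le> 1"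
    using targets that unfolding tree_graphs_def successor_rel_def by (simp add: len1 len2)
  then show ?thesis by (metis One_nat_def not_less_eq_eq numeral_2_eq_2)
qed

text \<open>
  The coefficient of order \<open>n\<close> of \<open>(f \<star> g) \<star> h - f \<star> (g \<star> h)\<close>, where \<open>l\<close> is the order of the inner product.
\<close>

definition associator_coeff :: "'d::finite bivector \<Rightarrow> (graph \<Rightarrow> real) \<Rightarrow> nat \<Rightarrow>
    (real^'d \<Rightarrow> real) \<Rightarrow> (real^'d \<Rightarrow> real) \<Rightarrow> (real^'d \<Rightarrow> real) \<Rightarrow> real^'d \<Rightarrow> real" where
  "associator_coeff \<alpha> W n f g h x = (\<Sum>l\<le>n. star_coeff \<alpha> W (n - l) (star_coeff \<alpha> W l f g) h x
      - star_coeff \<alpha> W (n - l) f (star_coeff \<alpha> W l g h) x)"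

context linear_poisson
begin

lemma graph_operator_two_incoming:
  assumes "v < length \<Gamma>" "length (incoming \<Gamma> (Inner v)) \<ge> 2"
  shows "graph_operator \<alpha> \<Gamma> m \<phi> x = 0"
proof -
  have "diff_along \<Gamma> I (Inner v) (\<alpha> i j) x = 0" for I i j
    unfolding diff_along_foldr linear linear_bivector_def using assms(2)
    by (subst foldr_pd_linear_zero) auto
  then show ?thesis unfolding graph_operator_def prod_vertices using assms(1)
    by (intro sum.neutral ballI) (auto intro!: prod_zero)
qed

lemma insertion_expand:
  assumes g1: "\<Gamma>\<^sub>1 \<in> tree_graphs n\<^sub>1 2" and g2: "\<Gamma>\<^sub>2 \<in> tree_graphs n\<^sub>2 2" and i: "i < 2"
    and \<phi>: "\<And>j. j < 3 \<Longrightarrow> \<phi> j \<in> smooth_functions"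
  shows "(\<Sum>T\<leftarrow>insertion i 2 \<Gamma>\<^sub>1 \<Gamma>\<^sub>2. graph_operator \<alpha> T 3 \<phi> x) =
    (\<Sum>\<Gamma>\<in>graph_reps (n\<^sub>1 + n\<^sub>2) 3. of_int (\<Sum>T\<leftarrow>insertion i 2 \<Gamma>\<^sub>1 \<Gamma>\<^sub>2. class_sign T \<Gamma>) * graph_operator \<alpha> \<Gamma> 3 \<phi> x)"
proof -
  let ?R = "\<Pi>\<^sub>E e\<in>set (edges \<Gamma>\<^sub>1). set (reattach i 2 \<Gamma>\<^sub>2 (length \<Gamma>\<^sub>1) (target \<Gamma>\<^sub>1 e))"
  let ?F = "\<lambda>\<Gamma>. graph_operator \<alpha> \<Gamma> 3 \<phi> x" and ?G = "graft i \<Gamma>\<^sub>1 \<Gamma>\<^sub>2"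
  have F: "?F \<in> weights" by (rule graph_operator_weights[OF \<phi>])
  have "?F (?G r) = (\<Sum>\<Gamma>\<in>graph_reps (n\<^sub>1 + n\<^sub>2) 3. of_int (class_sign (?G r) \<Gamma>) * ?F \<Gamma>)" if "r \<in> ?R" for r
  proof (rule graph_reps_expand[OF F, symmetric])
    note len = tree_graphsD(1)[OF g1] tree_graphsD(1)[OF g2]
    from graft_tree[OF g1 g2 i that] show "?G r \<in> tree_graphs (n\<^sub>1 + n\<^sub>2) 3 \<or> ?F (?G r) = 0"
    proof (elim disjE exE conjE)
      fix v assume "v < n\<^sub>1 + n\<^sub>2" "2 \<le> length (incoming (?G r) (Inner v))"
      then have "?F (?G r) = 0" by (intro graph_operator_two_incoming[of v]) (simp_all add: len)
      then show ?thesis by (rule disjI2)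
    qed simp
  qed
  then have "(\<Sum>r\<in>?R. ?F (?G r)) = (\<Sum>r\<in>?R. \<Sum>\<Gamma>\<in>graph_reps (n\<^sub>1 + n\<^sub>2) 3. of_int (class_sign (?G r) \<Gamma>) * ?F \<Gamma>)"
    by (rule sum.cong[OF refl])
  also have "\<dots> = (\<Sum>\<Gamma>\<in>graph_reps (n\<^sub>1 + n\<^sub>2) 3. of_int (\<Sum>r\<in>?R. class_sign (?G r) \<Gamma>) * ?F \<Gamma>)"
    by (subst sum.swap) (simp add: sum_distrib_right)
  finally show ?thesis unfolding sum_insertion .
qed

lemma star_coeff_compose_left:
  assumes "f \<in> smooth_functions" "g \<in> smooth_functions" "h \<in> smooth_functions"
  shows "star_coeff \<alpha> W a (star_coeff \<alpha> W b f g) h x = (\<Sum>\<Gamma>\<^sub>1\<in>graph_reps a 2. \<Sum>\<Gamma>\<^sub>2\<in>graph_reps b 2.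
    W \<Gamma>\<^sub>1 * W \<Gamma>\<^sub>2 * (\<Sum>T\<leftarrow>insertion 0 2 \<Gamma>\<^sub>1 \<Gamma>\<^sub>2. graph_operator \<alpha> T 3 (nth [f, g, h]) x))"
proof -
  have sm: "graph_operator \<alpha> \<Gamma>\<^sub>2 2 (nth [f, g]) \<in> smooth_functions" for \<Gamma>\<^sub>2
    by (intro graph_operator_smooth nth_smooth) (use assms in auto)
  have "graph_operator \<alpha> \<Gamma>\<^sub>1 2 (nth [graph_operator \<alpha> \<Gamma>\<^sub>2 2 (nth [f, g]), h]) x
     = (\<Sum>T\<leftarrow>insertion 0 2 \<Gamma>\<^sub>1 \<Gamma>\<^sub>2. graph_operator \<alpha> T 3 (nth [f, g, h]) x)"
    if g: "\<Gamma>\<^sub>1 \<in> graph_reps a 2" "\<Gamma>\<^sub>2 \<in> graph_reps b 2" for \<Gamma>\<^sub>1 \<Gamma>\<^sub>2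
  proof -
    have op: "graph_operator \<alpha> \<Gamma>\<^sub>2 2 (\<lambda>k. [f, g, h] ! (0 + k)) = graph_operator \<alpha> \<Gamma>\<^sub>2 2 (nth [f, g])"
      by (rule ext, rule graph_operator_cong) (auto simp: less_Suc_eq numeral_2_eq_2)
    let ?\<phi>1 = "\<lambda>j. if j < 0 then [f, g, h] ! j else if j = 0 then graph_operator \<alpha> \<Gamma>\<^sub>2 2 (\<lambda>k. [f, g, h] ! (0 + k)) else [f, g, h] ! (j + 2 - 1)"
    have "graph_operator \<alpha> \<Gamma>\<^sub>1 2 (nth [graph_operator \<alpha> \<Gamma>\<^sub>2 2 (nth [f, g]), h]) x = graph_operator \<alpha> \<Gamma>\<^sub>1 2 ?\<phi>1 x"
      unfolding op by (rule graph_operator_cong) (auto simp: less_Suc_eq numeral_2_eq_2)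
    also have "\<dots> = (\<Sum>T\<leftarrow>insertion 0 2 \<Gamma>\<^sub>1 \<Gamma>\<^sub>2. graph_operator \<alpha> T (2 + 2 - 1) (nth [f, g, h]) x)"
      by (rule graph_operator_insertion[OF graph_repsD(1)[OF g(1)] graph_repsD(1)[OF g(2)]])
         (use assms in \<open>auto simp: less_Suc_eq numeral_2_eq_2\<close>)
    finally show ?thesis by (simp add: numeral_3_eq_3)
  qed
  then have *: "W \<Gamma>\<^sub>2 * star_coeff \<alpha> W a (graph_operator \<alpha> \<Gamma>\<^sub>2 2 (nth [f, g])) h x =
    (\<Sum>\<Gamma>\<^sub>1\<in>graph_reps a 2. W \<Gamma>\<^sub>1 * W \<Gamma>\<^sub>2 * (\<Sum>T\<leftarrow>insertion 0 2 \<Gamma>\<^sub>1 \<Gamma>\<^sub>2. graph_operator \<alpha> T 3 (nth [f, g, h]) x))"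
    if "\<Gamma>\<^sub>2 \<in> graph_reps b 2" for \<Gamma>\<^sub>2
    unfolding star_coeff_operator sum_distrib_left using that by (intro sum.cong refl) simp
  have "star_coeff \<alpha> W a (star_coeff \<alpha> W b f g) h x =
      (\<Sum>\<Gamma>\<^sub>2\<in>graph_reps b 2. W \<Gamma>\<^sub>2 * star_coeff \<alpha> W a (graph_operator \<alpha> \<Gamma>\<^sub>2 2 (nth [f, g])) h x)"
    unfolding star_coeff_operator[of W b f g, abs_def] by (rule star_coeff_sum_left[OF sm])
  then show ?thesis by (simp add: *) (rule sum.swap)
qed

lemma star_coeff_compose_right:
  assumes "f \<in> smooth_functions" "g \<in> smooth_functions" "h \<in> smooth_functions"
  shows "star_coeff \<alpha> W a f (star_coeff \<alpha> W b g h) x = (\<Sum>\<Gamma>\<^sub>1\<in>graph_reps a 2. \<Sum>\<Gamma>\<^sub>2\<in>graph_reps b 2.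
    W \<Gamma>\<^sub>1 * W \<Gamma>\<^sub>2 * (\<Sum>T\<leftarrow>insertion 1 2 \<Gamma>\<^sub>1 \<Gamma>\<^sub>2. graph_operator \<alpha> T 3 (nth [f, g, h]) x))"
proof -
  have sm: "graph_operator \<alpha> \<Gamma>\<^sub>2 2 (nth [g, h]) \<in> smooth_functions" for \<Gamma>\<^sub>2
    by (intro graph_operator_smooth nth_smooth) (use assms in auto)
  have "graph_operator \<alpha> \<Gamma>\<^sub>1 2 (nth [f, graph_operator \<alpha> \<Gamma>\<^sub>2 2 (nth [g, h])]) x
     = (\<Sum>T\<leftarrow>insertion 1 2 \<Gamma>\<^sub>1 \<Gamma>\<^sub>2. graph_operator \<alpha> T 3 (nth [f, g, h]) x)"
    if g: "\<Gamma>\<^sub>1 \<in> graph_reps a 2" "\<Gamma>\<^sub>2 \<in> graph_reps b 2" for \<Gamma>\<^sub>1 \<Gamma>\<^sub>2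
  proof -
    have op: "graph_operator \<alpha> \<Gamma>\<^sub>2 2 (\<lambda>k. [f, g, h] ! (1 + k)) = graph_operator \<alpha> \<Gamma>\<^sub>2 2 (nth [g, h])"
      by (rule ext, rule graph_operator_cong) (auto simp: less_Suc_eq numeral_2_eq_2)
    let ?\<phi>1 = "\<lambda>j. if j < 1 then [f, g, h] ! j else if j = 1 then graph_operator \<alpha> \<Gamma>\<^sub>2 2 (\<lambda>k. [f, g, h] ! (1 + k)) else [f, g, h] ! (j + 2 - 1)"
    have "graph_operator \<alpha> \<Gamma>\<^sub>1 2 (nth [f, graph_operator \<alpha> \<Gamma>\<^sub>2 2 (nth [g, h])]) x = graph_operator \<alpha> \<Gamma>\<^sub>1 2 ?\<phi>1 x"
      unfolding op by (rule graph_operator_cong) (auto simp: less_Suc_eq numeral_2_eq_2)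
    also have "\<dots> = (\<Sum>T\<leftarrow>insertion 1 2 \<Gamma>\<^sub>1 \<Gamma>\<^sub>2. graph_operator \<alpha> T (2 + 2 - 1) (nth [f, g, h]) x)"
      by (rule graph_operator_insertion[OF graph_repsD(1)[OF g(1)] graph_repsD(1)[OF g(2)]])
         (use assms in \<open>auto simp: less_Suc_eq numeral_2_eq_2\<close>)
    finally show ?thesis by (simp add: numeral_3_eq_3)
  qed
  then have *: "W \<Gamma>\<^sub>2 * star_coeff \<alpha> W a f (graph_operator \<alpha> \<Gamma>\<^sub>2 2 (nth [g, h])) x =
    (\<Sum>\<Gamma>\<^sub>1\<in>graph_reps a 2. W \<Gamma>\<^sub>1 * W \<Gamma>\<^sub>2 * (\<Sum>T\<leftarrow>insertion 1 2 \<Gamma>\<^sub>1 \<Gamma>\<^sub>2. graph_operator \<alpha> T 3 (nth [f, g, h]) x))"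
    if "\<Gamma>\<^sub>2 \<in> graph_reps b 2" for \<Gamma>\<^sub>2
    unfolding star_coeff_operator sum_distrib_left using that by (intro sum.cong refl) simp
  have "star_coeff \<alpha> W a f (star_coeff \<alpha> W b g h) x =
      (\<Sum>\<Gamma>\<^sub>2\<in>graph_reps b 2. W \<Gamma>\<^sub>2 * star_coeff \<alpha> W a f (graph_operator \<alpha> \<Gamma>\<^sub>2 2 (nth [g, h])) x)"
    unfolding star_coeff_operator[of W b g h, abs_def] by (rule star_coeff_sum_right[OF sm])
  then show ?thesis by (simp add: *) (rule sum.swap)
qed

text \<open>
  Expand the composed operators by insertion, collect the terms by classes of graphs, and compare with
  the definition of the coproduct as the dual of the composition.
\<close>

lemma associator_moyal:
  assumes "f \<in> smooth_functions" "g \<in> smooth_functions" "h \<in> smooth_functions"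
  shows "associator_coeff \<alpha> W n f g h x = (\<Sum>\<Gamma>\<in>graph_reps n 3. weight_coproduct W \<Gamma> * graph_op \<alpha> \<Gamma> [f, g, h] x)"
proof -
  let ?F = "\<lambda>\<Gamma>. graph_operator \<alpha> \<Gamma> 3 (nth [f, g, h]) x"
  have \<phi>: "[f, g, h] ! j \<in> smooth_functions" if "j < 3" for j
    using that assms by (auto simp: less_Suc_eq numeral_3_eq_3)
  have "star_coeff \<alpha> W (n - l) (star_coeff \<alpha> W l f g) h x - star_coeff \<alpha> W (n - l) f (star_coeff \<alpha> W l g h) x =
    (\<Sum>\<Gamma>\<in>graph_reps n 3. (\<Sum>\<Gamma>\<^sub>1\<in>graph_reps (n - l) 2. \<Sum>\<Gamma>\<^sub>2\<in>graph_reps l 2.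
        of_int (coproduct \<Gamma> (\<Gamma>\<^sub>1, \<Gamma>\<^sub>2)) * (W \<Gamma>\<^sub>1 * W \<Gamma>\<^sub>2)) * ?F \<Gamma>)" if l: "l \<le> n" for l
  proof -
    have ins: "(\<Sum>T\<leftarrow>insertion 0 2 \<Gamma>\<^sub>1 \<Gamma>\<^sub>2. ?F T) - (\<Sum>T\<leftarrow>insertion 1 2 \<Gamma>\<^sub>1 \<Gamma>\<^sub>2. ?F T)
      = (\<Sum>\<Gamma>\<in>graph_reps n 3. of_int (coproduct \<Gamma> (\<Gamma>\<^sub>1, \<Gamma>\<^sub>2)) * ?F \<Gamma>)"
      if "\<Gamma>\<^sub>1 \<in> graph_reps (n - l) 2" "\<Gamma>\<^sub>2 \<in> graph_reps l 2" for \<Gamma>\<^sub>1 \<Gamma>\<^sub>2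
    proof -
      note t = graph_repsD(1)[OF that(1)] graph_repsD(1)[OF that(2)]
      show ?thesis
        using insertion_expand[OF t, of 0 "nth [f, g, h]" x] insertion_expand[OF t, of 1 "nth [f, g, h]" x] \<phi> l
        by (simp add: coproduct_def composition_coeff_def sum_subtractf[symmetric] left_diff_distrib)
    qed
    have "star_coeff \<alpha> W (n - l) (star_coeff \<alpha> W l f g) h x - star_coeff \<alpha> W (n - l) f (star_coeff \<alpha> W l g h) x =
      (\<Sum>\<Gamma>\<^sub>1\<in>graph_reps (n - l) 2. \<Sum>\<Gamma>\<^sub>2\<in>graph_reps l 2. W \<Gamma>\<^sub>1 * W \<Gamma>\<^sub>2 *
        ((\<Sum>T\<leftarrow>insertion 0 2 \<Gamma>\<^sub>1 \<Gamma>\<^sub>2. ?F T) - (\<Sum>T\<leftarrow>insertion 1 2 \<Gamma>\<^sub>1 \<Gamma>\<^sub>2. ?F T)))"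
      by (simp only: star_coeff_compose_left[OF assms] star_coeff_compose_right[OF assms]
            right_diff_distrib sum_subtractf)
    also have "\<dots> = (\<Sum>\<Gamma>\<^sub>1\<in>graph_reps (n - l) 2. \<Sum>\<Gamma>\<^sub>2\<in>graph_reps l 2. \<Sum>\<Gamma>\<in>graph_reps n 3.
        of_int (coproduct \<Gamma> (\<Gamma>\<^sub>1, \<Gamma>\<^sub>2)) * (W \<Gamma>\<^sub>1 * W \<Gamma>\<^sub>2) * ?F \<Gamma>)"
      by (intro sum.cong refl) (simp only: ins, simp add: sum_distrib_left mult_ac)
    also have "\<dots> = (\<Sum>\<Gamma>\<^sub>1\<in>graph_reps (n - l) 2. \<Sum>\<Gamma>\<in>graph_reps n 3. \<Sum>\<Gamma>\<^sub>2\<in>graph_reps l 2.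
        of_int (coproduct \<Gamma> (\<Gamma>\<^sub>1, \<Gamma>\<^sub>2)) * (W \<Gamma>\<^sub>1 * W \<Gamma>\<^sub>2) * ?F \<Gamma>)"
      by (intro sum.cong refl sum.swap)
    also have "\<dots> = (\<Sum>\<Gamma>\<in>graph_reps n 3. \<Sum>\<Gamma>\<^sub>1\<in>graph_reps (n - l) 2. \<Sum>\<Gamma>\<^sub>2\<in>graph_reps l 2.
        of_int (coproduct \<Gamma> (\<Gamma>\<^sub>1, \<Gamma>\<^sub>2)) * (W \<Gamma>\<^sub>1 * W \<Gamma>\<^sub>2) * ?F \<Gamma>)"
      by (rule sum.swap)
    finally show ?thesis by (simp add: sum_distrib_right)
  qed
  then have "associator_coeff \<alpha> W n f g h x = (\<Sum>l\<le>n. \<Sum>\<Gamma>\<in>graph_reps n 3. (\<Sum>\<Gamma>\<^sub>1\<in>graph_reps (n - l) 2. \<Sum>\<Gamma>\<^sub>2\<in>graph_reps l 2.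
        of_int (coproduct \<Gamma> (\<Gamma>\<^sub>1, \<Gamma>\<^sub>2)) * (W \<Gamma>\<^sub>1 * W \<Gamma>\<^sub>2)) * ?F \<Gamma>)"
    unfolding associator_coeff_def by (intro sum.cong refl) simp
  also have "\<dots> = (\<Sum>\<Gamma>\<in>graph_reps n 3. weight_coproduct W \<Gamma> * ?F \<Gamma>)"
    by (subst sum.swap) (simp add: weight_coproduct_def graph_reps_length sum_distrib_right)
  finally show ?thesis by (simp add: graph_op_operator numeral_3_eq_3)
qed

lemma moyal_iff:
  "moyal_equation \<alpha> W n \<longleftrightarrow> (\<forall>f\<in>smooth_functions. \<forall>g\<in>smooth_functions. \<forall>h\<in>smooth_functions.
     \<forall>x. associator_coeff \<alpha> W n f g h x = 0)"
  unfolding moyal_equation_def using associator_moyal by simp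

end

section \<open>The associator as a Hochschild cocycle\<close>

lemma sum_fun_apply: "(\<Sum>a\<in>A. F a) x = (\<Sum>a\<in>A. (F a x :: 'b::comm_monoid_add))"
  by (induction A rule: infinite_finite_induct) (auto simp: zero_fun_def plus_fun_def)

context linear_poisson
begin

lemma star_coeff_zero_left: "star_coeff \<alpha> W n (\<lambda>y. 0) g = (\<lambda>y. 0)"
  using star_coeff_sum_left[of "{}" _ W n _ g] by auto

lemma star_coeff_zero_right: "star_coeff \<alpha> W n f (\<lambda>y. 0) = (\<lambda>y. 0)"
  using star_coeff_sum_right[of "{}" _ W n f] by auto

lemma star_coeff_diff_left:
  assumes "f \<in> smooth_functions" "f' \<in> smooth_functions"
  shows "star_coeff \<alpha> W n (\<lambda>y. f y - f' y) g x = star_coeff \<alpha> W n f g x - star_coeff \<alpha> W n f' g x"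
  using star_coeff_sum_left[of UNIV "\<lambda>b. if b then f else f'" W n "\<lambda>b. if b then 1 else -1" g x] assms
  by (simp add: UNIV_bool algebra_simps)

lemma star_coeff_diff_right:
  assumes "g \<in> smooth_functions" "g' \<in> smooth_functions"
  shows "star_coeff \<alpha> W n f (\<lambda>y. g y - g' y) x = star_coeff \<alpha> W n f g x - star_coeff \<alpha> W n f g' x"
  using star_coeff_sum_right[of UNIV "\<lambda>b. if b then g else g'" W n f "\<lambda>b. if b then 1 else -1" x] assms
  by (simp add: UNIV_bool algebra_simps)

lemma associator_smooth:
  assumes "f \<in> smooth_functions" "g \<in> smooth_functions" "h \<in> smooth_functions"
  shows "associator_coeff \<alpha> W n f g h \<in> smooth_functions"
  unfolding associator_coeff_def[abs_def] using assms
  by (intro smooth_sum smooth_diff star_coeff_smooth)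

lemma triple_sum_left:
  fixes F :: "nat \<Rightarrow> nat \<Rightarrow> nat \<Rightarrow> real"
  shows "(\<Sum>l\<le>n. \<Sum>k\<le>l. F (n - l) (l - k) k) = (\<Sum>(i, j, k)\<in>{(i, j, k). i + j + k = n}. F i j k)"
proof -
  have "(\<Sum>l\<le>n. \<Sum>k\<le>l. F (n - l) (l - k) k) = (\<Sum>(l, k)\<in>Sigma {..n} (\<lambda>l. {..l}). F (n - l) (l - k) k)"
    by (rule sum.Sigma) auto
  also have "\<dots> = (\<Sum>(i, j, k)\<in>{(i, j, k). i + j + k = n}. F i j k)"
    by (rule sum.reindex_bij_witness[of _ "\<lambda>(i, j, k). (j + k, k)" "\<lambda>(l, k). (n - l, l - k, k)"]) auto
  finally show ?thesis .
qed

lemma triple_sum_right: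
  fixes F :: "nat \<Rightarrow> nat \<Rightarrow> nat \<Rightarrow> real"
  shows "(\<Sum>l\<le>n. \<Sum>m\<le>n - l. F (n - l - m) m l) = (\<Sum>(i, j, k)\<in>{(i, j, k). i + j + k = n}. F i j k)"
proof -
  have "(\<Sum>l\<le>n. \<Sum>m\<le>n - l. F (n - l - m) m l) = (\<Sum>(l, m)\<in>Sigma {..n} (\<lambda>l. {..n - l}). F (n - l - m) m l)"
    by (rule sum.Sigma) auto
  also have "\<dots> = (\<Sum>(i, j, k)\<in>{(i, j, k). i + j + k = n}. F i j k)"
    by (rule sum.reindex_bij_witness[of _ "\<lambda>(i, j, k). (k, j)" "\<lambda>(l, m). (n - l - m, m, l)"]) auto
  finally show ?thesis .
qed

lemma triple_sum_swap:
  fixes F :: "nat \<Rightarrow> nat \<Rightarrow> nat \<Rightarrow> real"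
  shows "(\<Sum>(i, j, k)\<in>{(i, j, k). i + j + k = n}. F i j k) = (\<Sum>(i, j, k)\<in>{(i, j, k). i + j + k = n}. F i k j)"
  by (rule sum.reindex_bij_witness[of _ "\<lambda>(i, j, k). (i, k, j)" "\<lambda>(i, j, k). (i, k, j)"]) (auto simp: ac_simps)

text \<open>
  The pentagon identity for the five ways of bracketing four factors. Each of the five sums is a
  difference of two of the sums \<open>t1, \<dots>, t5\<close> over all distributions of the order \<open>n\<close>.
\<close>

lemma associator_pentagon:
  fixes W :: "graph \<Rightarrow> real"
  assumes f: "f \<in> smooth_functions" and g: "g \<in> smooth_functions" and h: "h \<in> smooth_functions" and p: "p \<in> smooth_functions"
  defines "B \<equiv> star_coeff \<alpha> W" and "A \<equiv> associator_coeff \<alpha> W"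
  shows "(\<Sum>l\<le>n. B (n - l) f (A l g h p) x) - (\<Sum>l\<le>n. A (n - l) (B l f g) h p x) + (\<Sum>l\<le>n. A (n - l) f (B l g h) p x)
      - (\<Sum>l\<le>n. A (n - l) f g (B l h p) x) + (\<Sum>l\<le>n. B (n - l) (A l f g h) p x) = 0"
proof -
  let ?T = "{(i, j, k). i + j + k = n}"
  have sm: "B i u v \<in> smooth_functions" if "u \<in> smooth_functions" "v \<in> smooth_functions" for i u v
    unfolding B_def by (rule star_coeff_smooth[OF that])
  define t1 where "t1 i j k = B i (B j (B k f g) h) p x" for i j k
  define t2 where "t2 i j k = B i (B j f (B k g h)) p x" for i j k
  define t3 where "t3 i j k = B i (B j f g) (B k h p) x" for i j k
  define t4 where "t4 i j k = B i f (B j (B k g h) p) x" for i j k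
  define t5 where "t5 i j k = B i f (B j g (B k h p)) x" for i j k
  let ?S = "\<lambda>t. \<Sum>(i, j, k)\<in>?T. t i j k"
  have right: "B m u (A l v w z) x = (\<Sum>k\<le>l. B m u (B (l - k) (B k v w) z) x - B m u (B (l - k) v (B k w z)) x)"
    if "v \<in> smooth_functions" "w \<in> smooth_functions" "z \<in> smooth_functions" for m l u v w z
  proof -
    have "A l v w z = (\<lambda>y. \<Sum>k\<le>l. 1 * (B (l - k) (B k v w) z y - B (l - k) v (B k w z) y))"
      by (simp add: fun_eq_iff A_def B_def associator_coeff_def)
    then show ?thesis unfolding B_def
      using star_coeff_sum_right[of "{..l}" "\<lambda>k y. B (l - k) (B k v w) z y - B (l - k) v (B k w z) y" W m u "\<lambda>_. 1" x]
      by (simp add: B_def star_coeff_diff_right sm[unfolded B_def] that smooth_diff)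
  qed
  have left: "B m (A l v w z) u x = (\<Sum>k\<le>l. B m (B (l - k) (B k v w) z) u x - B m (B (l - k) v (B k w z)) u x)"
    if "v \<in> smooth_functions" "w \<in> smooth_functions" "z \<in> smooth_functions" for m l u v w z
  proof -
    have "A l v w z = (\<lambda>y. \<Sum>k\<le>l. 1 * (B (l - k) (B k v w) z y - B (l - k) v (B k w z) y))"
      by (simp add: fun_eq_iff A_def B_def associator_coeff_def)
    then show ?thesis unfolding B_def
      using star_coeff_sum_left[of "{..l}" "\<lambda>k y. B (l - k) (B k v w) z y - B (l - k) v (B k w z) y" W m "\<lambda>_. 1" u x]
      by (simp add: B_def star_coeff_diff_left sm[unfolded B_def] that smooth_diff)
  qed
  have "(\<Sum>l\<le>n. B (n - l) f (A l g h p) x) = ?S t4 - ?S t5"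
    using triple_sum_left[where F = t4] triple_sum_left[where F = t5]
    by (simp add: right g h p t4_def t5_def sum_subtractf)
  moreover have "(\<Sum>l\<le>n. B (n - l) (A l f g h) p x) = ?S t1 - ?S t2"
    using triple_sum_left[where F = t1] triple_sum_left[where F = t2]
    by (simp add: left f g h t1_def t2_def sum_subtractf)
  moreover have "(\<Sum>l\<le>n. A (n - l) (B l f g) h p x) = ?S t1 - ?S t3"
  proof -
    have "(\<Sum>l\<le>n. A (n - l) (B l f g) h p x) = (\<Sum>l\<le>n. \<Sum>m\<le>n - l. t1 (n - l - m) m l) - (\<Sum>l\<le>n. \<Sum>m\<le>n - l. t3 (n - l - m) l m)"
      by (simp add: A_def associator_coeff_def t1_def t3_def B_def sum_subtractf)
    then show ?thesis
      using triple_sum_right[where F = t1] triple_sum_right[where F = "\<lambda>i j k. t3 i k j"] triple_sum_swap[where F = t3] by simp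
  qed
  moreover have "(\<Sum>l\<le>n. A (n - l) f (B l g h) p x) = ?S t2 - ?S t4"
    using triple_sum_right[where F = t2] triple_sum_right[where F = t4]
    by (simp add: A_def associator_coeff_def t2_def t4_def B_def sum_subtractf)
  moreover have "(\<Sum>l\<le>n. A (n - l) f g (B l h p) x) = ?S t3 - ?S t5"
  proof -
    have "(\<Sum>l\<le>n. A (n - l) f g (B l h p) x) = (\<Sum>l\<le>n. \<Sum>m\<le>n - l. t3 (n - l - m) m l) - (\<Sum>l\<le>n. \<Sum>m\<le>n - l. t5 (n - l - m) m l)"
      by (simp add: A_def associator_coeff_def t3_def t5_def B_def sum_subtractf)
    then show ?thesis
      using triple_sum_right[where F = t3] triple_sum_right[where F = t5] by simp
  qed
  ultimately show ?thesis by simp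
qed

definition deforms_product :: "(graph \<Rightarrow> real) \<Rightarrow> bool" where
  "deforms_product W \<longleftrightarrow> (\<forall>f\<in>smooth_functions. \<forall>g\<in>smooth_functions. star_coeff \<alpha> W 0 f g = (\<lambda>x. f x * g x))"

text \<open>
  If the associator vanishes below order \<open>n\<close>, then in the pentagon identity only the terms survive in
  which the other product has order 0, that is, the Hochschild differential.
\<close>

lemma associator_cocycle:
  assumes W: "deforms_product W" and below: "\<And>k. k < n \<Longrightarrow> moyal_equation \<alpha> W k"
    and f: "f \<in> smooth_functions" and g: "g \<in> smooth_functions" and h: "h \<in> smooth_functions" and p: "p \<in> smooth_functions"
  defines "A \<equiv> associator_coeff \<alpha> W n"
  shows "f x * A g h p x - A (\<lambda>y. f y * g y) h p x + A f (\<lambda>y. g y * h y) p x - A f g (\<lambda>y. h y * p y) x + A f g h x * p x = 0"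
proof -
  let ?A = "associator_coeff \<alpha> W" and ?B = "star_coeff \<alpha> W"
  have B0: "?B 0 u v = (\<lambda>y. u y * v y)" if "u \<in> smooth_functions" "v \<in> smooth_functions" for u v
    using W that by (simp add: deforms_product_def)
  have A0: "?A k u v w = (\<lambda>y. 0)" if "k < n" "u \<in> smooth_functions" "v \<in> smooth_functions" "w \<in> smooth_functions" for k u v w
    using below[OF that(1)] that unfolding moyal_iff by auto
  note sm = star_coeff_smooth associator_smooth
  have low: "(\<Sum>l\<le>n. F l) = F 0" if "\<And>l. 0 < l \<Longrightarrow> l \<le> n \<Longrightarrow> F l = 0" for F :: "nat \<Rightarrow> real"
  proof -
    have "(\<Sum>l\<le>n. F l) = (\<Sum>l\<in>{0}. F l)" by (rule sum.mono_neutral_right) (use that in auto)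
    then show ?thesis by simp
  qed
  have top: "(\<Sum>l\<le>n. F l) = F n" if "\<And>l. l < n \<Longrightarrow> F l = 0" for F :: "nat \<Rightarrow> real"
  proof -
    have "(\<Sum>l\<le>n. F l) = (\<Sum>l\<in>{n}. F l)" by (rule sum.mono_neutral_right) (use that in auto)
    then show ?thesis by simp
  qed
  have "(\<Sum>l\<le>n. ?B (n - l) f (?A l g h p) x) = f x * A g h p x"
    by (subst top) (simp_all add: A0 f g h p star_coeff_zero_right B0 sm A_def)
  moreover have "(\<Sum>l\<le>n. ?B (n - l) (?A l f g h) p x) = A f g h x * p x"
    by (subst top) (simp_all add: A0 f g h p star_coeff_zero_left B0 sm A_def)
  moreover have "(\<Sum>l\<le>n. ?A (n - l) (?B l f g) h p x) = A (\<lambda>y. f y * g y) h p x"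
    by (subst low) (simp_all add: A0 f g h p B0 sm A_def)
  moreover have "(\<Sum>l\<le>n. ?A (n - l) f (?B l g h) p x) = A f (\<lambda>y. g y * h y) p x"
    by (subst low) (simp_all add: A0 f g h p B0 sm A_def)
  moreover have "(\<Sum>l\<le>n. ?A (n - l) f g (?B l h p) x) = A f g (\<lambda>y. h y * p y) x"
    by (subst low) (simp_all add: A0 f g h p B0 sm A_def)
  ultimately show ?thesis using associator_pentagon[OF f g h p, of W n x] by simp
qed

text \<open>
  Changing the product in order \<open>n\<close> by \<open>D\<close> changes the associator by the Hochschild coboundary of \<open>D\<close>.
\<close>

lemma associator_change:
  assumes n: "n > 0" and W: "deforms_product W"
    and eq: "\<And>k f g. k < n \<Longrightarrow> f \<in> smooth_functions \<Longrightarrow> g \<in> smooth_functions \<Longrightarrow> star_coeff \<alpha> W' k f g = star_coeff \<alpha> W k f g"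
    and f: "f \<in> smooth_functions" and g: "g \<in> smooth_functions" and h: "h \<in> smooth_functions"
  defines "D \<equiv> (\<lambda>f g x. star_coeff \<alpha> W' n f g x - star_coeff \<alpha> W n f g x)"
  shows "associator_coeff \<alpha> W' n f g h x = associator_coeff \<alpha> W n f g h x
    + D (\<lambda>y. f y * g y) h x - D f (\<lambda>y. g y * h y) x + D f g x * h x - f x * D g h x"
proof -
  let ?B = "star_coeff \<alpha> W" and ?B' = "star_coeff \<alpha> W'"
  have B0: "?B 0 u v = (\<lambda>y. u y * v y)" "?B' 0 u v = (\<lambda>y. u y * v y)" if "u \<in> smooth_functions" "v \<in> smooth_functions" for u v
    using W that eq[of 0 u v] n by (simp_all add: deforms_product_def)
  let ?t = "\<lambda>W l. star_coeff \<alpha> W (n - l) (star_coeff \<alpha> W l f g) h x - star_coeff \<alpha> W (n - l) f (star_coeff \<alpha> W l g h) x"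
  have "associator_coeff \<alpha> W' n f g h x - associator_coeff \<alpha> W n f g h x = (\<Sum>l\<le>n. ?t W' l - ?t W l)"
    by (simp add: associator_coeff_def sum_subtractf)
  also have "\<dots> = (\<Sum>l\<in>{0, n}. ?t W' l - ?t W l)"
    by (rule sum.mono_neutral_right) (auto simp: eq f g h star_coeff_smooth)
  also have "\<dots> = D (\<lambda>y. f y * g y) h x - D f (\<lambda>y. g y * h y) x + D f g x * h x - f x * D g h x"
    using n by (simp add: B0 f g h star_coeff_smooth D_def algebra_simps)
  finally show ?thesis by simp
qed

end

section \<open>Homogeneous parts of symbols\<close>

definition symbol_sum :: "'d::finite bivector \<Rightarrow> graph set \<Rightarrow> (graph \<Rightarrow> real) \<Rightarrow> ('d \<Rightarrow> real) list \<Rightarrow> real^'d \<Rightarrow> real" where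
  "symbol_sum \<alpha> S w ps x = (\<Sum>\<Gamma>\<in>S. w \<Gamma> * symbol \<alpha> \<Gamma> (nth ps) x)"

lemma symbol_cong:
  assumes g: "\<Gamma> \<in> tree_graphs n m" and P: "\<And>j. j < m \<Longrightarrow> P j = Q j"
  shows "symbol \<alpha> \<Gamma> P x = symbol \<alpha> \<Gamma> Q x"
proof -
  have "leaf_label \<Gamma> e < m" if "e \<in> leaf_edges \<Gamma>" for e
    using that tree_graphsD(2)[OF g, of e] by (auto simp: leaf_edges_def leaf_label_def set_vertices)
  then show ?thesis by (simp add: symbol_def P)
qed

definition leaf_part :: "nat \<Rightarrow> graph set \<Rightarrow> graph set" where
  "leaf_part N S = {\<Gamma> \<in> S. card (leaf_edges \<Gamma>) = N}"

lemma card_leaf_edges_le: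
  assumes "\<Gamma> \<in> tree_graphs n m" shows "card (leaf_edges \<Gamma>) \<le> 2 * n"
proof -
  have "card (leaf_edges \<Gamma>) \<le> card (set (edges \<Gamma>))" by (rule card_mono) (auto simp: leaf_edges_def)
  also have "\<dots> = 2 * n" by (simp add: set_edges tree_graphsD(1)[OF assms] card_cartesian_product)
  finally show ?thesis .
qed

lemma symbol_sum_parts:
  assumes S: "S \<subseteq> tree_graphs n m"
  shows "symbol_sum \<alpha> S w ps x = (\<Sum>N\<le>2 * n. symbol_sum \<alpha> (leaf_part N S) w ps x)"
proof -
  have fin: "finite S" using S finite_tree_graphs finite_subset by blast
  show ?thesis unfolding symbol_sum_def leaf_part_def
    by (rule sum.group[OF fin, symmetric]) (use S card_leaf_edges_le in auto)
qed

definition dilate :: "real \<Rightarrow> ('d \<Rightarrow> real) \<Rightarrow> 'd \<Rightarrow> real" where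
  "dilate t p = (\<lambda>i. t * p i)"

lemma dilate_add: "dilate t (p + q) = dilate t p + dilate t q"
  by (simp add: dilate_def plus_fun_def algebra_simps)

lemma dilate_2: "p + p = dilate 2 p"
  by (simp add: dilate_def plus_fun_def)

lemma symbol_sum_part_dilate:
  assumes S: "S \<subseteq> tree_graphs n m" and "length ps = m"
  shows "symbol_sum \<alpha> (leaf_part N S) w (map (dilate t) ps) x = t ^ N * symbol_sum \<alpha> (leaf_part N S) w ps x"
  unfolding symbol_sum_def sum_distrib_left
proof (rule sum.cong[OF refl])
  fix \<Gamma> assume "\<Gamma> \<in> leaf_part N S"
  then have g: "\<Gamma> \<in> tree_graphs n m" "card (leaf_edges \<Gamma>) = N" using S by (auto simp: leaf_part_def)
  have "symbol \<alpha> \<Gamma> (nth (map (dilate t) ps)) x = symbol \<alpha> \<Gamma> (\<lambda>j i. t * (ps ! j) i) x"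
    by (rule symbol_cong[OF g(1)]) (simp add: assms dilate_def)
  then show "w \<Gamma> * symbol \<alpha> \<Gamma> (nth (map (dilate t) ps)) x = t ^ N * (w \<Gamma> * symbol \<alpha> \<Gamma> (nth ps) x)"
    by (simp add: symbol_scale g(2))
qed

text \<open>
  Linear relations between values of a combination of symbols pass to its homogeneous parts if they
  hold for all dilations. The list \<open>qs\<close> is a formal combination of arguments.
\<close>

lemma parts_vanish:
  assumes S: "S \<subseteq> tree_graphs n m"
    and Q: "\<And>q. q \<in> set qs \<Longrightarrow> length (snd q) = m"
    and zero: "\<And>t::nat. (\<Sum>(a, ps)\<leftarrow>qs. a * symbol_sum \<alpha> S w (map (dilate t) ps) x) = 0"
  shows "(\<Sum>(a, ps)\<leftarrow>qs. a * symbol_sum \<alpha> (leaf_part N S) w ps x) = 0"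
proof (cases "N \<le> 2 * n")
  case True
  have "(\<Sum>N\<le>2 * n. real t ^ N * (\<Sum>(a, ps)\<leftarrow>qs. a * symbol_sum \<alpha> (leaf_part N S) w ps x))
    = (\<Sum>(a, ps)\<leftarrow>qs. a * symbol_sum \<alpha> S w (map (dilate t) ps) x)" for t :: nat
    using Q
  proof (induction qs)
    case (Cons q qs)
    then have "length (snd q) = m" by simp
    then have "(\<Sum>N\<le>2 * n. real t ^ N * (fst q * symbol_sum \<alpha> (leaf_part N S) w (snd q) x))
        = fst q * symbol_sum \<alpha> S w (map (dilate t) (snd q)) x"
      unfolding symbol_sum_parts[OF S] by (simp add: symbol_sum_part_dilate[OF S] sum_distrib_left mult.left_commute)
    then show ?case using Cons by (simp add: split_def distrib_left sum.distrib)
  qed simp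
  then show ?thesis using sum_powers_zero[where N = "2 * n" and m = N and F = "\<lambda>N. \<Sum>(a, ps)\<leftarrow>qs. a * symbol_sum \<alpha> (leaf_part N S) w ps x"] zero True by simp
next
  case False
  then have "leaf_part N S = {}" using S card_leaf_edges_le by (fastforce simp: leaf_part_def)
  then have "symbol_sum \<alpha> (leaf_part N S) w ps x = 0" for ps by (simp add: symbol_sum_def)
  then show ?thesis by (induction qs) auto
qed

section \<open>Uniqueness in one order\<close>

lemma expo_mult: "(\<lambda>y. expo p y * expo q y) = expo (p + q)"
  by (simp add: expo_add plus_fun_def)

lemma graph_operator_expo2:
  assumes "\<Gamma> \<in> tree_graphs n 2"
  shows "graph_operator \<alpha> \<Gamma> 2 (nth [expo p, expo q]) x = symbol \<alpha> \<Gamma> (nth [p, q]) x * (expo p x * expo q x)"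
proof -
  have "graph_operator \<alpha> \<Gamma> 2 (nth [expo p, expo q]) x = graph_operator \<alpha> \<Gamma> 2 (\<lambda>j. expo ([p, q] ! j)) x"
    unfolding graph_operator_def prod_vertices by (simp add: numeral_2_eq_2)
  then show ?thesis unfolding graph_operator_expo[OF assms] by (simp add: numeral_2_eq_2)
qed

lemma graph_operator_expo3:
  assumes "\<Gamma> \<in> tree_graphs n 3"
  shows "graph_operator \<alpha> \<Gamma> 3 (nth [expo p, expo q, expo r]) x
    = symbol \<alpha> \<Gamma> (nth [p, q, r]) x * (expo p x * expo q x * expo r x)"
proof -
  have "graph_operator \<alpha> \<Gamma> 3 (nth [expo p, expo q, expo r]) x = graph_operator \<alpha> \<Gamma> 3 (\<lambda>j. expo ([p, q, r] ! j)) x"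
    unfolding graph_operator_def prod_vertices by (simp add: numeral_3_eq_3)
  then show ?thesis unfolding graph_operator_expo[OF assms] by (simp add: numeral_3_eq_3 mult_ac)
qed

text \<open>
  A relation between the symbols at \<open>x\<close> implies the relation between the operators at \<open>x\<close>.
\<close>

lemma operators_from_symbol_sum:
  assumes S: "S \<subseteq> tree_graphs n m"
    and zero: "\<And>ps. length ps = m \<Longrightarrow> symbol_sum \<alpha> S w ps x = 0"
    and \<phi>: "\<And>j. j < m \<Longrightarrow> \<phi> j \<in> smooth_functions"
  shows "(\<Sum>\<Gamma>\<in>S. w \<Gamma> * graph_operator \<alpha> \<Gamma> m \<phi> x) = 0"
proof (rule operators_from_symbols[OF S _ \<phi>])
  fix P
  have "symbol \<alpha> \<Gamma> P x = symbol \<alpha> \<Gamma> (nth (map P [0..<m])) x" if "\<Gamma> \<in> S" for \<Gamma>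
    by (rule symbol_cong) (use S that in auto)
  then have "(\<Sum>\<Gamma>\<in>S. w \<Gamma> * symbol \<alpha> \<Gamma> P x) = symbol_sum \<alpha> S w (map P [0..<m]) x"
    unfolding symbol_sum_def by (intro sum.cong refl) simp
  then show "(\<Sum>\<Gamma>\<in>S. w \<Gamma> * symbol \<alpha> \<Gamma> P x) = 0" by (simp add: zero)
qed

lemma leaf_part_small:
  assumes "S \<subseteq> tree_graphs n m" "n > 0" "N \<le> n"
  shows "symbol_sum \<alpha> (leaf_part N S) w ps x = 0"
proof -
  have "leaf_part N S = {}" using card_leaf_edges[OF _ assms(2)] assms(1,3) by (fastforce simp: leaf_part_def)
  then show ?thesis by (simp add: symbol_sum_def)
qed

context linear_poisson
begin

lemma graph_reps_tree: "graph_reps n m \<subseteq> tree_graphs n m"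
  using graph_repsD(1) by blast

lemma star_coeff_difference:
  "star_coeff \<alpha> W' n f g x - star_coeff \<alpha> W n f g x =
     (\<Sum>\<Gamma>\<in>graph_reps n 2. (W' \<Gamma> - W \<Gamma>) * graph_operator \<alpha> \<Gamma> 2 (nth [f, g]) x)"
  by (simp add: star_coeff_operator sum_subtractf[symmetric] left_diff_distrib)

text \<open>
  Each nonempty homogeneous part is a cocycle that doubling multiplies by \<open>2\<^sup>N \<ge> 8\<close>.
\<close>

lemma two_cocycle_symbol_zero:
  assumes S: "S \<subseteq> tree_graphs n 2" and n: "n \<ge> 2"
    and coc: "\<And>p q r. group_coboundary (\<lambda>p q. symbol_sum \<alpha> S w [p, q] x) p q r = 0"
  shows "symbol_sum \<alpha> S w [p, q] x = 0"
proof -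
  have "symbol_sum \<alpha> (leaf_part N S) w [p, q] x = 0" for N p q
  proof (cases "N \<le> n")
    case True
    then show ?thesis using leaf_part_small[OF S] n by simp
  next
    case False
    let ?B = "\<lambda>p q. symbol_sum \<alpha> (leaf_part N S) w [p, q] x"
    have M: "(2::real) ^ N \<ge> 2 ^ 3" using False n by (intro power_increasing) auto
    show ?thesis
    proof (rule two_cocycle_zero[where B = ?B and M = "2 ^ N"])
      fix p q r :: "'d \<Rightarrow> real"
      have "(\<Sum>(a, ps)\<leftarrow>[(1, [q, r]), (-1, [p + q, r]), (1, [p, q + r]), (-1, [p, q])].
          a * symbol_sum \<alpha> (leaf_part N S) w ps x) = 0"
      proof (rule parts_vanish[OF S])
        fix t :: nat
        show "(\<Sum>(a, ps)\<leftarrow>[(1, [q, r]), (-1, [p + q, r]), (1, [p, q + r]), (-1, [p, q])].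
            a * symbol_sum \<alpha> S w (map (dilate t) ps) x) = 0"
          using coc[of "dilate t p" "dilate t q" "dilate t r"] by (simp add: group_coboundary_def dilate_add)
      qed auto
      then show "group_coboundary ?B p q r = 0" by (simp add: group_coboundary_def)
    next
      fix p :: "'d \<Rightarrow> real"
      have "symbol \<alpha> \<Gamma> (nth [p, p]) x = 0" if "\<Gamma> \<in> S" for \<Gamma>
      proof -
        have g: "\<Gamma> \<in> tree_graphs n 2" using S that by auto
        have "symbol \<alpha> \<Gamma> (nth [p, p]) x = symbol \<alpha> \<Gamma> (\<lambda>j. p) x"
          by (rule symbol_cong[OF g]) (auto simp: less_Suc_eq numeral_2_eq_2)
        then show ?thesis using symbol_diagonal[OF g] n by simp
      qed
      then show "?B p p = 0" unfolding symbol_sum_def leaf_part_def by (intro sum.neutral) auto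
    next
      fix p q :: "'d \<Rightarrow> real"
      show "?B (p + p) (q + q) = 2 ^ N * ?B p q"
        using symbol_sum_part_dilate[OF S, of "[p, q]" \<alpha> N w 2 x] by (simp add: dilate_2)
    qed (use M in auto)
  qed
  then show ?thesis unfolding symbol_sum_parts[OF S] by simp
qed

text \<open>
  If two products agree below order \<open>n\<close> and are associative in order \<open>n\<close>, their difference in order \<open>n\<close>
  is a Hochschild 2-cocycle; evaluated on exponentials, a group 2-cocycle.
\<close>

lemma star_coeff_unique_step:
  assumes n: "n \<ge> 2" and W: "deforms_product W"
    and eq: "\<And>k f g. k < n \<Longrightarrow> f \<in> smooth_functions \<Longrightarrow> g \<in> smooth_functions \<Longrightarrow> star_coeff \<alpha> W' k f g = star_coeff \<alpha> W k f g"
    and moyal: "moyal_equation \<alpha> W n" "moyal_equation \<alpha> W' n"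
    and f: "f \<in> smooth_functions" and g: "g \<in> smooth_functions"
  shows "star_coeff \<alpha> W' n f g = star_coeff \<alpha> W n f g"
proof
  fix x
  let ?w = "\<lambda>\<Gamma>. W' \<Gamma> - W \<Gamma>" and ?S = "graph_reps n 2"
  let ?d = "\<lambda>p q. symbol_sum \<alpha> ?S ?w [p, q] x"
  have D: "star_coeff \<alpha> W' n (expo p) (expo q) x - star_coeff \<alpha> W n (expo p) (expo q) x = ?d p q * (expo p x * expo q x)" for p q
    unfolding star_coeff_difference symbol_sum_def sum_distrib_right
    by (intro sum.cong refl) (simp add: graph_operator_expo2[OF graph_repsD(1)])
  have coc: "group_coboundary ?d p q r = 0" for p q r
  proof -
    have "associator_coeff \<alpha> W' n (expo p) (expo q) (expo r) x = 0" "associator_coeff \<alpha> W n (expo p) (expo q) (expo r) x = 0"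
      using moyal unfolding moyal_iff by auto
    then have "?d (p + q) r * (expo (p + q) x * expo r x) - ?d p (q + r) * (expo p x * expo (q + r) x)
      + ?d p q * (expo p x * expo q x) * expo r x - expo p x * (?d q r * (expo q x * expo r x)) = 0"
      using associator_change[of n W W' "expo p" "expo q" "expo r" x] n W eq by (simp add: D expo_mult)
    moreover have "expo (p + q) x = expo p x * expo q x" "expo (q + r) x = expo q x * expo r x"
      by (simp_all add: expo_add plus_fun_def)
    ultimately have "(?d (p + q) r - ?d p (q + r) + ?d p q - ?d q r) * (expo p x * expo q x * expo r x) = 0"
      by (simp add: algebra_simps)
    then show ?thesis by (simp add: group_coboundary_def)
  qed
  have "(\<Sum>\<Gamma>\<in>?S. ?w \<Gamma> * graph_operator \<alpha> \<Gamma> 2 (nth [f, g]) x) = 0"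
  proof (rule operators_from_symbol_sum[OF graph_reps_tree])
    fix ps :: "('d \<Rightarrow> real) list" assume "length ps = 2"
    then obtain p q where "ps = [p, q]" by (auto simp: length_Suc_conv numeral_2_eq_2)
    then show "symbol_sum \<alpha> ?S ?w ps x = 0" using two_cocycle_symbol_zero[OF graph_reps_tree n coc] by simp
  qed (use f g in \<open>auto simp: less_Suc_eq numeral_2_eq_2\<close>)
  then show "star_coeff \<alpha> W' n f g x = star_coeff \<alpha> W n f g x" using star_coeff_difference[of W' n f g x W] by simp
qed

section \<open>Removing the associator of one order\<close>

lemma bracket_skew: "bracket \<alpha> g f x = - bracket \<alpha> f g x"
proof -
  have "bracket \<alpha> g f x = (\<Sum>j\<in>UNIV. \<Sum>i\<in>UNIV. \<alpha> i j x * pd i g x * pd j f x)"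
    unfolding bracket_def by (rule sum.swap)
  also have "\<dots> = (\<Sum>j\<in>UNIV. \<Sum>i\<in>UNIV. - (\<alpha> j i x * pd j f x * pd i g x))"
    by (intro sum.cong refl) (subst skew, simp)
  finally show ?thesis by (simp add: bracket_def sum_negf)
qed

lemma bracket_minus_right:
  assumes "u \<in> smooth_functions" shows "bracket \<alpha> f (\<lambda>y. - u y) x = - bracket \<alpha> f u x"
  using pd_cmult[OF assms, of _ "-1"] by (simp add: bracket_def sum_negf)

lemma bracket_smooth:
  assumes "f \<in> smooth_functions" "g \<in> smooth_functions" shows "bracket \<alpha> f g \<in> smooth_functions"
  unfolding bracket_def using assms by (intro smooth_sum smooth_mult) auto

definition starts_with_bracket :: "(graph \<Rightarrow> real) \<Rightarrow> bool" where
  "starts_with_bracket W \<longleftrightarrow> (\<forall>f\<in>smooth_functions. \<forall>g\<in>smooth_functions. star_coeff \<alpha> W 1 f g = bracket \<alpha> f g)"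

text \<open>
  In the associator of order 2, the terms with the coefficient of order 2 form a coboundary, and the
  remaining term \<open>{{f, g}, h} - {f, {g, h}}\<close> is \<open>{g, {h, f}}\<close> by the Jacobi identity, whose alternation is
  twice the Jacobiator.
\<close>

lemma associator_alternation:
  assumes W: "deforms_product W" "starts_with_bracket W"
    and s: "f \<in> smooth_functions" "g \<in> smooth_functions" "h \<in> smooth_functions"
  shows "alternation (\<lambda>f g h. associator_coeff \<alpha> W 2 f g h x) f g h = 0"
proof -
  let ?B = "star_coeff \<alpha> W 2" and ?b = "bracket \<alpha>"
  have B0: "star_coeff \<alpha> W 0 u v = (\<lambda>y. u y * v y)" and B1: "star_coeff \<alpha> W (Suc 0) u v = ?b u v"
    if "u \<in> smooth_functions" "v \<in> smooth_functions" for u v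
    using W that by (simp_all add: deforms_product_def starts_with_bracket_def)
  have J: "?b f (?b g h) x + ?b g (?b h f) x + ?b h (?b f g) x = 0"
    if "f \<in> smooth_functions" "g \<in> smooth_functions" "h \<in> smooth_functions" for f g h
  proof -
    have "?b f (?b g h) + ?b g (?b h f) + ?b h (?b f g) = 0"
      using poisson that unfolding poisson_structure_def by blast
    from fun_cong[OF this, of x] show ?thesis by (simp add: plus_fun_def zero_fun_def)
  qed
  have swap: "?b f (?b h g) x = - ?b f (?b g h) x" if "g \<in> smooth_functions" "h \<in> smooth_functions" for f g h
  proof -
    have "?b h g = (\<lambda>y. - ?b g h y)" using bracket_skew by blast
    then show ?thesis by (simp add: bracket_minus_right bracket_smooth that)
  qed
  have A: "associator_coeff \<alpha> W 2 f g h x = ?b g (?b h f) x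
      + (?B (\<lambda>y. f y * g y) h x - ?B f (\<lambda>y. g y * h y) x + ?B f g x * h x - f x * ?B g h x)"
    if "f \<in> smooth_functions" "g \<in> smooth_functions" "h \<in> smooth_functions" for f g h
  proof -
    have "?b (?b f g) h x = - ?b h (?b f g) x" by (rule bracket_skew)
    then show ?thesis using J[OF that]
      by (simp add: associator_coeff_def atMost_Suc numeral_2_eq_2 B0 B1 that star_coeff_smooth bracket_smooth)
  qed
  show ?thesis
    unfolding alternation_def using s J[OF s] swap[OF s(1,2), of h] swap[OF s(2,3), of f] swap[OF s(1,3), of g]
    by (simp add: A mult.commute)
qed

text \<open>
  Combinations of symbols of graphs whose coefficients do not depend on the point \<open>x\<close>. The cocycles are
  solved for each \<open>x\<close> separately, but weights have to serve for all \<open>x\<close> at once.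
\<close>

definition graph_span :: "nat \<Rightarrow> (('d \<Rightarrow> real) \<Rightarrow> ('d \<Rightarrow> real) \<Rightarrow> real^'d \<Rightarrow> real) \<Rightarrow> bool" where
  "graph_span n G \<longleftrightarrow> (\<exists>w. \<forall>p q x. G p q x = symbol_sum \<alpha> (tree_graphs n 2) w [p, q] x)"

lemma graph_span_sum:
  assumes "\<And>a. a \<in> A \<Longrightarrow> graph_span n (G a)"
  shows "graph_span n (\<lambda>p q x. \<Sum>a\<in>A. b a * G a p q x)"
proof -
  \<comment> \<open>The coefficients are chosen for each \<open>a\<close>, uniformly in \<open>p\<close>, \<open>q\<close> and \<open>x\<close>.\<close>
  define w where "w a = (SOME w. \<forall>p q x. G a p q x = symbol_sum \<alpha> (tree_graphs n 2) w [p, q] x)" for a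
  have w: "G a p q x = symbol_sum \<alpha> (tree_graphs n 2) (w a) [p, q] x" if "a \<in> A" for a p q x
  proof -
    have "\<forall>p q x. G a p q x = symbol_sum \<alpha> (tree_graphs n 2) (w a) [p, q] x"
      unfolding w_def by (rule someI_ex[OF assms[OF that, unfolded graph_span_def]])
    then show ?thesis by blast
  qed
  have "(\<Sum>a\<in>A. b a * G a p q x) = symbol_sum \<alpha> (tree_graphs n 2) (\<lambda>\<Gamma>. \<Sum>a\<in>A. b a * w a \<Gamma>) [p, q] x" for p q x
  proof -
    have "(\<Sum>a\<in>A. b a * G a p q x) = (\<Sum>a\<in>A. \<Sum>\<Gamma>\<in>tree_graphs n 2. b a * w a \<Gamma> * symbol \<alpha> \<Gamma> (nth [p, q]) x)"
      by (intro sum.cong refl) (simp add: w symbol_sum_def sum_distrib_left mult.assoc)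
    also have "\<dots> = symbol_sum \<alpha> (tree_graphs n 2) (\<lambda>\<Gamma>. \<Sum>a\<in>A. b a * w a \<Gamma>) [p, q] x"
      unfolding symbol_sum_def sum_distrib_right by (rule sum.swap)
    finally show ?thesis .
  qed
  then show ?thesis unfolding graph_span_def by blast
qed

lemma graph_span_cmult: "graph_span n G \<Longrightarrow> graph_span n (\<lambda>p q x. b * G p q x)"
  using graph_span_sum[of "{()}" n "\<lambda>_. G" "\<lambda>_. b"] by simp

lemma graph_span_add: "graph_span n G \<Longrightarrow> graph_span n H \<Longrightarrow> graph_span n (\<lambda>p q x. G p q x + H p q x)"
  using graph_span_sum[of UNIV n "\<lambda>b. if b then G else H" "\<lambda>_. 1"] by (simp add: UNIV_bool add.commute)

lemma graph_span_diff: "graph_span n G \<Longrightarrow> graph_span n H \<Longrightarrow> graph_span n (\<lambda>p q x. G p q x - H p q x)"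
  using graph_span_add[OF _ graph_span_cmult[of n H "-1"], of G] by simp

lemma graph_span_symbol:
  assumes "T \<in> tree_graphs n 2"
  shows "graph_span n (\<lambda>p q. symbol \<alpha> T (nth [p, q]))"
proof -
  have "symbol \<alpha> T (nth [p, q]) x = symbol_sum \<alpha> (tree_graphs n 2) (\<lambda>\<Gamma>. if \<Gamma> = T then 1 else 0) [p, q] x" for p q x
    using assms by (simp add: symbol_sum_def finite_tree_graphs if_distrib[of "\<lambda>z. z * _"] cong: if_cong)
  then show ?thesis unfolding graph_span_def by blast
qed

definition lin :: "real \<times> real \<Rightarrow> ('d \<Rightarrow> real) \<Rightarrow> ('d \<Rightarrow> real) \<Rightarrow> 'd \<Rightarrow> real" where
  "lin a p q = (\<lambda>i. fst a * p i + snd a * q i)"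

text \<open>
  The primitive of a 3-cocycle is built from its values at linear combinations of two covectors.
\<close>

definition substitution_closed :: "nat \<Rightarrow> (('d \<Rightarrow> real) \<Rightarrow> ('d \<Rightarrow> real) \<Rightarrow> ('d \<Rightarrow> real) \<Rightarrow> real^'d \<Rightarrow> real) \<Rightarrow> bool" where
  "substitution_closed n E \<longleftrightarrow> (\<forall>a b c. graph_span n (\<lambda>p q. E (lin a p q) (lin b p q) (lin c p q)))"

lemma symbol_sum_substitution_closed:
  assumes S: "S \<subseteq> tree_graphs n 3"
  shows "substitution_closed n (\<lambda>p q r. symbol_sum \<alpha> S w [p, q, r])"
  unfolding substitution_closed_def
proof (intro allI)
  fix a b c :: "real \<times> real"
  define A where "A j k = (if k = 0 then fst ([a, b, c] ! j) else snd ([a, b, c] ! j))" for j k :: nat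
  have "graph_span n (\<lambda>p q. symbol \<alpha> \<Gamma> (nth [lin a p q, lin b p q, lin c p q]))" if "\<Gamma> \<in> S" for \<Gamma>
  proof -
    have g: "\<Gamma> \<in> tree_graphs n 3" using S that by auto
    have "symbol \<alpha> \<Gamma> (nth [lin a p q, lin b p q, lin c p q]) x
      = (\<Sum>l \<in> leaf_edges \<Gamma> \<rightarrow>\<^sub>E {..<2}. (\<Prod>e\<in>leaf_edges \<Gamma>. A (leaf_label \<Gamma> e) (l e)) * symbol \<alpha> (rebind \<Gamma> l) (nth [p, q]) x)" for p q x
      unfolding symbol_substitution[symmetric]
      by (rule symbol_cong[OF g]) (auto simp: less_Suc_eq numeral_2_eq_2 numeral_3_eq_3 A_def lin_def)
    moreover have "graph_span n (\<lambda>p q x. \<Sum>l \<in> leaf_edges \<Gamma> \<rightarrow>\<^sub>E {..<2}.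
        (\<Prod>e\<in>leaf_edges \<Gamma>. A (leaf_label \<Gamma> e) (l e)) * symbol \<alpha> (rebind \<Gamma> l) (nth [p, q]) x)"
      by (intro graph_span_sum graph_span_symbol rebind_tree[OF g]) auto
    ultimately show ?thesis by (simp only: graph_span_def)
  qed
  then have "graph_span n (\<lambda>p q x. \<Sum>\<Gamma>\<in>S. w \<Gamma> * symbol \<alpha> \<Gamma> (nth [lin a p q, lin b p q, lin c p q]) x)"
    by (rule graph_span_sum)
  then show "graph_span n (\<lambda>p q. symbol_sum \<alpha> S w [lin a p q, lin b p q, lin c p q])"
    by (simp add: symbol_sum_def[abs_def])
qed

lemma lambda_square_closed:
  assumes "substitution_closed n E"
  shows "substitution_closed n (\<lambda>p q r x. lambda_square (\<lambda>p q r. E p q r x) p q r)"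
  using assms unfolding substitution_closed_def lambda_square_def
  by (intro allI graph_span_add graph_span_diff graph_span_cmult) auto

lemma doubling_homotopy_span:
  assumes "substitution_closed n E"
  shows "graph_span n (\<lambda>p q x. doubling_homotopy (\<lambda>p q r. E p q r x) p q)"
proof -
  have l: "lin (1, 0) p q = p" "lin (0, 1) p q = q" "lin (1, 1) p q = p + q" "lin (0, 2) p q = q + q" for p q
    by (auto simp: lin_def plus_fun_def)
  note s = assms[unfolded substitution_closed_def, rule_format]
  show ?thesis unfolding doubling_homotopy_def
    using s[of "(1, 0)" "(0, 1)" "(0, 1)"] s[of "(0, 1)" "(1, 0)" "(0, 1)"] s[of "(1, 0)" "(0, 1)" "(1, 1)"] s[of "(1, 0)" "(1, 0)" "(0, 2)"]
    unfolding l by (intro graph_span_add graph_span_diff)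
qed

text \<open>
  The primitive is found for each homogeneous part separately, as it depends on the degree.
\<close>

lemma three_cocycle_symbol_coboundary:
  assumes S: "S \<subseteq> tree_graphs n 3" and n: "n \<ge> 2"
    and coc: "\<And>x. group_cocycle (\<lambda>p q r. symbol_sum \<alpha> S w [p, q, r] x)"
    and alt: "\<And>p q r x. n = 2 \<Longrightarrow> alternation (\<lambda>p q r. symbol_sum \<alpha> S w [p, q, r] x) p q r = 0"
  obtains v where "\<And>p q r x. group_coboundary (\<lambda>p q. symbol_sum \<alpha> (tree_graphs n 2) v [p, q] x) p q r = symbol_sum \<alpha> S w [p, q, r] x"
proof -
  let ?E = "\<lambda>N x p q r. symbol_sum \<alpha> (leaf_part N S) w [p, q, r] x"
  have cocN: "group_cocycle (?E N x)" for N x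
    unfolding group_cocycle_def
  proof (intro allI)
    fix p q r s :: "'d \<Rightarrow> real"
    have "(\<Sum>(a, ps)\<leftarrow>[(1, [q, r, s]), (-1, [p + q, r, s]), (1, [p, q + r, s]), (-1, [p, q, r + s]), (1, [p, q, r])].
        a * symbol_sum \<alpha> (leaf_part N S) w ps x) = 0"
    proof (rule parts_vanish[OF S])
      fix t :: nat
      show "(\<Sum>(a, ps)\<leftarrow>[(1, [q, r, s]), (-1, [p + q, r, s]), (1, [p, q + r, s]), (-1, [p, q, r + s]), (1, [p, q, r])].
        a * symbol_sum \<alpha> S w (map (dilate t) ps) x) = 0"
        using coc[of x, unfolded group_cocycle_def, rule_format, where p = "dilate t p" and q = "dilate t q" and r = "dilate t r" and s = "dilate t s"]
        by (simp add: dilate_add)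
    qed auto
    then show "?E N x q r s - ?E N x (p + q) r s + ?E N x p (q + r) s - ?E N x p q (r + s) + ?E N x p q r = 0" by simp
  qed
  have scaleN: "?E N x (p + p) (q + q) (r + r) = 2 ^ N * ?E N x p q r" for N x p q r
    using symbol_sum_part_dilate[OF S, of "[p, q, r]" \<alpha> N w 2 x] by (simp add: dilate_2)
  have altN: "alternation (?E N x) p q r = 0" if N: "N \<ge> 3" for N x p q r
  proof (cases "N = 3")
    case False
    then have "(2::real) ^ N \<ge> 2 ^ 4" using N by (intro power_increasing) auto
    then have "(2::real) ^ N \<noteq> 8" by auto
    then show ?thesis by (rule alternation_cocycle_zero[where E = "?E N x" and M = "2 ^ N", OF cocN scaleN])
  next
    case True
    show ?thesis
    proof (cases "n = 2")
      case False
      then have "symbol_sum \<alpha> (leaf_part N S) w ps x = 0" for ps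
        using True n by (intro leaf_part_small[OF S]) auto
      then show ?thesis by (simp add: alternation_def)
    next
      case n2: True
      have "(\<Sum>(a, ps)\<leftarrow>[(1, [p, q, r]), (-1, [q, p, r]), (1, [q, r, p]), (-1, [r, q, p]), (1, [r, p, q]), (-1, [p, r, q])].
          a * symbol_sum \<alpha> (leaf_part N S) w ps x) = 0"
      proof (rule parts_vanish[OF S])
        fix t :: nat
        show "(\<Sum>(a, ps)\<leftarrow>[(1, [p, q, r]), (-1, [q, p, r]), (1, [q, r, p]), (-1, [r, q, p]), (1, [r, p, q]), (-1, [p, r, q])].
          a * symbol_sum \<alpha> S w (map (dilate t) ps) x) = 0"
          using alt[OF n2, of x "dilate t p" "dilate t q" "dilate t r"] by (simp add: alternation_def)
      qed auto
      then show ?thesis by (simp add: alternation_def)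
    qed
  qed
  \<comment> \<open>The denominators are nonzero since \<open>N \<ge> 3\<close>; smaller parts are empty.\<close>
  define C where "C N p q x = (doubling_homotopy (lambda_square (?E N x)) p q + (2 ^ N - 6) * doubling_homotopy (?E N x) p q)
      / ((2 ^ N - 2) * (2 ^ N - 4))" for N p q x
  have CN: "group_coboundary (\<lambda>p q. C N p q x) p q r = ?E N x p q r" if N: "N \<ge> 3" for N p q r x
  proof -
    have "(2::real) ^ N \<ge> 2 ^ 3" using N by (intro power_increasing) auto
    then have M: "(2::real) ^ N \<noteq> 2" "(2::real) ^ N \<noteq> 4" by auto
    show ?thesis unfolding C_def
      by (rule three_cocycle_coboundary[where E = "?E N x" and M = "2 ^ N", OF cocN scaleN M altN[OF N]])
  qed
  have spanN: "graph_span n (\<lambda>p q x. C N p q x)" for N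
  proof -
    have S': "leaf_part N S \<subseteq> tree_graphs n 3" using S by (auto simp: leaf_part_def)
    note cl = symbol_sum_substitution_closed[OF S', of w]
    have "graph_span n (\<lambda>p q x. (1 / ((2 ^ N - 2) * (2 ^ N - 4))) *
      (doubling_homotopy (lambda_square (?E N x)) p q + (2 ^ N - 6) * doubling_homotopy (?E N x) p q))"
      using doubling_homotopy_span[OF cl] doubling_homotopy_span[OF lambda_square_closed[OF cl]]
      by (intro graph_span_cmult graph_span_add) auto
    then show ?thesis unfolding C_def by simp
  qed
  have "graph_span n (\<lambda>p q x. \<Sum>N\<in>{3..2 * n}. 1 * C N p q x)" by (intro graph_span_sum spanN)
  then obtain v where v: "\<And>p q x. (\<Sum>N\<in>{3..2 * n}. C N p q x) = symbol_sum \<alpha> (tree_graphs n 2) v [p, q] x"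
    unfolding graph_span_def by auto
  have "group_coboundary (\<lambda>p q. symbol_sum \<alpha> (tree_graphs n 2) v [p, q] x) p q r = symbol_sum \<alpha> S w [p, q, r] x" for p q r x
  proof -
    have "group_coboundary (\<lambda>p q. symbol_sum \<alpha> (tree_graphs n 2) v [p, q] x) p q r
      = (\<Sum>N\<in>{3..2 * n}. group_coboundary (\<lambda>p q. C N p q x) p q r)"
      by (simp add: v[symmetric] group_coboundary_def sum.distrib sum_subtractf)
    also have "\<dots> = (\<Sum>N\<in>{3..2 * n}. ?E N x p q r)" by (intro sum.cong refl CN) auto
    also have "\<dots> = (\<Sum>N\<le>2 * n. ?E N x p q r)"
    proof (rule sum.mono_neutral_left)
      have "?E N x p q r = 0" if "N \<le> n" for N
        using n that by (intro leaf_part_small[OF S]) auto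
      then show "\<forall>N\<in>{..2 * n} - {3..2 * n}. ?E N x p q r = 0" using n by auto
    qed auto
    finally show ?thesis unfolding symbol_sum_parts[OF S] .
  qed
  then show ?thesis using that by blast
qed

text \<open>
  The associator of order \<open>n\<close> is a cocycle, hence the coboundary of a combination of graphs; adding
  this combination to the weights of order \<open>n\<close> cancels it.
\<close>

lemma weights_correction_step:
  assumes n: "n \<ge> 2" and Ww: "W \<in> weights" and W: "deforms_product W" "starts_with_bracket W"
    and below: "\<And>k. k < n \<Longrightarrow> moyal_equation \<alpha> W k"
  obtains W' where "W' \<in> weights" "\<And>\<Gamma>. length \<Gamma> \<noteq> n \<Longrightarrow> W' \<Gamma> = W \<Gamma>" "moyal_equation \<alpha> W' n"
proof -
  let ?S = "graph_reps n 3" and ?wc = "weight_coproduct W"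
  have A: "associator_coeff \<alpha> V n (expo p) (expo q) (expo r) x
      = symbol_sum \<alpha> ?S (weight_coproduct V) [p, q, r] x * (expo p x * expo q x * expo r x)" for V p q r x
    by (simp add: associator_moyal symbol_sum_def sum_distrib_right graph_op_operator numeral_3_eq_3
        graph_operator_expo3[OF graph_repsD(1), unfolded numeral_3_eq_3] mult.assoc)
  have e: "expo (p + q) x = expo p x * expo q x" for p q :: "'d \<Rightarrow> real" and x by (simp add: expo_add plus_fun_def)
  have coc: "group_cocycle (\<lambda>p q r. symbol_sum \<alpha> ?S ?wc [p, q, r] x)" for x
    unfolding group_cocycle_def
  proof (intro allI)
    fix p q r s :: "'d \<Rightarrow> real"
    let ?R = "\<lambda>p q r. symbol_sum \<alpha> ?S ?wc [p, q, r] x"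
    have "(?R q r s - ?R (p + q) r s + ?R p (q + r) s - ?R p q (r + s) + ?R p q r) * (expo p x * expo q x * expo r x * expo s x) = 0"
      using associator_cocycle[OF W(1) below smooth_expo smooth_expo smooth_expo smooth_expo, of n p x q r s]
      by (simp add: A expo_mult e algebra_simps)
    then show "?R q r s - ?R (p + q) r s + ?R p (q + r) s - ?R p q (r + s) + ?R p q r = 0" by simp
  qed
  have alt: "alternation (\<lambda>p q r. symbol_sum \<alpha> ?S ?wc [p, q, r] x) p q r = 0" if n2: "n = 2" for p q r x
  proof -
    have "alternation (\<lambda>p q r. symbol_sum \<alpha> ?S ?wc [p, q, r] x) p q r * (expo p x * expo q x * expo r x) = 0"
      using associator_alternation[OF W smooth_expo smooth_expo smooth_expo, of x p q r] A[of W _ _ _ x]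
      by (simp add: alternation_def n2 algebra_simps)
    then show ?thesis by simp
  qed
  obtain v where v: "\<And>p q r x. group_coboundary (\<lambda>p q. symbol_sum \<alpha> (tree_graphs n 2) v [p, q] x) p q r = symbol_sum \<alpha> ?S ?wc [p, q, r] x"
    using three_cocycle_symbol_coboundary[OF graph_reps_tree n coc alt] by blast
  obtain V where V: "V \<in> weights" "\<And>F. F \<in> weights \<Longrightarrow> (\<Sum>\<Gamma>\<in>graph_reps n 2. V \<Gamma> * F \<Gamma>) = (\<Sum>T\<in>tree_graphs n 2. v T * F T)"
    using weights_spanning[OF finite_tree_graphs subset_refl, of n 2 v] by blast
  define W' where "W' \<Gamma> = (if length \<Gamma> = n then W \<Gamma> + V \<Gamma> else W \<Gamma>)" for \<Gamma>
  have W'w: "W' \<in> weights"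
    using Ww V(1) unfolding weights_def W'_def by (auto simp: oriented_iso_length algebra_simps)
  have eq: "star_coeff \<alpha> W' k f g = star_coeff \<alpha> W k f g" if "k < n" for k f g
    using that unfolding star_coeff_def W'_def
    by (intro ext sum.cong refl) (auto simp: graph_reps_length)
  let ?C = "\<lambda>p q x. symbol_sum \<alpha> (tree_graphs n 2) v [p, q] x"
  have D: "star_coeff \<alpha> W' n (expo p) (expo q) x - star_coeff \<alpha> W n (expo p) (expo q) x = ?C p q x * (expo p x * expo q x)" for p q x
  proof -
    have "star_coeff \<alpha> W' n (expo p) (expo q) x - star_coeff \<alpha> W n (expo p) (expo q) x
      = (\<Sum>\<Gamma>\<in>graph_reps n 2. V \<Gamma> * graph_operator \<alpha> \<Gamma> 2 (nth [expo p, expo q]) x)"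
      unfolding star_coeff_difference by (intro sum.cong refl) (simp add: W'_def graph_reps_length)
    also have "\<dots> = (\<Sum>T\<in>tree_graphs n 2. v T * graph_operator \<alpha> T 2 (nth [expo p, expo q]) x)"
      by (intro V(2) graph_operator_weights) (auto simp: less_Suc_eq numeral_2_eq_2)
    also have "\<dots> = ?C p q x * (expo p x * expo q x)"
      unfolding symbol_sum_def sum_distrib_right by (intro sum.cong refl) (simp add: graph_operator_expo2)
    finally show ?thesis .
  qed
  have zero: "symbol_sum \<alpha> ?S (weight_coproduct W') [p, q, r] x = 0" for p q r x
  proof -
    have "associator_coeff \<alpha> W' n (expo p) (expo q) (expo r) x =
      (symbol_sum \<alpha> ?S ?wc [p, q, r] x + ?C (p + q) r x - ?C p (q + r) x + ?C p q x - ?C q r x) * (expo p x * expo q x * expo r x)"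
      using associator_change[of n W W' "expo p" "expo q" "expo r" x] n W(1) eq
      by (simp add: A D expo_mult e algebra_simps)
    also have "\<dots> = 0" using v[of x p q r] by (simp add: group_coboundary_def)
    finally show ?thesis using A[of W' p q r x] by simp
  qed
  have "moyal_equation \<alpha> W' n" unfolding moyal_equation_def
  proof (intro ballI allI)
    fix f g h :: "real^'d \<Rightarrow> real" and x assume s: "f \<in> smooth_functions" "g \<in> smooth_functions" "h \<in> smooth_functions"
    have "(\<Sum>\<Gamma>\<in>?S. weight_coproduct W' \<Gamma> * graph_operator \<alpha> \<Gamma> 3 (nth [f, g, h]) x) = 0"
    proof (rule operators_from_symbol_sum[OF graph_reps_tree])
      fix ps :: "('d \<Rightarrow> real) list" assume "length ps = 3"
      then obtain p q r where "ps = [p, q, r]" by (auto simp: length_Suc_conv numeral_3_eq_3)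
      then show "symbol_sum \<alpha> ?S (weight_coproduct W') ps x = 0" using zero by simp
    qed (use s in \<open>auto simp: less_Suc_eq numeral_3_eq_3\<close>)
    then show "(\<Sum>\<Gamma>\<in>?S. weight_coproduct W' \<Gamma> * graph_op \<alpha> \<Gamma> [f, g, h] x) = 0"
      by (simp add: graph_op_operator numeral_3_eq_3)
  qed
  then show ?thesis using that[of W'] W'w by (simp add: W'_def)
qed

end

section \<open>Associativity on formal series\<close>

lemma star_coeff_cong:
  "(\<And>\<Gamma>. \<Gamma> \<in> graph_reps n 2 \<Longrightarrow> W \<Gamma> = W' \<Gamma>) \<Longrightarrow> star_coeff \<alpha> W n f g = star_coeff \<alpha> W' n f g"
  unfolding star_coeff_def by (intro ext sum.cong refl) simp

lemma moyal_equation_cong: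
  assumes "\<And>\<Gamma>. length \<Gamma> \<le> n \<Longrightarrow> W \<Gamma> = W' \<Gamma>"
  shows "moyal_equation \<alpha> W n \<longleftrightarrow> moyal_equation \<alpha> W' n"
proof -
  have "weight_coproduct W \<Gamma> = weight_coproduct W' \<Gamma>" if "\<Gamma> \<in> graph_reps n 3" for \<Gamma>
    unfolding weight_coproduct_def graph_reps_length[OF that]
    by (intro sum.cong refl) (simp add: assms graph_reps_length)
  then show ?thesis by (simp add: moyal_equation_def)
qed

text \<open>
  In \<open>(F \<star> G) \<star> H\<close>, sum first over the orders \<open>c, d, e\<close> of the factors and then over the order \<open>l\<close> of the inner
  product.
\<close>

lemma quadruple_sum_left:
  fixes F :: "nat \<Rightarrow> nat \<Rightarrow> nat \<Rightarrow> nat \<Rightarrow> real"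
  shows "(\<Sum>a\<le>n. \<Sum>b\<le>n - a. \<Sum>c\<le>a. \<Sum>d\<le>a - c. F c d b (a - c - d)) =
    (\<Sum>(c, d, e)\<in>{(c, d, e). c + d + e \<le> n}. \<Sum>l\<le>n - c - d - e. F c d e l)"
proof -
  have fin: "finite {(c, d, e). c + d + e \<le> n}"
    by (rule finite_subset[of _ "{..n} \<times> {..n} \<times> {..n}"]) auto
  have "(\<Sum>a\<le>n. \<Sum>b\<le>n - a. \<Sum>c\<le>a. \<Sum>d\<le>a - c. F c d b (a - c - d)) =
    (\<Sum>(a, b, c, d)\<in>Sigma {..n} (\<lambda>a. Sigma {..n - a} (\<lambda>b. Sigma {..a} (\<lambda>c. {..a - c}))). F c d b (a - c - d))"
    by (simp add: sum.Sigma)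
  also have "\<dots> = (\<Sum>((c, d, e), l)\<in>Sigma {(c, d, e). c + d + e \<le> n} (\<lambda>(c, d, e). {..n - c - d - e}). F c d e l)"
    by (rule sum.reindex_bij_witness[of _ "\<lambda>((c, d, e), l). (c + d + l, e, c, d)" "\<lambda>(a, b, c, d). ((c, d, b), a - c - d)"]) auto
  also have "\<dots> = (\<Sum>(c, d, e)\<in>{(c, d, e). c + d + e \<le> n}. \<Sum>l\<le>n - c - d - e. F c d e l)"
    by (subst sum.Sigma[OF fin, symmetric]) (auto simp: split_def)
  finally show ?thesis .
qed

lemma quadruple_sum_right:
  fixes F :: "nat \<Rightarrow> nat \<Rightarrow> nat \<Rightarrow> nat \<Rightarrow> real"
  shows "(\<Sum>a\<le>n. \<Sum>b\<le>n - a. \<Sum>d\<le>b. \<Sum>e\<le>b - d. F a d e (b - d - e)) =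
    (\<Sum>(c, d, e)\<in>{(c, d, e). c + d + e \<le> n}. \<Sum>l\<le>n - c - d - e. F c d e l)"
proof -
  have fin: "finite {(c, d, e). c + d + e \<le> n}"
    by (rule finite_subset[of _ "{..n} \<times> {..n} \<times> {..n}"]) auto
  have "(\<Sum>a\<le>n. \<Sum>b\<le>n - a. \<Sum>d\<le>b. \<Sum>e\<le>b - d. F a d e (b - d - e)) =
    (\<Sum>(a, b, d, e)\<in>Sigma {..n} (\<lambda>a. Sigma {..n - a} (\<lambda>b. Sigma {..b} (\<lambda>d. {..b - d}))). F a d e (b - d - e))"
    by (simp add: sum.Sigma)
  also have "\<dots> = (\<Sum>((c, d, e), l)\<in>Sigma {(c, d, e). c + d + e \<le> n} (\<lambda>(c, d, e). {..n - c - d - e}). F c d e l)"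
    by (rule sum.reindex_bij_witness[of _ "\<lambda>((c, d, e), l). (c, d + e + l, d, e)" "\<lambda>(a, b, d, e). ((a, d, e), b - d - e)"]) auto
  also have "\<dots> = (\<Sum>(c, d, e)\<in>{(c, d, e). c + d + e \<le> n}. \<Sum>l\<le>n - c - d - e. F c d e l)"
    by (subst sum.Sigma[OF fin, symmetric]) (auto simp: split_def)
  finally show ?thesis .
qed

lemma fps_const_smooth: "f \<in> smooth_functions \<Longrightarrow> fps_const f \<in> smooth_series"
  by (simp add: smooth_series_def zero_fun_def)

context linear_poisson
begin

lemma star_product_nth:
  assumes "F \<in> smooth_series" "G \<in> smooth_series"
  shows "fps_nth (star_product \<alpha> W F G) n =
    (\<lambda>x. \<Sum>a\<le>n. \<Sum>b\<le>n - a. star_coeff \<alpha> W (n - a - b) (fps_nth F a) (fps_nth G b) x)"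
  using assms by (simp add: star_product_def fun_eq_iff sum_fun_apply)

lemma star_product_smooth:
  assumes "F \<in> smooth_series" "G \<in> smooth_series"
  shows "star_product \<alpha> W F G \<in> smooth_series"
  using assms star_product_nth[OF assms] unfolding smooth_series_def
  by (auto intro!: smooth_sum star_coeff_smooth)

lemma star_product_const:
  assumes "f \<in> smooth_functions" "g \<in> smooth_functions"
  shows "fps_nth (star_product \<alpha> W (fps_const f) (fps_const g)) n = star_coeff \<alpha> W n f g"
proof
  fix x
  have z: "star_coeff \<alpha> W k 0 v x = 0" "star_coeff \<alpha> W k v 0 x = 0" for k v
    by (simp_all add: zero_fun_def star_coeff_zero_left star_coeff_zero_right)
  have "(\<Sum>a\<le>n. \<Sum>b\<le>n - a. star_coeff \<alpha> W (n - a - b) (fps_nth (fps_const f) a) (fps_nth (fps_const g) b) x)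
    = (\<Sum>a\<in>{0}. \<Sum>b\<le>n - a. star_coeff \<alpha> W (n - a - b) (fps_nth (fps_const f) a) (fps_nth (fps_const g) b) x)"
    by (rule sum.mono_neutral_right) (auto simp: z)
  also have "\<dots> = (\<Sum>b\<le>n. star_coeff \<alpha> W (n - b) f (fps_nth (fps_const g) b) x)" by simp
  also have "\<dots> = (\<Sum>b\<in>{0}. star_coeff \<alpha> W (n - b) f (fps_nth (fps_const g) b) x)"
    by (rule sum.mono_neutral_right) (auto simp: z)
  finally show "fps_nth (star_product \<alpha> W (fps_const f) (fps_const g)) n x = star_coeff \<alpha> W n f g x"
    by (simp add: star_product_nth fps_const_smooth assms)
qed

lemma initial_conditions_iff:
  "initial_conditions \<alpha> (star_product \<alpha> W) \<longleftrightarrow> deforms_product W \<and> starts_with_bracket W"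
  unfolding initial_conditions_def deforms_product_def starts_with_bracket_def
  by (auto simp: star_product_const times_fun_def)

text \<open>
  The associator of series is the sum of the associators of their coefficients. It proves both
  directions of the next equivalence: for constant series only the summand of \<open>(0, 0, 0)\<close> is nonzero.
\<close>

lemma associator_series:
  assumes F: "F \<in> smooth_series" and G: "G \<in> smooth_series" and H: "H \<in> smooth_series"
  shows "fps_nth (star_product \<alpha> W (star_product \<alpha> W F G) H) n x - fps_nth (star_product \<alpha> W F (star_product \<alpha> W G H)) n x
    = (\<Sum>(c, d, e)\<in>{(c, d, e). c + d + e \<le> n}. associator_coeff \<alpha> W (n - c - d - e) (fps_nth F c) (fps_nth G d) (fps_nth H e) x)"
proof -
  let ?B = "star_coeff \<alpha> W"
  have sm: "fps_nth F k \<in> smooth_functions" "fps_nth G k \<in> smooth_functions" "fps_nth H k \<in> smooth_functions" for k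
    using F G H by (auto simp: smooth_series_def)
  have l: "?B k (fps_nth (star_product \<alpha> W F G) a) v x = (\<Sum>c\<le>a. \<Sum>d\<le>a - c. ?B k (?B (a - c - d) (fps_nth F c) (fps_nth G d)) v x)" for k a v
  proof -
    have "?B k (\<lambda>y. \<Sum>c\<le>a. 1 * (\<Sum>d\<le>a - c. 1 * ?B (a - c - d) (fps_nth F c) (fps_nth G d) y)) v x
      = (\<Sum>c\<le>a. 1 * (\<Sum>d\<le>a - c. 1 * ?B k (?B (a - c - d) (fps_nth F c) (fps_nth G d)) v x))"
      by (subst star_coeff_sum_left, (intro smooth_sum smooth_cmult star_coeff_smooth sm)[1],
          subst star_coeff_sum_left) (auto intro: star_coeff_smooth sm)
    then show ?thesis by (simp add: star_product_nth[OF F G])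
  qed
  have r: "?B k v (fps_nth (star_product \<alpha> W G H) b) x = (\<Sum>d\<le>b. \<Sum>e\<le>b - d. ?B k v (?B (b - d - e) (fps_nth G d) (fps_nth H e)) x)" for k b v
  proof -
    have "?B k v (\<lambda>y. \<Sum>d\<le>b. 1 * (\<Sum>e\<le>b - d. 1 * ?B (b - d - e) (fps_nth G d) (fps_nth H e) y)) x
      = (\<Sum>d\<le>b. 1 * (\<Sum>e\<le>b - d. 1 * ?B k v (?B (b - d - e) (fps_nth G d) (fps_nth H e)) x))"
      by (subst star_coeff_sum_right, (intro smooth_sum smooth_cmult star_coeff_smooth sm)[1],
          subst star_coeff_sum_right) (auto intro: star_coeff_smooth sm)
    then show ?thesis by (simp add: star_product_nth[OF G H])
  qed
  let ?L = "\<lambda>c d e l. ?B (n - c - d - e - l) (?B l (fps_nth F c) (fps_nth G d)) (fps_nth H e) x"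
  let ?R = "\<lambda>c d e l. ?B (n - c - d - e - l) (fps_nth F c) (?B l (fps_nth G d) (fps_nth H e)) x"
  have "fps_nth (star_product \<alpha> W (star_product \<alpha> W F G) H) n x
    = (\<Sum>a\<le>n. \<Sum>b\<le>n - a. \<Sum>c\<le>a. \<Sum>d\<le>a - c. ?L c d b (a - c - d))"
    unfolding star_product_nth[OF star_product_smooth[OF F G] H] l
  proof (intro sum.cong refl)
    fix a b c d assume "a \<in> {..n}" "b \<in> {..n - a}" "c \<in> {..a}" "d \<in> {..a - c}"
    then have "n - a - b = n - c - d - b - (a - c - d)" by auto
    then show "?B (n - a - b) (?B (a - c - d) (fps_nth F c) (fps_nth G d)) (fps_nth H b) x = ?L c d b (a - c - d)" by (simp only:)
  qed
  moreover have "fps_nth (star_product \<alpha> W F (star_product \<alpha> W G H)) n x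
    = (\<Sum>a\<le>n. \<Sum>b\<le>n - a. \<Sum>d\<le>b. \<Sum>e\<le>b - d. ?R a d e (b - d - e))"
    unfolding star_product_nth[OF F star_product_smooth[OF G H]] r
  proof (intro sum.cong refl)
    fix a b d e assume "a \<in> {..n}" "b \<in> {..n - a}" "d \<in> {..b}" "e \<in> {..b - d}"
    then have "n - a - b = n - a - d - e - (b - d - e)" by auto
    then show "?B (n - a - b) (fps_nth F a) (?B (b - d - e) (fps_nth G d) (fps_nth H e)) x = ?R a d e (b - d - e)" by (simp only:)
  qed
  ultimately show ?thesis
    unfolding quadruple_sum_left[where F = ?L] quadruple_sum_right[where F = ?R] sum_subtractf[symmetric] associator_coeff_def
    by (simp add: split_def sum_subtractf)
qed

lemma associative_iff_moyal:
  "associative_product (star_product \<alpha> W) \<longleftrightarrow> (\<forall>n. moyal_equation \<alpha> W n)"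
proof
  assume a: "associative_product (star_product \<alpha> W)"
  show "\<forall>n. moyal_equation \<alpha> W n" unfolding moyal_iff
  proof (intro allI ballI)
    fix n x and f g h :: "real^'d \<Rightarrow> real" assume s: "f \<in> smooth_functions" "g \<in> smooth_functions" "h \<in> smooth_functions"
    let ?A = "\<lambda>(c, d, e). associator_coeff \<alpha> W (n - c - d - e) (fps_nth (fps_const f) c) (fps_nth (fps_const g) d) (fps_nth (fps_const h) e) x"
    have z: "associator_coeff \<alpha> W k 0 v w x = 0" "associator_coeff \<alpha> W k v 0 w x = 0" "associator_coeff \<alpha> W k v w 0 x = 0" for k v w
      by (simp_all add: associator_coeff_def zero_fun_def star_coeff_zero_left star_coeff_zero_right)
    have fin: "finite {(c, d, e). c + d + e \<le> n}"
      by (rule finite_subset[of _ "{..n} \<times> {..n} \<times> {..n}"]) auto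
    have "0 = (\<Sum>t\<in>{(c, d, e). c + d + e \<le> n}. ?A t)"
      using associator_series[OF s[THEN fps_const_smooth], of W n x] a s[THEN fps_const_smooth]
      unfolding associative_product_def by simp
    also have "\<dots> = (\<Sum>t\<in>{(0, 0, 0)}. ?A t)"
      by (rule sum.mono_neutral_right[OF fin]) (auto simp: z split: if_splits)
    finally show "associator_coeff \<alpha> W n f g h x = 0" by simp
  qed
next
  assume m: "\<forall>n. moyal_equation \<alpha> W n"
  show "associative_product (star_product \<alpha> W)" unfolding associative_product_def
  proof (intro conjI ballI star_product_smooth)
    fix F G H :: "(real^'d \<Rightarrow> real) fps"
    assume s: "F \<in> smooth_series" "G \<in> smooth_series" "H \<in> smooth_series"
    have "fps_nth (star_product \<alpha> W (star_product \<alpha> W F G) H) n x = fps_nth (star_product \<alpha> W F (star_product \<alpha> W G H)) n x" for n x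
    proof -
      have "(\<Sum>(c, d, e)\<in>{(c, d, e). c + d + e \<le> n}. associator_coeff \<alpha> W (n - c - d - e) (fps_nth F c) (fps_nth G d) (fps_nth H e) x) = 0"
        using m s unfolding moyal_iff smooth_series_def by (intro sum.neutral) auto
      then show ?thesis using associator_series[OF s, of W n x] by simp
    qed
    then show "star_product \<alpha> W (star_product \<alpha> W F G) H = star_product \<alpha> W F (star_product \<alpha> W G H)"
      by (intro fps_ext ext)
  qed
qed

lemma solution_iff:
  "W \<in> weights \<Longrightarrow> deforms_product W \<Longrightarrow> starts_with_bracket W \<Longrightarrow>
    semiclassical_solution \<alpha> (star_product \<alpha> W) \<longleftrightarrow> (\<forall>n. moyal_equation \<alpha> W n)"
  unfolding semiclassical_solution_def associative_iff_moyal initial_conditions_iff by blast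

lemma star_product_unique:
  assumes W: "deforms_product W" "starts_with_bracket W" "\<And>n. moyal_equation \<alpha> W n"
    and W': "deforms_product W'" "starts_with_bracket W'" "\<And>n. moyal_equation \<alpha> W' n"
  shows "star_product \<alpha> W = star_product \<alpha> W'"
proof -
  have eq: "star_coeff \<alpha> W n f g = star_coeff \<alpha> W' n f g" if "f \<in> smooth_functions" "g \<in> smooth_functions" for n f g
    using that
  proof (induction n arbitrary: f g rule: less_induct)
    case (less n)
    consider "n = 0" | "n = 1" | "n \<ge> 2" by linarith
    then show ?case
    proof cases
      case 3
      show ?thesis by (rule star_coeff_unique_step[OF 3 W'(1) less.IH W'(3) W(3) less.prems])
    qed (use less.prems W W' in \<open>simp_all add: deforms_product_def starts_with_bracket_def\<close>)
  qed
  show ?thesis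
  proof (intro ext)
    fix F G
    show "star_product \<alpha> W F G = star_product \<alpha> W' F G"
    proof (cases "F \<in> smooth_series \<and> G \<in> smooth_series")
      case True
      then have s: "F \<in> smooth_series" "G \<in> smooth_series" by auto
      then show ?thesis
        by (intro fps_ext) (auto simp: star_product_nth smooth_series_def eq)
    qed (auto simp: star_product_def)
  qed
qed

section \<open>Existence of a solution\<close>

lemma graph_operator_nil: "graph_operator \<alpha> [] 2 (nth [f, g]) x = f x * g x"
  by (simp add: graph_operator_def prod_vertices edges_def diff_along_foldr incoming_def numeral_2_eq_2)

lemma graph_operator_wedge: "graph_operator \<alpha> [(Bdry 0, Bdry 1)] 2 (nth [f, g]) x = bracket \<alpha> f g x"
proof -
  let ?b = "[(Bdry 0, Bdry (Suc 0))]"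
  have e: "edges [p] = [(0, False), (0, True)]" for p by (simp add: edges_def)
  have inc: "incoming ?b (Inner 0) = []" "incoming ?b (Bdry 0) = [(0, False)]" "incoming ?b (Bdry (Suc 0)) = [(0, True)]"
    by (simp_all add: incoming_def e target_def)
  have "graph_operator \<alpha> ?b 2 (nth [f, g]) x = (\<Sum>I \<in> set (edges ?b) \<rightarrow>\<^sub>E UNIV.
      \<alpha> (I (0, False)) (I (0, True)) x * pd (I (0, False)) f x * pd (I (0, True)) g x)"
    unfolding graph_operator_def by (simp add: prod_vertices numeral_2_eq_2 diff_along_foldr inc mult.assoc)
  also have "\<dots> = (\<Sum>(i, j)\<in>UNIV \<times> UNIV. \<alpha> i j x * pd i f x * pd j g x)"
    unfolding e
    by (rule sum.reindex_bij_witness[of _ "\<lambda>(i, j). restrict (\<lambda>e. if snd e then j else i) {(0, False), (0, True)}"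
          "\<lambda>I. (I (0, False), I (0, True))"]) (auto simp: fun_eq_iff PiE_def extensional_def restrict_def)
  finally show ?thesis by (simp add: bracket_def sum.cartesian_product)
qed

lemma initial_weights:
  obtains W where "W \<in> weights" "deforms_product W" "starts_with_bracket W"
proof -
  let ?b = "[(Bdry 0, Bdry (Suc 0))] :: graph"
  define W :: "graph \<Rightarrow> real" where "W \<Gamma> = of_int (class_sign [] \<Gamma>) + of_int (class_sign ?b \<Gamma>)" for \<Gamma>
  have w: "W \<in> weights"
    using class_sign_weights[of "[]"] class_sign_weights[of ?b] unfolding weights_def W_def
    by (auto simp: distrib_left)
  have nil: "[] \<in> tree_graphs 0 2" by (auto simp: tree_graphs_def edges_def acyclic_def)
  have e: "edges [p] = [(0, False), (0, True)]" for p by (simp add: edges_def)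
  have empty: "{(v, w). \<exists>b. (v, b) \<in> set (edges ?b) \<and> target ?b (v, b) = Inner w} = {}"
    by (auto simp: target_def e)
  have b: "?b \<in> tree_graphs 1 2"
    unfolding tree_graphs_def mem_Collect_eq empty by (auto simp: e target_def set_vertices acyclic_def incoming_def)
  have sum0: "(\<Sum>\<Gamma>\<in>graph_reps 0 2. W \<Gamma> * F \<Gamma>) = F []" and sum1: "(\<Sum>\<Gamma>\<in>graph_reps 1 2. W \<Gamma> * F \<Gamma>) = F ?b"
    if F: "F \<in> weights" for F
  proof -
    have "class_sign ?b \<Gamma> = 0" if "\<Gamma> \<in> graph_reps 0 2" for \<Gamma>
      using graph_reps_length[OF that] by (intro class_sign_zero) (auto dest: oriented_iso_length)
    then show "(\<Sum>\<Gamma>\<in>graph_reps 0 2. W \<Gamma> * F \<Gamma>) = F []"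
      using graph_reps_expand[OF F, of "[]" 0 2] nil by (simp add: W_def)
    have "class_sign [] \<Gamma> = 0" if "\<Gamma> \<in> graph_reps 1 2" for \<Gamma>
      using graph_reps_length[OF that] by (intro class_sign_zero) (auto dest: oriented_iso_length)
    then show "(\<Sum>\<Gamma>\<in>graph_reps 1 2. W \<Gamma> * F \<Gamma>) = F ?b"
      using graph_reps_expand[OF F, of ?b 1 2] b by (simp add: W_def)
  qed
  have op: "(\<lambda>\<Gamma>. graph_operator \<alpha> \<Gamma> 2 (nth [f, g]) x) \<in> weights" if "f \<in> smooth_functions" "g \<in> smooth_functions" for f g x
    by (rule graph_operator_weights) (use that in \<open>auto simp: less_Suc_eq numeral_2_eq_2\<close>)
  have "deforms_product W" unfolding deforms_product_def
    by (auto simp: star_coeff_operator fun_eq_iff sum0[OF op] graph_operator_nil)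
  moreover have "starts_with_bracket W" unfolding starts_with_bracket_def
    by (auto simp: star_coeff_operator fun_eq_iff sum1[OF op, simplified] graph_operator_wedge[simplified])
  ultimately show ?thesis using that w by blast
qed

text \<open>
  In order 0, multiplication of functions is associative; in order 1, the bracket is a derivation in
  both arguments.
\<close>

lemma moyal_low_orders:
  assumes W: "deforms_product W" "starts_with_bracket W" and n: "n < 2"
  shows "moyal_equation \<alpha> W n"
  unfolding moyal_iff
proof (intro ballI allI)
  fix f g h :: "real^'d \<Rightarrow> real" and x assume s: "f \<in> smooth_functions" "g \<in> smooth_functions" "h \<in> smooth_functions"
  have B0: "star_coeff \<alpha> W 0 u v = (\<lambda>y. u y * v y)" and B1: "star_coeff \<alpha> W (Suc 0) u v = bracket \<alpha> u v"
    if "u \<in> smooth_functions" "v \<in> smooth_functions" for u v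
    using W that by (simp_all add: deforms_product_def starts_with_bracket_def)
  have L: "bracket \<alpha> (\<lambda>y. u y * v y) w x = u x * bracket \<alpha> v w x + v x * bracket \<alpha> u w x"
    if "u \<in> smooth_functions" "v \<in> smooth_functions" for u v w
    using that by (simp add: bracket_def pd_mult sum_distrib_left sum.distrib[symmetric] algebra_simps)
  have R: "bracket \<alpha> w (\<lambda>y. u y * v y) x = u x * bracket \<alpha> w v x + v x * bracket \<alpha> w u x"
    if "u \<in> smooth_functions" "v \<in> smooth_functions" for u v w
    using that by (simp add: bracket_def pd_mult sum_distrib_left sum.distrib[symmetric] algebra_simps)
  show "associator_coeff \<alpha> W n f g h x = 0"
  proof (cases "n = 0")
    case True
    then show ?thesis by (simp add: associator_coeff_def B0 s smooth_mult mult.assoc)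
  next
    case False
    then have "n = 1" using n by simp
    then show ?thesis
      by (simp add: associator_coeff_def B0 B1 s smooth_mult bracket_smooth L R algebra_simps)
  qed
qed

definition solves_below :: "nat \<Rightarrow> (graph \<Rightarrow> real) \<Rightarrow> bool" where
  "solves_below n W \<longleftrightarrow> W \<in> weights \<and> deforms_product W \<and> starts_with_bracket W \<and> (\<forall>k<n. moyal_equation \<alpha> W k)"

lemma initial_data_cong:
  assumes "\<And>\<Gamma>. length \<Gamma> < 2 \<Longrightarrow> W' \<Gamma> = W \<Gamma>"
  shows "deforms_product W' \<longleftrightarrow> deforms_product W" "starts_with_bracket W' \<longleftrightarrow> starts_with_bracket W"
proof -
  have "star_coeff \<alpha> W' k f g = star_coeff \<alpha> W k f g" if "k < 2" for k f g
    by (rule star_coeff_cong) (use that in \<open>simp add: assms graph_reps_length\<close>)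
  then show "deforms_product W' \<longleftrightarrow> deforms_product W" "starts_with_bracket W' \<longleftrightarrow> starts_with_bracket W"
    by (simp_all add: deforms_product_def starts_with_bracket_def)
qed

lemma solves_below_step:
  assumes W: "solves_below n W" and n: "n \<ge> 2"
  obtains W' where "solves_below (Suc n) W'" "\<And>\<Gamma>. length \<Gamma> \<noteq> n \<Longrightarrow> W' \<Gamma> = W \<Gamma>"
proof -
  obtain W' where W': "W' \<in> weights" "\<And>\<Gamma>. length \<Gamma> \<noteq> n \<Longrightarrow> W' \<Gamma> = W \<Gamma>" "moyal_equation \<alpha> W' n"
    using weights_correction_step[OF n] W unfolding solves_below_def by metis
  have "moyal_equation \<alpha> W' k" if "k < n" for k
    using moyal_equation_cong[of k W' W \<alpha>] W'(2) W that by (auto simp: solves_below_def)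
  then have "\<forall>k<Suc n. moyal_equation \<alpha> W' k" using W'(3) by (auto simp: less_Suc_eq)
  moreover have "deforms_product W'" "starts_with_bracket W'"
    using initial_data_cong[of W' W] W'(2) W n by (auto simp: solves_below_def)
  ultimately show ?thesis using that W' by (simp add: solves_below_def)
qed

text \<open>
  Successive corrections only change the weights of larger and larger graphs, so they converge.
\<close>

lemma solution_exists:
  obtains W where "W \<in> weights" "deforms_product W" "starts_with_bracket W" "\<And>n. moyal_equation \<alpha> W n"
proof -
  have "\<exists>w. \<forall>n. solves_below (n + 2) (w n) \<and> (\<forall>\<Gamma>. length \<Gamma> \<noteq> n + 2 \<longrightarrow> w (Suc n) \<Gamma> = w n \<Gamma>)"
  proof (rule dependent_nat_choice)
    show "\<exists>W. solves_below (0 + 2) W"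
      using initial_weights moyal_low_orders unfolding solves_below_def by (metis add_0)
    show "\<exists>W'. solves_below (Suc n + 2) W' \<and> (\<forall>\<Gamma>. length \<Gamma> \<noteq> n + 2 \<longrightarrow> W' \<Gamma> = W \<Gamma>)"
      if "solves_below (n + 2) W" for W n
      by (rule solves_below_step[OF that]) auto
  qed
  then obtain w where w: "\<And>n. solves_below (n + 2) (w n)"
    "\<And>n \<Gamma>. length \<Gamma> \<noteq> n + 2 \<Longrightarrow> w (Suc n) \<Gamma> = w n \<Gamma>" by blast
  have stable: "w (m + k) \<Gamma> = w m \<Gamma>" if "length \<Gamma> < m + 2" for m k \<Gamma>
    by (induction k) (use w(2)[of \<Gamma>] that in auto)
  \<comment> \<open>Only the weights of graphs with \<open>m + 2\<close> vertices differ between \<open>w m\<close> and \<open>w (Suc m)\<close>, so \<open>w n\<close> is final on graphs with at most \<open>n\<close> vertices.\<close>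
  define W where "W \<Gamma> = w (length \<Gamma>) \<Gamma>" for \<Gamma>
  have W: "W \<Gamma> = w n \<Gamma>" if "length \<Gamma> \<le> n" for \<Gamma> n
    using stable[of \<Gamma> "length \<Gamma>" "n - length \<Gamma>"] that by (simp add: W_def)
  have "W \<in> weights"
    using w(1) unfolding weights_def W_def solves_below_def by (auto simp: oriented_iso_length)
  moreover have "moyal_equation \<alpha> W n" for n
    using moyal_equation_cong[of n W "w n" \<alpha>] W w(1)[of n] by (auto simp: solves_below_def)
  moreover have "deforms_product W" "starts_with_bracket W"
    using initial_data_cong[of W "w 2"] W w(1)[of 2] by (auto simp: solves_below_def)
  ultimately show ?thesis using that by blast
qed

end

section \<open>The semi-classical star-product\<close>

theorem theorem7p1:
  fixes c :: "'d::finite \<Rightarrow> 'd \<Rightarrow> 'd \<Rightarrow> real"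
    and \<alpha> :: "'d bivector"
  assumes "\<alpha> = linear_bivector c"
    and "poisson_structure \<alpha>"
  shows
    "(\<exists>!star. semiclassical_solution \<alpha> star)
     \<and> (\<forall>W\<in>weights. initial_conditions \<alpha> (star_product \<alpha> W) \<longrightarrow>
          (semiclassical_solution \<alpha> (star_product \<alpha> W) \<longleftrightarrow> (\<forall>n. moyal_equation \<alpha> W n)))
     \<and> (\<forall>n\<ge>2. \<forall>W\<in>weights. \<forall>W'\<in>weights.
          W [] = 1 \<and> W' [] = 1 \<and> agree_below n W W'
          \<and> (\<forall>\<Gamma>\<in>graph_reps n 3. weight_coproduct W \<Gamma> = weight_coproduct W' \<Gamma>)
          \<longrightarrow> (\<forall>\<Gamma>\<in>graph_reps n 2. W \<Gamma> = W' \<Gamma>))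
     \<and> (\<forall>n\<ge>2. \<forall>W\<in>weights.
          initial_conditions \<alpha> (star_product \<alpha> W) \<and> (\<forall>k<n. moyal_equation \<alpha> W k) \<longrightarrow>
          (\<exists>W'\<in>weights. agree_below n W W' \<and> moyal_equation \<alpha> W' n)
          \<and> (\<forall>W\<^sub>1\<in>weights. \<forall>W\<^sub>2\<in>weights.
               agree_below n W W\<^sub>1 \<and> moyal_equation \<alpha> W\<^sub>1 n
               \<and> agree_below n W W\<^sub>2 \<and> moyal_equation \<alpha> W\<^sub>2 n \<longrightarrow>
               (\<forall>f\<in>smooth_functions. \<forall>g\<in>smooth_functions.
                  star_coeff \<alpha> W\<^sub>1 n f g = star_coeff \<alpha> W\<^sub>2 n f g)))"
proof -
  interpret linear_poisson c \<alpha> using assms by unfold_locales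
  show ?thesis
  proof (intro conjI)
    obtain W where W: "W \<in> weights" "deforms_product W" "starts_with_bracket W" "\<And>n. moyal_equation \<alpha> W n"
      by (rule solution_exists) (rule that)
    show "\<exists>!star. semiclassical_solution \<alpha> star"
    proof (rule ex1I)
      show "semiclassical_solution \<alpha> (star_product \<alpha> W)" using solution_iff W by blast
      fix star assume s: "semiclassical_solution \<alpha> star"
      then obtain W' where W': "star = star_product \<alpha> W'" unfolding semiclassical_solution_def by blast
      have "deforms_product W'" "starts_with_bracket W'" "\<And>n. moyal_equation \<alpha> W' n"
        using s unfolding semiclassical_solution_def W' associative_iff_moyal initial_conditions_iff by blast+
      then show "star = star_product \<alpha> W" unfolding W' using W(2-4) by (rule star_product_unique)
    qed
  next
    show "\<forall>W\<in>weights. initial_conditions \<alpha> (star_product \<alpha> W) \<longrightarrow>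
          (semiclassical_solution \<alpha> (star_product \<alpha> W) \<longleftrightarrow> (\<forall>n. moyal_equation \<alpha> W n))"
      using solution_iff initial_conditions_iff by blast
  next
    show "\<forall>n\<ge>2. \<forall>W\<in>weights. \<forall>W'\<in>weights.
          W [] = 1 \<and> W' [] = 1 \<and> agree_below n W W'
          \<and> (\<forall>\<Gamma>\<in>graph_reps n 3. weight_coproduct W \<Gamma> = weight_coproduct W' \<Gamma>)
          \<longrightarrow> (\<forall>\<Gamma>\<in>graph_reps n 2. W \<Gamma> = W' \<Gamma>)"
      using coproduct_determines_weights by blast
  next
    show "\<forall>n\<ge>2. \<forall>W\<in>weights.
          initial_conditions \<alpha> (star_product \<alpha> W) \<and> (\<forall>k<n. moyal_equation \<alpha> W k) \<longrightarrow>
          (\<exists>W'\<in>weights. agree_below n W W' \<and> moyal_equation \<alpha> W' n)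
          \<and> (\<forall>W\<^sub>1\<in>weights. \<forall>W\<^sub>2\<in>weights.
               agree_below n W W\<^sub>1 \<and> moyal_equation \<alpha> W\<^sub>1 n
               \<and> agree_below n W W\<^sub>2 \<and> moyal_equation \<alpha> W\<^sub>2 n \<longrightarrow>
               (\<forall>f\<in>smooth_functions. \<forall>g\<in>smooth_functions.
                  star_coeff \<alpha> W\<^sub>1 n f g = star_coeff \<alpha> W\<^sub>2 n f g))"
    proof (intro allI ballI impI conjI)
      fix n :: nat and W assume n: "2 \<le> n" and Ww: "W \<in> weights"
        and A: "initial_conditions \<alpha> (star_product \<alpha> W) \<and> (\<forall>k<n. moyal_equation \<alpha> W k)"
      have W: "deforms_product W" "starts_with_bracket W" using A initial_conditions_iff by blast+
      obtain W' where W': "W' \<in> weights" "\<And>\<Gamma>. length \<Gamma> \<noteq> n \<Longrightarrow> W' \<Gamma> = W \<Gamma>" "moyal_equation \<alpha> W' n"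
        using weights_correction_step[OF n Ww W] A by metis
      then show "\<exists>W'\<in>weights. agree_below n W W' \<and> moyal_equation \<alpha> W' n"
        by (intro bexI[of _ W']) (auto simp: agree_below_def graph_reps_length)
      fix W\<^sub>1 W\<^sub>2 and f g :: "real^'d \<Rightarrow> real"
      assume B: "agree_below n W W\<^sub>1 \<and> moyal_equation \<alpha> W\<^sub>1 n \<and> agree_below n W W\<^sub>2 \<and> moyal_equation \<alpha> W\<^sub>2 n"
        and s: "f \<in> smooth_functions" "g \<in> smooth_functions"
      have eq: "star_coeff \<alpha> W\<^sub>1 k u v = star_coeff \<alpha> W k u v" "star_coeff \<alpha> W\<^sub>2 k u v = star_coeff \<alpha> W k u v" if "k < n" for k u v
        using B that by (auto simp: agree_below_def intro!: star_coeff_cong)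
      have "deforms_product W\<^sub>2" using W(1) n by (simp add: deforms_product_def eq)
      then show "star_coeff \<alpha> W\<^sub>1 n f g = star_coeff \<alpha> W\<^sub>2 n f g"
        by (rule star_coeff_unique_step[OF n]) (use B s eq in auto)
    qed
  qed
qed

end
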